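(* Let $\alpha(x)=\sum_{n=0}^\infty\Big(\sum_{k=0}^n\binom{n}{k}^2\binom{n+k}{n}^2\Big)x^n\in\mathbb{Z}[[x]]$ and let $\xi(x)=x(x^2-34x+1)^{1/2}\alpha(x)$. The $G$-function $\xi$ cannot be written as a polynomial with coefficients in $\overline{\mathbb{Q}}$ of functions of the form ${}_pF_{p-1}[a_1,\dots,a_p;b_1,\dots,b_{p-1};\gamma x^m]$, with $p\ge1$, $a_j\in\mathbb{Q}$, $b_j\in\mathbb{Q}\setminus\mathbb{Z}_{\le0}$, $\gamma\in\overline{\mathbb{Q}}^*$, $m\in\mathbb{Z}^*=\mathbb{Z}\setminus\{0\}$. (Here the parameters $a_j,b_j$ and the values of $\gamma$, $p$ and $m$ may vary among the functions occurring in the polynomial.)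
   Context: $\overline{\mathbb{Q}}\subset\mathbb{C}$ is the field of algebraic numbers. A $G$-function is a power series $F(x)=\sum_{n\ge0}a_nx^n\in\overline{\mathbb{Q}}[[x]]$ such that: (i) $F$ is a solution of a non-zero linear differential equation with coefficients in $\overline{\mathbb{Q}}(x)$; (ii) there is $C>0$ such that $|\sigma(a_n)|\le C^{n+1}$ for all $\sigma\in\mathrm{Gal}(\overline{\mathbb{Q}}/\mathbb{Q})$ and $n\ge0$; (iii) there are $D>0$ and integers $d_n$ with $1\le d_n\le D^{n+1}$ such that $d_na_m$ is an algebraic integer for all $m\le n$. The generalized hypergeometric series is $${}_pF_{p-1}[a_1,\dots,a_p;b_1,\dots,b_{p-1};x]=\sum_{n=0}^\infty\frac{(a_1)_n\cdots(a_p)_n}{(1)_n(b_1)_n\cdots(b_{p-1})_n}x^n,$$ where $(a)_0=1$ and $(a)_n=a(a+1)\cdots(a+n-1)$ for $n\ge1$; empty products equal $1$. Near $x=0$, $(x^2-34x+1)^{1/2}$ is the power series with constant term $1$. Functions are understood, after analytic continuation where necessary (e.g. when $m<0$), as analytic functions on a common nonempty connected open subset of $\mathbb{C}$, and an identity between them means an identity on such a set. *)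

theory Defs
  imports
    "HOL-Complex_Analysis.Complex_Analysis"
    "HOL-Computational_Algebra.Computational_Algebra"
    "HOL-Library.Poly_Mapping"
begin

section \<open>G-functions\<close>

definition Qbar :: "complex set"
  where "Qbar = {z. algebraic z}"

text \<open>Only the values on \<^const>\<open>Qbar\<close> of an element of the Galois group matter.\<close>

definition Gal_Qbar :: "(complex \<Rightarrow> complex) set"
  where "Gal_Qbar = {\<sigma>. bij_betw \<sigma> Qbar Qbar \<and>
     (\<forall>x\<in>Qbar. \<forall>y\<in>Qbar. \<sigma> (x + y) = \<sigma> x + \<sigma> y) \<and>
     (\<forall>x\<in>Qbar. \<forall>y\<in>Qbar. \<sigma> (x * y) = \<sigma> x * \<sigma> y) \<and>
     (\<forall>q\<in>\<rat>. \<sigma> q = q)}"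

text \<open>The field of rational functions over \<^const>\<open>Qbar\<close>, embedded in the field of Laurent series
  at the origin.\<close>

definition Qbar_ratfuns :: "complex fls set"
  where "Qbar_ratfuns = {fps_to_fls (fps_of_poly p) / fps_to_fls (fps_of_poly q) | p q.
     (\<forall>i. coeff p i \<in> Qbar) \<and> (\<forall>i. coeff q i \<in> Qbar) \<and> q \<noteq> 0}"

definition G_function :: "complex fps \<Rightarrow> bool"
  where "G_function F \<longleftrightarrow>
     (\<forall>n. fps_nth F n \<in> Qbar) \<and>
     (\<exists>(r::nat) c. (\<forall>j\<le>r. c j \<in> Qbar_ratfuns) \<and> (\<exists>j\<le>r. c j \<noteq> 0) \<and>
        (\<Sum>j\<le>r. c j * (fls_deriv ^^ j) (fps_to_fls F)) = 0) \<and>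
     (\<exists>C::real. C > 0 \<and> (\<forall>\<sigma>\<in>Gal_Qbar. \<forall>n. norm (\<sigma> (fps_nth F n)) \<le> C ^ (n + 1))) \<and>
     (\<exists>(D::real) (d :: nat \<Rightarrow> int). D > 0 \<and>
        (\<forall>n. 1 \<le> d n \<and> of_int (d n) \<le> D ^ (n + 1) \<and>
          (\<forall>m\<le>n. algebraic_int (of_int (d n) * fps_nth F m))))"

section \<open>Analytic continuation\<close>

definition function_element :: "(complex \<Rightarrow> complex) \<Rightarrow> complex set \<Rightarrow> bool"
  where "function_element f U \<longleftrightarrow> open U \<and> connected U \<and> U \<noteq> {} \<and> f holomorphic_on U"

text \<open>
  \<open>analytic_continuation_of f U g V\<close>: the function element \<open>(g, V)\<close> arises from \<open>(f, U)\<close> by a finite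
  chain of direct continuations, i.e. by continuation along some path. Two consecutive elements
  only have to agree on some nonempty open part \<open>D\<close> of the intersection of their domains, which need
  not be connected, so \<open>(g, V)\<close> may be any branch.
\<close>

inductive analytic_continuation_of ::
  "(complex \<Rightarrow> complex) \<Rightarrow> complex set \<Rightarrow> (complex \<Rightarrow> complex) \<Rightarrow> complex set \<Rightarrow> bool"
  for f :: "complex \<Rightarrow> complex" and U :: "complex set"
  where
    refl: "function_element f U \<Longrightarrow> analytic_continuation_of f U f U"
  | step: "analytic_continuation_of f U g V \<Longrightarrow> function_element h W \<Longrightarrow>
      open D \<Longrightarrow> D \<noteq> {} \<Longrightarrow> D \<subseteq> V \<inter> W \<Longrightarrow> (\<And>z. z \<in> D \<Longrightarrow> g z = h z) \<Longrightarrow>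
      analytic_continuation_of f U h W"

lemma analytic_continuation_of_function_element:
  "analytic_continuation_of f U g V \<Longrightarrow> function_element g V"
  by (erule analytic_continuation_of.cases) auto

definition fps_branch :: "complex fps \<Rightarrow> (complex \<Rightarrow> complex) \<Rightarrow> complex set \<Rightarrow> bool"
  where "fps_branch F g U \<longleftrightarrow>
     analytic_continuation_of (eval_fps F) (eball 0 (fps_conv_radius F)) g U"

lemma function_element_eval_fps:
  assumes "fps_conv_radius F > 0"
  shows "function_element (eval_fps F) (eball 0 (fps_conv_radius F))"
proof -
  have "connected (eball (0::complex) (fps_conv_radius F))"
    by (cases "fps_conv_radius F") auto
  moreover have "(0::complex) \<in> eball 0 (fps_conv_radius F)"
    using assms by (simp add: eball_def zero_ereal_def)
  ultimately show ?thesis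
    unfolding function_element_def
    by (blast intro: open_eball holomorphic_on_eval_fps)
qed

section \<open>Hypergeometric functions of a monomial\<close>

text \<open>
  In \<^const>\<open>fps_hypergeo\<close> the factor \<open>(1)\<^sub>n = n!\<close> of the denominator is implicit and the last
  argument scales the variable; here it is \<open>1\<close>. A negative \<open>m\<close> amounts to starting from a
  neighbourhood of infinity; the origin has to be excluded explicitly as \<open>0 powi m = 0\<close> in that case.
\<close>

definition hypergeo_branch ::
  "complex list \<Rightarrow> complex list \<Rightarrow> complex \<Rightarrow> int \<Rightarrow> (complex \<Rightarrow> complex) \<Rightarrow> complex set \<Rightarrow> bool"
  where "hypergeo_branch as bs \<gamma> m g U \<longleftrightarrow>
     (let F = fps_hypergeo as bs 1
      in analytic_continuation_of (\<lambda>x. eval_fps F (\<gamma> * x powi m))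
           {x. (m < 0 \<longrightarrow> x \<noteq> 0) \<and> \<gamma> * x powi m \<in> eball 0 (fps_conv_radius F)} g U)"

definition admissible_branch :: "(complex \<Rightarrow> complex) \<Rightarrow> complex set \<Rightarrow> bool"
  where "admissible_branch g U \<longleftrightarrow>
     (\<exists>p as bs \<gamma> m. p \<ge> 1 \<and> length as = p \<and> length bs = p - 1 \<and>
        set as \<subseteq> \<rat> \<and> set bs \<subseteq> \<rat> - \<int>\<^sub>\<le>\<^sub>0 \<and> \<gamma> \<in> Qbar \<and> \<gamma> \<noteq> 0 \<and> m \<noteq> 0 \<and>
        hypergeo_branch as bs \<gamma> m g U)"

section \<open>Polynomials in several variables\<close>

text \<open>A polynomial in the variables \<open>X\<^sub>i\<close>, \<open>i :: nat\<close>, maps each monomial to its coefficient, where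
  a monomial maps each variable to its exponent.\<close>

type_synonym cmpoly = "(nat \<Rightarrow>\<^sub>0 nat) \<Rightarrow>\<^sub>0 complex"

definition Qbar_mpoly :: "nat \<Rightarrow> cmpoly set"
  where "Qbar_mpoly N = {P. (\<forall>e. Poly_Mapping.lookup P e \<in> Qbar) \<and> (\<forall>e\<in>Poly_Mapping.keys P. Poly_Mapping.keys e \<subseteq> {..<N})}"

definition eval_mpoly :: "cmpoly \<Rightarrow> (nat \<Rightarrow> complex) \<Rightarrow> complex"
  where "eval_mpoly P v = (\<Sum>e\<in>Poly_Mapping.keys P. Poly_Mapping.lookup P e * (\<Prod>i\<in>Poly_Mapping.keys e. v i ^ Poly_Mapping.lookup e i))"

section \<open>The series \<open>\<xi>\<close>\<close>

definition apery_fps :: "complex fps"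
  where "apery_fps = Abs_fps (\<lambda>n. of_nat (\<Sum>k\<le>n. (n choose k)\<^sup>2 * ((n + k) choose n)\<^sup>2))"

definition apery_sqrt_fps :: "complex fps"
  where "apery_sqrt_fps = fps_radical (\<lambda>_ _. 1) 2 (fps_X\<^sup>2 - 34 * fps_X + 1)"

lemma apery_sqrt_fps_unique:
  "s = apery_sqrt_fps \<longleftrightarrow> s\<^sup>2 = fps_X\<^sup>2 - 34 * fps_X + 1 \<and> fps_nth s 0 = 1"
proof -
  let ?b = "fps_X\<^sup>2 - 34 * fps_X + 1 :: complex fps"
  have b0: "fps_nth ?b 0 = 1"
    by (simp add: power2_eq_square)
  have *: "fps_nth s 0 = 1 \<Longrightarrow> s\<^sup>2 = ?b \<longleftrightarrow> s = apery_sqrt_fps"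
    using radical_unique[of "\<lambda>_ _. 1" 1 ?b s]
    by (simp add: b0 apery_sqrt_fps_def numeral_2_eq_2)
  have "fps_nth apery_sqrt_fps 0 = 1"
    by (simp add: apery_sqrt_fps_def)
  with * show ?thesis
    by auto
qed

definition xi_fps :: "complex fps"
  where "xi_fps = fps_X * apery_sqrt_fps * apery_fps"

lemma fps_conv_radius_xi_fps_pos: "fps_conv_radius xi_fps > 0"
proof -
  let ?g = "\<lambda>x::complex. csqrt (x\<^sup>2 - 34 * x + 1)"
  let ?G = "fps_expansion ?g 0"
  have "?g analytic_on {0}"
    by (auto intro!: analytic_intros)
  hence G: "?g has_fps_expansion ?G"
    by (rule analytic_at_imp_has_fps_expansion_0)
  have "(\<lambda>x. ?g x ^ 2) has_fps_expansion ?G\<^sup>2"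
    by (intro fps_expansion_intros G)
  moreover have "(\<lambda>x::complex. x\<^sup>2 - 34 * x + 1) has_fps_expansion (fps_X\<^sup>2 - 34 * fps_X + 1)"
    by (intro fps_expansion_intros)
  ultimately have "?G\<^sup>2 = fps_X\<^sup>2 - 34 * fps_X + 1"
    by (simp add: fps_expansion_unique_complex)
  moreover have "fps_nth ?G 0 = 1"
    using has_fps_expansion_imp_0_eq_fps_nth_0[OF G] by simp
  ultimately have "?G = apery_sqrt_fps"
    by (simp add: apery_sqrt_fps_unique)
  hence 1: "fps_conv_radius apery_sqrt_fps > 0"
    using G by (simp add: has_fps_expansion_def)
  have le: "(\<Sum>k\<le>n. (n choose k)\<^sup>2 * ((n + k) choose n)\<^sup>2) \<le> 128 ^ n" for n :: nat
  proof -
    have "(\<Sum>k\<le>n. (n choose k)\<^sup>2 * ((n + k) choose n)\<^sup>2) \<le> (\<Sum>k\<le>n. (2 ^ n)\<^sup>2 * (2 ^ (2 * n))\<^sup>2)"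
    proof (intro sum_mono mult_mono power_mono)
      fix k assume "k \<in> {..n}"
      have "(n + k) choose n \<le> 2 ^ (n + k)"
        by (rule binomial_le_pow2)
      also have "\<dots> \<le> 2 ^ (2 * n)"
        using \<open>k \<in> {..n}\<close> by (intro power_increasing) auto
      finally show "(n + k) choose n \<le> 2 ^ (2 * n)" .
    qed (auto simp: binomial_le_pow2)
    also have "\<dots> = (n + 1) * 64 ^ n"
      by (simp add: power_mult power2_eq_square flip: power_mult_distrib)
    also have "\<dots> \<le> 2 ^ n * 64 ^ n"
      by (intro mult_right_mono) (auto simp: Suc_leI)
    also have "\<dots> = 128 ^ n"
      by (simp flip: power_mult_distrib)
    finally show ?thesis .
  qed
  have "summable (\<lambda>n. fps_nth apery_fps n * (1 / 256) ^ n)"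
  proof (rule summable_comparison_test')
    show "summable (\<lambda>n. (1 / 2 :: real) ^ n)"
      by (rule summable_geometric) simp
    fix n :: nat
    have "norm (fps_nth apery_fps n) \<le> real (128 ^ n)"
      unfolding apery_fps_def fps_nth_Abs_fps norm_of_nat of_nat_le_iff by (rule le)
    hence "norm (fps_nth apery_fps n) * (1 / 256) ^ n \<le> real (128 ^ n) * (1 / 256) ^ n"
      by (intro mult_right_mono) auto
    also have "\<dots> = (1 / 2) ^ n"
      by (simp flip: power_mult_distrib)
    finally show "norm (fps_nth apery_fps n * (1 / 256) ^ n) \<le> (1 / 2) ^ n"
      by (simp add: norm_mult norm_power norm_divide)
  qed
  hence "fps_conv_radius apery_fps \<ge> norm (1 / 256 :: complex)"
    unfolding fps_conv_radius_def by (rule conv_radius_geI)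
  hence 2: "fps_conv_radius apery_fps > 0"
    by (rule less_le_trans[rotated]) (simp add: norm_divide)
  have 3: "min (fps_conv_radius (fps_X * apery_sqrt_fps)) (fps_conv_radius apery_fps)
             \<le> fps_conv_radius xi_fps"
    unfolding xi_fps_def by (rule fps_conv_radius_mult)
  have "fps_conv_radius (fps_X * apery_sqrt_fps) \<ge> fps_conv_radius apery_sqrt_fps"
    using fps_conv_radius_mult[of fps_X apery_sqrt_fps] by simp
  with 1 2 3 show ?thesis
    by (meson less_le_trans min_less_iff_conj)
qed

end

theory Submission
  imports Defs
begin

text \<open>
  The obstruction is monodromy. In the variable \<open>x = e\<^sup>t\<close> a hypergeometric function of \<open>\<gamma> x\<^sup>m\<close> solves a
  linear differential equation whose only singularities are the points with \<open>\<gamma> e\<^bsup>mt\<^esup> = 1\<close>. They lie on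
  one vertical line, so at most one of the singular points \<open>\<plusminus>L\<close>, \<open>L = ln (17 + 12 \<surd>2)\<close>, of the equation
  of \<open>\<alpha>\<close> is among them. Continuation around \<open>-L\<close> therefore commutes with continuation around \<open>L\<close> for
  each such function, hence for every polynomial in them, and also for \<open>x\<^sup>-\<^sup>1 (x\<^sup>2 - 34 x + 1)\<^bsup>-1/2\<^esup>\<close>.
  If \<open>\<xi>\<close> were such a polynomial, the two monodromies \<open>m\<^sub>1\<close>, \<open>m\<^sub>2\<close> would commute on \<open>\<alpha>\<close>.

  The equation of \<open>\<alpha>\<close> has order three, and its solutions become holomorphic near \<open>\<plusminus>L\<close> after the
  substitution \<open>t = \<plusminus>L + w\<^sup>2\<close>, where the monodromy acts by \<open>w \<mapsto> -w\<close>. The equation is a symmetric square,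
  so it has a quadratic first integral \<open>J\<close>. By a barrier argument for \<open>J = 1/2\<close> on the real interval
  from \<open>-L\<close> to \<open>L\<close>, a solution that is odd in \<open>w\<close> at \<open>-L\<close> is positive there up to scaling and its growth
  prevents it from being odd or even at \<open>L\<close>, unless it vanishes. Applied to \<open>(1 - m\<^sub>1) (1 - m\<^sub>2) \<alpha>\<close>, which is odd
  at both points, and then to \<open>(1 - m\<^sub>1) \<alpha>\<close>, which is then odd at \<open>-L\<close> and even at \<open>L\<close>, this
  shows that \<open>\<alpha>\<close> is even at \<open>-L\<close>. But then \<open>J\<close> would be negative at \<open>-L\<close>, as \<open>\<alpha>\<close> has positive coefficients,
  whereas \<open>J = 0\<close> for \<open>\<alpha>\<close>, as one sees at \<open>x = 0\<close>.
\<close>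


section \<open>Linear differential equations in the complex domain\<close>

text \<open>No paths and no monodromy group are formed. All functions live on a thin strip
  \<open>0 < Im t < e\<close>, so low that it contains no singular point of any equation involved,
  while \<open>-L\<close> and \<open>L\<close> lie on its border; a local monodromy is a relation
  between functions on this strip. Since the strip and the half discs are convex, every continuation
  is a Cauchy problem on a convex set.

  A first obstacle is that the assumed identity may hold on any branch of \<open>\<xi>\<close>, over
  any open set. It is brought back to the origin along the given chain of continuations. This works
  because \<open>\<xi>\<close> is single-valued on each domain of the chain, while of the other
  functions one only asks for some solutions of their equations at each place, not for their own
  continuation.

  A second is the square root, which is singular at both points. It is split into
  \<open>(1 - exp (t - L))^(-1/2)\<close> and \<open>(1 - exp (t + L))^(-1/2)\<close>, each singular
  at only one of the two.

  A third is to refute commutation without knowing the monodromy matrices; hence the real growth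
  estimate, which needs only signs.\<close>

lemma primitive_with_value:
  fixes f :: "complex \<Rightarrow> complex"
  assumes "open S" "convex S" "f holomorphic_on S" "z0 \<in> S"
  shows "\<exists>g. g z0 = 0 \<and> (\<forall>z\<in>S. (g has_field_derivative f z) (at z))"
proof -
  obtain g where g: "\<And>x. x \<in> S \<Longrightarrow> (g has_field_derivative f x) (at x within S)"
    using holomorphic_convex_primitive'[OF assms(2,1,3)] by blast
  have "((\<lambda>x. g x - g z0) has_field_derivative f z) (at z)" if "z \<in> S" for z
  proof -
    have "(g has_field_derivative f z) (at z)"
      using g[OF that] at_within_open[OF that assms(1)] by simp
    thus ?thesis by (auto intro!: derivative_eq_intros)
  qed
  thus ?thesis
    by (intro exI[of _ "\<lambda>x. g x - g z0"]) auto
qed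

text \<open>Integration along the segment from \<open>z0\<close> raises the exponent by one and
  gains the factor \<open>1 / (n + 1)\<close>. Iterated, this produces the factorial in the Picard
  estimate below.\<close>

lemma primitive_power_bound:
  fixes g :: "complex \<Rightarrow> complex"
  assumes "convex K" "z0 \<in> K" "z \<in> K" "g z0 = 0"
    and der: "\<And>x. x \<in> K \<Longrightarrow> (g has_field_derivative f x) (at x)"
    and bd: "\<And>x. x \<in> K \<Longrightarrow> norm (f x) \<le> C * norm (x - z0) ^ n"
  shows "norm (g z) \<le> C * norm (z - z0) ^ Suc n / of_nat (Suc n)"
proof -
  define d where "d = norm (z - z0)"
  define h where "h = (\<lambda>s::real. g (z0 + s *\<^sub>R (z - z0)))"
  define h' where "h' = (\<lambda>s::real. f (z0 + s *\<^sub>R (z - z0)) * (z - z0))"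
  define \<phi> where "\<phi> = (\<lambda>s::real. C * d ^ Suc n / of_nat (Suc n) * s ^ Suc n)"
  define \<phi>' where "\<phi>' = (\<lambda>s::real. C * d ^ Suc n * s ^ n)"
  have inK: "z0 + s *\<^sub>R (z - z0) \<in> K" if "s \<in> {0..1}" for s
  proof -
    have "(1 - s) *\<^sub>R z0 + s *\<^sub>R z \<in> K"
      using that assms(1-3) by (intro convexD) auto
    thus ?thesis by (simp add: algebra_simps)
  qed
  have hder: "(h has_vector_derivative h' s) (at s)" if "s \<in> {0..1}" for s
  proof -
    have *: "((\<lambda>s. z0 + s *\<^sub>R (z - z0)) has_vector_derivative (z - z0)) (at s)"
      by (auto intro!: derivative_eq_intros)
    from field_vector_diff_chain_at[OF * der[OF inK[OF that]]] show ?thesis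
      unfolding h_def h'_def o_def by (simp add: mult.commute)
  qed
  have \<phi>der: "(\<phi> has_vector_derivative \<phi>' s) (at s)" for s
  proof -
    have "(\<phi> has_real_derivative C * d ^ Suc n / real (Suc n) * (real (Suc n) * s ^ (Suc n - Suc 0))) (at s)"
      unfolding \<phi>_def by (intro DERIV_cmult DERIV_pow)
    also have "C * d ^ Suc n / real (Suc n) * (real (Suc n) * s ^ (Suc n - Suc 0)) = \<phi>' s"
      unfolding \<phi>'_def by simp
    finally show ?thesis by (simp add: has_real_derivative_iff_has_vector_derivative)
  qed
  have "norm (h 1 - h 0) \<le> \<phi> 1 - \<phi> 0"
  proof (rule differentiable_bound_general[where f' = h' and \<phi>' = \<phi>'])
    show "continuous_on {0..1} h"
      using hder has_vector_derivative_continuous by (intro continuous_at_imp_continuous_on) blast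
    show "continuous_on {0..1} \<phi>"
      using \<phi>der has_vector_derivative_continuous by (intro continuous_at_imp_continuous_on) blast
    fix s :: real assume s: "0 < s" "s < 1"
    show "(h has_vector_derivative h' s) (at s)" using hder s by auto
    show "(\<phi> has_vector_derivative \<phi>' s) (at s)" by (rule \<phi>der)
    have "norm (h' s) = norm (f (z0 + s *\<^sub>R (z - z0))) * d"
      by (simp add: h'_def norm_mult d_def)
    also have "\<dots> \<le> (C * norm (z0 + s *\<^sub>R (z - z0) - z0) ^ n) * d"
      using s by (intro mult_right_mono bd inK) (auto simp: d_def)
    also have "\<dots> = \<phi>' s"
      using s by (simp add: \<phi>'_def d_def power_mult_distrib)
    finally show "norm (h' s) \<le> \<phi>' s" .
  qed auto
  thus ?thesis
    using assms(4) by (simp add: h_def \<phi>_def d_def)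
qed

text \<open>Picard iteration written as a series: \<open>D n\<close> is the n-th correction, the
  primitive of the matrix applied to the previous one. The bound
  \<open>C * b ^ n / fact n * norm (z - z0) ^ n\<close> gives locally uniform convergence on all of
  \<open>S\<close>, not only near \<open>z0\<close>; convexity of \<open>S\<close> supplies the
  primitives.\<close>

lemma linear_system_exists:
  fixes M :: "nat \<Rightarrow> nat \<Rightarrow> complex \<Rightarrow> complex"
  assumes S: "open S" "convex S" "z0 \<in> S"
    and M: "\<And>i k. i < p \<Longrightarrow> k < p \<Longrightarrow> M i k holomorphic_on S"
  shows "\<exists>Y. \<forall>i<p. Y i z0 = c i \<and>
    (\<forall>z\<in>S. (Y i has_field_derivative (\<Sum>k<p. M i k z * Y k z)) (at z))"
proof -
  define prim where "prim = (\<lambda>f. SOME g. g z0 = 0 \<and> (\<forall>z\<in>S. (g has_field_derivative f z) (at z)))"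
  have prim: "prim f z0 = 0" "\<And>z. z \<in> S \<Longrightarrow> (prim f has_field_derivative f z) (at z)"
    if "f holomorphic_on S" for f
    using someI_ex[OF primitive_with_value[OF S(1,2) that S(3)]] unfolding prim_def by blast+
  define D where "D = rec_nat (\<lambda>i z. c i) (\<lambda>n Dn i. prim (\<lambda>z. \<Sum>k<p. M i k z * Dn k z))"
  have D0: "D 0 = (\<lambda>i z. c i)" and DS: "D (Suc n) i = prim (\<lambda>z. \<Sum>k<p. M i k z * D n k z)" for n i
    by (simp_all add: D_def)
  have holD: "D n i holomorphic_on S" if "i < p" for n i
    using that
  proof (induction n arbitrary: i)
    case 0 show ?case by (simp add: D0)
  next
    case (Suc n)
    have "(\<lambda>z. \<Sum>k<p. M i k z * D n k z) holomorphic_on S"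
      by (intro holomorphic_intros M Suc) auto
    from prim(2)[OF this] show ?case
      unfolding DS using S(1) by (auto simp: holomorphic_on_open)
  qed
  have holMD: "(\<lambda>z. \<Sum>k<p. M i k z * D n k z) holomorphic_on S" if "i < p" for n i
    using that by (intro holomorphic_intros M holD) auto
  \<comment> \<open>The zeroth term is constant, so its derivative is 0. The series of derivatives
    is therefore the matrix applied to the original series, shifted by one index.\<close>
  define D' where "D' = (\<lambda>n i z. case n of 0 \<Rightarrow> 0 | Suc m \<Rightarrow> \<Sum>k<p. M i k z * D m k z)"
  have derD: "(D n i has_field_derivative D' n i z) (at z)" if "i < p" "z \<in> S" for n i z
    using prim(2)[OF holMD[OF that(1)] that(2)] by (cases n) (auto simp: D0 DS D'_def)
  have ex: "\<exists>d h. 0 < d \<and> summable h \<and> range h \<subseteq> \<real>\<^sub>\<ge>\<^sub>0 \<and>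
      (\<forall>\<^sub>F n in sequentially. \<forall>y\<in>ball x d \<inter> S. cmod (D n i y) \<le> cmod (h n))"
    if i: "i < p" and x: "x \<in> S" for i x
  proof -
    obtain r where r: "r > 0" "cball x r \<subseteq> S"
      using S(1) x open_contains_cball by blast
    \<comment> \<open>The hull contains the segments from \<open>z0\<close> to all points near
      \<open>x\<close>, along which the integrals are estimated, and it is still compact, so the
      matrix entries are bounded on it.\<close>
    define K where "K = convex hull (insert z0 (cball x r))"
    have K: "compact K" "convex K" "z0 \<in> K" "K \<subseteq> S" "ball x r \<subseteq> K"
      unfolding K_def using r S
      by (auto intro!: compact_convex_hull hull_inc hull_minimal simp: subset_hull)
    have "\<exists>B. \<forall>i<p. \<forall>k<p. \<forall>z\<in>K. norm (M i k z) \<le> B"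
    proof -
      have "\<exists>B. \<forall>z\<in>K. norm (M i k z) \<le> B" if "i < p" "k < p" for i k
      proof -
        have "compact (M i k ` K)"
          using K M[OF that] by (intro compact_continuous_image)
            (meson holomorphic_on_imp_continuous_on holomorphic_on_subset)
        thus ?thesis by (meson bounded_iff compact_imp_bounded imageI)
      qed
      then obtain b where b: "\<And>i k z. i < p \<Longrightarrow> k < p \<Longrightarrow> z \<in> K \<Longrightarrow> norm (M i k z) \<le> b i k"
        by metis
      have "norm (M i k z) \<le> (\<Sum>i<p. \<Sum>k<p. \<bar>b i k\<bar>)" if "i < p" "k < p" "z \<in> K" for i k z
      proof -
        have "norm (M i k z) \<le> \<bar>b i k\<bar>" using b[OF that] by simp
        also have "\<dots> \<le> (\<Sum>k<p. \<bar>b i k\<bar>)" using that by (intro member_le_sum) auto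
        also have "\<dots> \<le> (\<Sum>i<p. \<Sum>k<p. \<bar>b i k\<bar>)"
          using that member_le_sum[of i "{..<p}" "\<lambda>i. \<Sum>k<p. \<bar>b i k\<bar>"] by (auto intro: sum_nonneg)
        finally show ?thesis .
      qed
      thus ?thesis by blast
    qed
    then obtain B where B: "\<And>i k z. i < p \<Longrightarrow> k < p \<Longrightarrow> z \<in> K \<Longrightarrow> norm (M i k z) \<le> B" by blast
    define C where "C = (\<Sum>i<p. norm (c i))"
    define b where "b = real p * \<bar>B\<bar>"
    have bound: "norm (D n i z) \<le> C * b ^ n / fact n * norm (z - z0) ^ n" if "i < p" "z \<in> K" for n i z
      using that
    proof (induction n arbitrary: i z)
      case 0
      have "norm (c i) \<le> C" unfolding C_def using 0 by (intro member_le_sum) auto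
      thus ?case by (simp add: D0)
    next
      case (Suc n)
      have "norm (\<Sum>k<p. M i k x * D n k x) \<le> C * b ^ Suc n / fact n * norm (x - z0) ^ n"
        if "x \<in> K" for x
      proof -
        have "norm (\<Sum>k<p. M i k x * D n k x) \<le> (\<Sum>k<p. norm (M i k x * D n k x))"
          by (rule norm_sum)
        also have "\<dots> \<le> (\<Sum>k<p. \<bar>B\<bar> * (C * b ^ n / fact n * norm (x - z0) ^ n))"
          unfolding norm_mult using Suc.prems that
          by (intro sum_mono mult_mono Suc.IH) (auto intro: order.trans[OF B])
        also have "\<dots> = C * b ^ Suc n / fact n * norm (x - z0) ^ n"
          by (simp add: b_def)
        finally show ?thesis .
      qed
      hence "norm (D (Suc n) i z) \<le> (C * b ^ Suc n / fact n) * norm (z - z0) ^ Suc n / of_nat (Suc n)"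
        using derD[OF Suc.prems(1), of _ "Suc n"] K Suc.prems
        by (intro primitive_power_bound[OF K(2,3) Suc.prems(2)])
           (auto simp: DS D'_def intro!: prim(1) holMD)
      thus ?case by (simp add: field_simps)
    qed
    obtain R where R: "\<And>z. z \<in> K \<Longrightarrow> norm (z - z0) \<le> R"
      using compact_imp_bounded[OF K(1)] unfolding bounded_any_center[of _ z0]
      by (auto simp: dist_norm norm_minus_commute)
    have R0: "R \<ge> 0" using R[OF K(3)] by simp
    have C0: "C \<ge> 0" "b \<ge> 0" by (auto simp: C_def b_def intro: sum_nonneg)
    define h where "h = (\<lambda>n. complex_of_real (C * ((b * R) ^ n / fact n)))"
    have "summable (\<lambda>n. C * ((b * R) ^ n / fact n))"
      using summable_exp_generic[of "b * R"] by (intro summable_mult) (simp add: divide_inverse mult.commute)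
    hence "summable h" unfolding h_def by (rule summable_of_real)
    moreover have "range h \<subseteq> \<real>\<^sub>\<ge>\<^sub>0"
      using C0 R0 unfolding h_def by (intro image_subsetI, simp only: nonneg_Reals_of_real_iff) simp
    moreover have "\<forall>\<^sub>F n in sequentially. \<forall>y\<in>ball x r \<inter> S. cmod (D n i y) \<le> cmod (h n)"
    proof (intro always_eventually allI ballI)
      fix n y assume "y \<in> ball x r \<inter> S"
      hence y: "y \<in> K" using K(5) by blast
      have "norm (D n i y) \<le> C * b ^ n / fact n * norm (y - z0) ^ n" by (rule bound[OF i y])
      also have "\<dots> \<le> C * b ^ n / fact n * R ^ n"
        using C0 R[OF y] by (intro mult_left_mono power_mono) auto
      also have "\<dots> = norm (h n)"
        using C0 R0 by (simp add: h_def norm_mult norm_divide norm_power power_mult_distrib)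
      finally show "norm (D n i y) \<le> norm (h n)" .
    qed
    ultimately show ?thesis using r(1) by blast
  qed
  have "\<exists>g. \<forall>x\<in>S. ((\<lambda>n. D n i x) sums g x) \<and> (\<exists>g'. ((\<lambda>n. D' n i x) sums g') \<and> (g has_field_derivative g') (at x))"
    if "i < p" for i
    using series_and_derivative_comparison_complex[OF S(1) derD[OF that] ex[OF that]] by blast
  then obtain Y where Y: "\<And>i x. i < p \<Longrightarrow> x \<in> S \<Longrightarrow> (\<lambda>n. D n i x) sums Y i x"
    "\<And>i x. i < p \<Longrightarrow> x \<in> S \<Longrightarrow> \<exists>g'. ((\<lambda>n. D' n i x) sums g') \<and> (Y i has_field_derivative g') (at x)"
    by metis
  show ?thesis
  proof (intro exI[of _ Y] allI impI conjI ballI)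
    fix i assume i: "i < p"
    have "(\<lambda>n. D n i z0) = (\<lambda>n. if n = 0 then c i else 0)"
      by (rule ext, case_tac n) (auto simp: D0 DS intro!: prim(1) holMD i)
    hence "(\<lambda>n. D n i z0) sums c i"
      using sums_single[of 0 "\<lambda>_. c i"] by simp
    thus "Y i z0 = c i" using Y(1)[OF i S(3)] sums_unique2 by blast
  next
    fix i z assume i: "i < p" and z: "z \<in> S"
    have "(\<lambda>n. \<Sum>k<p. M i k z * D n k z) sums (\<Sum>k<p. M i k z * Y k z)"
      using Y(1) z by (intro sums_sum sums_mult) auto
    hence "(\<lambda>n. D' (Suc n) i z) sums (\<Sum>k<p. M i k z * Y k z)"
      by (simp add: D'_def)
    hence "(\<lambda>n. D' n i z) sums (\<Sum>k<p. M i k z * Y k z)"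
      by (subst (asm) sums_Suc_iff) (simp add: D'_def)
    with Y(2)[OF i z] show "(Y i has_field_derivative (\<Sum>k<p. M i k z * Y k z)) (at z)"
      using sums_unique2 by blast
  qed
qed

text \<open>The equation is solved for the highest derivative, so that its singular points show up
  as singularities of the coefficients \<open>a j\<close>.\<close>

definition lsol :: "nat \<Rightarrow> (nat \<Rightarrow> complex \<Rightarrow> complex) \<Rightarrow> (complex \<Rightarrow> complex) \<Rightarrow> complex set \<Rightarrow> bool"
  where "lsol p a f D \<longleftrightarrow> f holomorphic_on D \<and>
    (\<forall>z\<in>D. (deriv ^^ p) f z = (\<Sum>j<p. a j z * (deriv ^^ j) f z))"

lemma lsol_holomorphic: "lsol p a f D \<Longrightarrow> f holomorphic_on D"
  by (simp add: lsol_def)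

lemma lsol_subset: "lsol p a f D \<Longrightarrow> D' \<subseteq> D \<Longrightarrow> lsol p a f D'"
  by (auto simp: lsol_def intro: holomorphic_on_subset)

lemma lsol_cong:
  assumes "lsol p a f D" "open D" "\<And>z. z \<in> D \<Longrightarrow> f z = g z"
  shows "lsol p a g D"
proof -
  have g: "g holomorphic_on D"
    using assms by (metis holomorphic_cong lsol_def)
  have "(deriv ^^ j) f z = (deriv ^^ j) g z" if "z \<in> D" for z j
    using assms g that by (intro higher_deriv_transform_within_open[of f D]) (auto simp: lsol_def)
  thus ?thesis using assms g by (simp add: lsol_def)
qed

lemma lsol_exists:
  assumes S: "open S" "convex S" "z0 \<in> S" and a: "\<And>j. j < p \<Longrightarrow> a j holomorphic_on S"
  shows "\<exists>y. lsol p a y S \<and> (\<forall>j<p. (deriv ^^ j) y z0 = c j)"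
proof (cases "p = 0")
  case True
  thus ?thesis by (intro exI[of _ "\<lambda>_. 0"]) (auto simp: lsol_def)
next
  case False
  \<comment> \<open>Companion matrix of the scalar equation: the last row carries the coefficients,
    the other rows shift.\<close>
  define M where "M = (\<lambda>i k. if Suc i < p then (\<lambda>_. if k = Suc i then 1 else 0) else a k)"
  have "M i k holomorphic_on S" if "i < p" "k < p" for i k
    using a[OF that(2)] by (auto simp: M_def)
  from linear_system_exists[OF S, of p M c, OF this] obtain Y where
    Y0: "\<And>i. i < p \<Longrightarrow> Y i z0 = c i" and
    Y: "\<And>i z. i < p \<Longrightarrow> z \<in> S \<Longrightarrow> (Y i has_field_derivative (\<Sum>k<p. M i k z * Y k z)) (at z)"
    by blast
  have Ystep: "(Y i has_field_derivative Y (Suc i) z) (at z)" if "Suc i < p" "z \<in> S" for i z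
  proof -
    have "(\<Sum>k<p. M i k z * Y k z) = (\<Sum>k<p. if k = Suc i then Y k z else 0)"
      using that by (intro sum.cong) (auto simp: M_def)
    also have "\<dots> = Y (Suc i) z" using that by simp
    finally show ?thesis using Y[of i z] that by simp
  qed
  have hol: "Y i holomorphic_on S" if "i < p" for i
    using Y[OF that] S(1) by (auto simp: holomorphic_on_open)
  have der: "(deriv ^^ i) (Y 0) z = Y i z" if "i < p" "z \<in> S" for i z
    using that
  proof (induction i arbitrary: z)
    case (Suc i)
    have "deriv ((deriv ^^ i) (Y 0)) z = deriv (Y i) z"
      using Suc S(1) by (intro complex_derivative_transform_within_open[of _ S] hol holomorphic_higher_deriv) auto
    also have "\<dots> = Y (Suc i) z" using Ystep Suc.prems by (simp add: DERIV_imp_deriv)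
    finally show ?case by simp
  qed simp
  obtain q where q: "p = Suc q" using False by (cases p) auto
  have "(deriv ^^ p) (Y 0) z = (\<Sum>j<p. a j z * (deriv ^^ j) (Y 0) z)" if "z \<in> S" for z
  proof -
    have "deriv ((deriv ^^ q) (Y 0)) z = deriv (Y q) z"
      using S(1) q that by (intro complex_derivative_transform_within_open[of _ S] hol holomorphic_higher_deriv der) auto
    also have "\<dots> = (\<Sum>k<p. M q k z * Y k z)" using Y[of q z] q that by (simp add: DERIV_imp_deriv)
    also have "\<dots> = (\<Sum>j<p. a j z * (deriv ^^ j) (Y 0) z)"
      using der that by (intro sum.cong) (auto simp: M_def q)
    finally show ?thesis by (simp add: q)
  qed
  thus ?thesis using der Y0 S(3) hol False
    by (intro exI[of _ "Y 0"]) (auto simp: lsol_def)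
qed

lemma higher_deriv_sum:
  assumes "finite I" "\<And>i. i \<in> I \<Longrightarrow> f i holomorphic_on S" "open S" "z \<in> S"
  shows "(deriv ^^ n) (\<lambda>w. \<Sum>i\<in>I. f i w) z = (\<Sum>i\<in>I. (deriv ^^ n) (f i) z)"
  using assms(1,2)
proof (induction I rule: finite_induct)
  case empty show ?case by (simp)
next
  case (insert i I)
  have "(deriv ^^ n) (\<lambda>w. f i w + (\<Sum>i\<in>I. f i w)) z =
    (deriv ^^ n) (f i) z + (deriv ^^ n) (\<lambda>w. \<Sum>i\<in>I. f i w) z"
    using insert assms by (intro higher_deriv_add[of _ S]) (auto intro!: holomorphic_intros)
  with insert show ?case by simp
qed

text \<open>Differentiating the equation repeatedly expresses each derivative of order at least
  \<open>p\<close> at \<open>z0\<close> through lower ones, so all Taylor coefficients vanish and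
  the identity theorem applies.\<close>

lemma lsol_eq_0:
  assumes f: "lsol p a f D" and D: "open D" "connected D" "z0 \<in> D" "z \<in> D"
    and a: "\<And>j. j < p \<Longrightarrow> a j holomorphic_on D"
    and init: "\<And>j. j < p \<Longrightarrow> (deriv ^^ j) f z0 = 0"
  shows "f z = 0"
proof -
  have hol: "f holomorphic_on D" using f by (rule lsol_holomorphic)
  have "(deriv ^^ n) f z0 = 0" for n
  proof (induction n rule: less_induct)
    case (less n)
    show ?case
    proof (cases "n < p")
      case False
      then obtain m where m: "n = m + p" by (metis le_add_diff_inverse2 not_less)
      have "(deriv ^^ n) f z0 = (deriv ^^ m) ((deriv ^^ p) f) z0"
        by (simp add: m funpow_add)
      also have "\<dots> = (deriv ^^ m) (\<lambda>w. \<Sum>j<p. a j w * (deriv ^^ j) f w) z0"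
        using f D a hol by (intro higher_deriv_transform_within_open[of _ D])
          (auto simp: lsol_def intro!: holomorphic_intros holomorphic_higher_deriv)
      also have "\<dots> = (\<Sum>j<p. (deriv ^^ m) (\<lambda>w. a j w * (deriv ^^ j) f w) z0)"
        using D a hol by (intro higher_deriv_sum[of _ _ D]) (auto intro!: holomorphic_intros holomorphic_higher_deriv)
      also have "\<dots> = (\<Sum>j<p. \<Sum>i = 0..m. of_nat (m choose i) * (deriv ^^ i) (a j) z0 * (deriv ^^ (m - i)) ((deriv ^^ j) f) z0)"
        using D a hol by (intro sum.cong higher_deriv_mult[of _ D]) (auto intro!: holomorphic_higher_deriv)
      also have "\<dots> = 0"
      proof (intro sum.neutral ballI)
        fix j i assume ji: "j \<in> {..<p}" "i \<in> {0..m}"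
        have "(deriv ^^ (m - i)) ((deriv ^^ j) f) z0 = (deriv ^^ (m - i + j)) f z0"
          by (simp add: funpow_add)
        also have "\<dots> = 0" using ji by (intro less) (auto simp: m)
        finally show "of_nat (m choose i) * (deriv ^^ i) (a j) z0 * (deriv ^^ (m - i)) ((deriv ^^ j) f) z0 = 0"
          by simp
      qed
      finally show ?thesis .
    qed (use init in auto)
  qed
  thus ?thesis using holomorphic_fun_eq_0_on_connected[OF hol D(1,2) _ D(3,4)] by blast
qed

lemma lsol_diff:
  assumes "lsol p a f D" "lsol p a g D" "open D"
  shows "lsol p a (\<lambda>z. f z - g z) D"
  unfolding lsol_def
proof (intro conjI ballI)
  show "(\<lambda>z. f z - g z) holomorphic_on D" using assms by (auto simp: lsol_def intro!: holomorphic_intros)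
  fix z assume z: "z \<in> D"
  have "(deriv ^^ j) (\<lambda>z. f z - g z) z = (deriv ^^ j) f z - (deriv ^^ j) g z" for j
    using assms z by (intro higher_deriv_diff) (auto simp: lsol_def)
  thus "(deriv ^^ p) (\<lambda>z. f z - g z) z = (\<Sum>j<p. a j z * (deriv ^^ j) (\<lambda>z. f z - g z) z)"
    using assms z by (simp add: lsol_def right_diff_distrib sum_subtractf)
qed

lemma lsol_unique:
  assumes "lsol p a f D" "lsol p a g D" and D: "open D" "connected D" "z0 \<in> D" "z \<in> D"
    and a: "\<And>j. j < p \<Longrightarrow> a j holomorphic_on D"
    and "\<And>j. j < p \<Longrightarrow> (deriv ^^ j) f z0 = (deriv ^^ j) g z0"
  shows "f z = g z"
proof -
  have "f z - g z = 0"
  proof (rule lsol_eq_0[OF lsol_diff[OF assms(1,2) D(1)] D a])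
    fix j assume "j < p"
    show "(deriv ^^ j) (\<lambda>z. f z - g z) z0 = 0"
      using higher_deriv_diff[of f D g z0 j] assms \<open>j < p\<close> by (auto simp: lsol_def)
  qed
  thus ?thesis by simp
qed

text \<open>Solve the Cauchy problem on \<open>S\<close> with the initial values of \<open>f\<close>
  at one point of \<open>D\<close>. This takes the place of the monodromy theorem, with convex sets
  instead of simply connected ones.\<close>

lemma lsol_extend:
  assumes f: "lsol p a f D" and D: "open D" "connected D" "D \<noteq> {}" "D \<subseteq> S"
    and S: "open S" "convex S" and a: "\<And>j. j < p \<Longrightarrow> a j holomorphic_on S"
  shows "\<exists>g. lsol p a g S \<and> (\<forall>z\<in>D. g z = f z)"
proof -
  obtain z0 where z0: "z0 \<in> D" using D by blast
  obtain g where g: "lsol p a g S" "\<And>j. j < p \<Longrightarrow> (deriv ^^ j) g z0 = (deriv ^^ j) f z0"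
    using lsol_exists[OF S, of z0 p a "\<lambda>j. (deriv ^^ j) f z0"] a D z0 by blast
  have "g z = f z" if "z \<in> D" for z
    using D z0 that a g(2) by (intro lsol_unique[OF lsol_subset[OF g(1)] f, of z0])
      (auto intro: holomorphic_on_subset)
  with g(1) show ?thesis by blast
qed

lemma lsol_continue:
  assumes f: "lsol p a f A" and A: "open A" "convex A" and B: "open B" "convex B" "A \<inter> B \<noteq> {}"
    and a: "\<And>j. j < p \<Longrightarrow> a j holomorphic_on B"
  shows "\<exists>g. lsol p a g B \<and> (\<forall>z\<in>A \<inter> B. f z = g z)"
proof -
  have "\<exists>g. lsol p a g B \<and> (\<forall>z\<in>A \<inter> B. g z = f z)"
    using A B a by (intro lsol_extend lsol_subset[OF f]) (auto intro: convex_Int convex_connected)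
  thus ?thesis by metis
qed

section \<open>Analytic continuation around a point\<close>

text \<open>The common base region of all continuations around real points. Its border contains
  every real \<open>c\<close>, so turns around different points start and end in the same set and
  can be composed.\<close>

definition strip :: "real \<Rightarrow> complex set"
  where "strip e = {t. 0 < Im t \<and> Im t < e}"

lemma open_strip: "open (strip e)"
proof -
  have "strip e = {t. 0 < Im t} \<inter> {t. Im t < e}" by (auto simp: strip_def)
  thus ?thesis by (simp add: open_Int open_halfspace_Im_gt open_halfspace_Im_lt)
qed

lemma convex_strip: "convex (strip e)"
proof -
  have "strip e = {t. 0 < Im t} \<inter> {t. Im t < e}" by (auto simp: strip_def)
  thus ?thesis by (simp add: convex_Int convex_halfspace_Im_gt convex_halfspace_Im_lt)
qed

definition left_disc :: "real \<Rightarrow> real \<Rightarrow> complex set"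
  where "left_disc d c = ball (of_real c) d \<inter> {t. Re t < c}"

definition low_disc :: "real \<Rightarrow> real \<Rightarrow> complex set"
  where "low_disc d c = ball (of_real c) d \<inter> {t. Im t < 0}"

definition right_disc :: "real \<Rightarrow> real \<Rightarrow> complex set"
  where "right_disc d c = ball (of_real c) d \<inter> {t. Re t > c}"

lemmas half_disc_defs = left_disc_def low_disc_def right_disc_def

lemma half_disc_props:
  "open (left_disc d c)" "open (low_disc d c)" "open (right_disc d c)"
  "convex (left_disc d c)" "convex (low_disc d c)" "convex (right_disc d c)"
  unfolding half_disc_defs
  by (auto intro!: open_Int convex_Int simp: open_halfspace_Re_lt open_halfspace_Im_lt
      open_halfspace_Re_gt convex_halfspace_Re_lt convex_halfspace_Im_lt convex_halfspace_Re_gt)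

lemma half_disc_subset:
  "left_disc d c \<subseteq> ball (of_real c) d - {of_real c}"
  "low_disc d c \<subseteq> ball (of_real c) d - {of_real c}"
  "right_disc d c \<subseteq> ball (of_real c) d - {of_real c}"
  unfolding half_disc_defs by (safe, simp_all)

lemma half_disc_overlap:
  assumes "0 < d" "d \<le> e"
  shows "strip e \<inter> left_disc d c \<noteq> {}" "left_disc d c \<inter> low_disc d c \<noteq> {}"
    "low_disc d c \<inter> right_disc d c \<noteq> {}" "right_disc d c \<inter> strip e \<noteq> {}"
proof -
  have "norm (Complex u v) < d" if "\<bar>u\<bar> = d / 4" "\<bar>v\<bar> = d / 4" for u v
    using cmod_le[of "Complex u v"] that assms by simp
  hence b: "Complex (c + u) v \<in> ball (of_real c) d" if "\<bar>u\<bar> = d / 4" "\<bar>v\<bar> = d / 4" for u v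
    using that by (simp add: dist_norm complex_of_real_def norm_minus_commute minus_complex.code)
  have "Complex (c - d/4) (d/4) \<in> strip e \<inter> left_disc d c"
    "Complex (c - d/4) (-d/4) \<in> left_disc d c \<inter> low_disc d c"
    "Complex (c + d/4) (-d/4) \<in> low_disc d c \<inter> right_disc d c"
    "Complex (c + d/4) (d/4) \<in> right_disc d c \<inter> strip e"
    using b[of "-d/4" "d/4"] b[of "-d/4" "-d/4"] b[of "d/4" "d/4"] b[of "d/4" "-d/4"] assms
    by (simp_all add: half_disc_defs strip_def)
  thus "strip e \<inter> left_disc d c \<noteq> {}" "left_disc d c \<inter> low_disc d c \<noteq> {}"
    "low_disc d c \<inter> right_disc d c \<noteq> {}" "right_disc d c \<inter> strip e \<noteq> {}"
    by blast+
qed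

text \<open>Continuation from the strip above the real axis once counterclockwise around \<open>c\<close>, passing through
  the half discs to the left of, below and to the right of \<open>c\<close>.\<close>

definition turn_via where
  "turn_via e d c f g l b r \<longleftrightarrow> f holomorphic_on strip e \<and> g holomorphic_on strip e \<and>
     l holomorphic_on left_disc d c \<and> b holomorphic_on low_disc d c \<and> r holomorphic_on right_disc d c \<and>
     (\<forall>t\<in>strip e \<inter> left_disc d c. f t = l t) \<and> (\<forall>t\<in>left_disc d c \<inter> low_disc d c. l t = b t) \<and>
     (\<forall>t\<in>low_disc d c \<inter> right_disc d c. b t = r t) \<and> (\<forall>t\<in>right_disc d c \<inter> strip e. r t = g t)"

definition turn :: "real \<Rightarrow> real \<Rightarrow> real \<Rightarrow> (complex \<Rightarrow> complex) \<Rightarrow> (complex \<Rightarrow> complex) \<Rightarrow> bool"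
  where "turn e d c f g \<longleftrightarrow> (\<exists>l b r. turn_via e d c f g l b r)"

lemma convex_overlap_unique:
  assumes "f holomorphic_on B" "g holomorphic_on B" "open A" "open B" "convex B" "A \<inter> B \<noteq> {}"
    and "\<And>z. z \<in> A \<inter> B \<Longrightarrow> f z = g z" and "z \<in> B"
  shows "f z = (g z :: complex)"
  by (rule analytic_continuation_open[OF open_Int[OF assms(3,4)] assms(4,6)
    convex_connected[OF assms(5)] Int_lower2 assms(1,2,7,8)])

lemma turn_unique:
  assumes "turn e d c f g" "turn e d c f' g'" "0 < d" "d \<le> e"
    and "\<And>t. t \<in> strip e \<Longrightarrow> f t = f' t" and t: "t \<in> strip e"
  shows "g t = g' t"
proof -
  obtain l b r where 1: "l holomorphic_on left_disc d c" "b holomorphic_on low_disc d c"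
    "r holomorphic_on right_disc d c" "g holomorphic_on strip e"
    "\<And>t. t \<in> strip e \<inter> left_disc d c \<Longrightarrow> f t = l t" "\<And>t. t \<in> left_disc d c \<inter> low_disc d c \<Longrightarrow> l t = b t"
    "\<And>t. t \<in> low_disc d c \<inter> right_disc d c \<Longrightarrow> b t = r t" "\<And>t. t \<in> right_disc d c \<inter> strip e \<Longrightarrow> r t = g t"
    using assms(1) unfolding turn_def turn_via_def by blast
  obtain l' b' r' where 2: "l' holomorphic_on left_disc d c" "b' holomorphic_on low_disc d c"
    "r' holomorphic_on right_disc d c" "g' holomorphic_on strip e"
    "\<And>t. t \<in> strip e \<inter> left_disc d c \<Longrightarrow> f' t = l' t" "\<And>t. t \<in> left_disc d c \<inter> low_disc d c \<Longrightarrow> l' t = b' t"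
    "\<And>t. t \<in> low_disc d c \<inter> right_disc d c \<Longrightarrow> b' t = r' t" "\<And>t. t \<in> right_disc d c \<inter> strip e \<Longrightarrow> r' t = g' t"
    using assms(2) unfolding turn_def turn_via_def by blast
  note ov = half_disc_overlap[OF assms(3,4), of c]
  have l: "l t = l' t" if "t \<in> left_disc d c" for t
    by (rule convex_overlap_unique[OF 1(1) 2(1) open_strip half_disc_props(1,4) ov(1) _ that])
      (use 1(5) 2(5) assms(5) in force)
  have b: "b t = b' t" if "t \<in> low_disc d c" for t
    by (rule convex_overlap_unique[OF 1(2) 2(2) half_disc_props(1,2,5) ov(2) _ that])
      (use 1(6) 2(6) l in force)
  have r: "r t = r' t" if "t \<in> right_disc d c" for t
    by (rule convex_overlap_unique[OF 1(3) 2(3) half_disc_props(2,3,6) ov(3) _ that])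
      (use 1(7) 2(7) b in force)
  show ?thesis
    by (rule convex_overlap_unique[OF 1(4) 2(4) half_disc_props(3) open_strip convex_strip ov(4) _ t])
      (use 1(8) 2(8) r in force)
qed

lemma turn_exists:
  assumes f: "lsol p a f (strip e)" and d: "0 < d" "d \<le> e"
    and a: "\<And>j. j < p \<Longrightarrow> a j holomorphic_on (strip e \<union> (ball (of_real c) d - {of_real c}))"
  shows "\<exists>g. turn e d c f g \<and> lsol p a g (strip e)"
proof -
  note ov = half_disc_overlap[OF d, of c]
  note hp = half_disc_props[of d c]
  have a1: "a j holomorphic_on X" if "j < p" "X \<subseteq> ball (of_real c) d - {of_real c}" for X j
    using that by (intro holomorphic_on_subset[OF a]) auto
  have a2: "a j holomorphic_on strip e" if "j < p" for j
    using that by (intro holomorphic_on_subset[OF a]) auto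
  obtain l where l: "lsol p a l (left_disc d c)" "\<forall>z\<in>strip e \<inter> left_disc d c. f z = l z"
    using lsol_continue[OF f open_strip convex_strip hp(1,4) ov(1) a1] half_disc_subset by blast
  obtain b where b: "lsol p a b (low_disc d c)" "\<forall>z\<in>left_disc d c \<inter> low_disc d c. l z = b z"
    using lsol_continue[OF l(1) hp(1,4) hp(2,5) ov(2) a1] half_disc_subset by blast
  obtain r where r: "lsol p a r (right_disc d c)" "\<forall>z\<in>low_disc d c \<inter> right_disc d c. b z = r z"
    using lsol_continue[OF b(1) hp(2,5) hp(3,6) ov(3) a1] half_disc_subset by blast
  obtain g where g: "lsol p a g (strip e)" "\<forall>z\<in>right_disc d c \<inter> strip e. r z = g z"
    using lsol_continue[OF r(1) hp(3,6) open_strip convex_strip ov(4) a2] by blast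
  have "turn_via e d c f g l b r"
    unfolding turn_via_def using f l b r g lsol_holomorphic by blast
  hence "turn e d c f g" unfolding turn_def by blast
  thus ?thesis using g by blast
qed

text \<open>With coefficients regular at \<open>c\<close> as well, a single solution on the whole
  disc restricts to all three half discs.\<close>

lemma turn_trivial:
  assumes f: "lsol p a f (strip e)" and d: "0 < d" "d \<le> e"
    and a: "\<And>j. j < p \<Longrightarrow> a j holomorphic_on (strip e \<union> ball (of_real c) d)"
  shows "turn e d c f f"
proof -
  have a1: "a j holomorphic_on ball (of_real c) d" if "j < p" for j
    using that by (intro holomorphic_on_subset[OF a]) auto
  have "strip e \<inter> ball (of_real c) d \<noteq> {}"
    using half_disc_overlap(1)[OF d, of c] half_disc_subset(1)[of d c] by blast
  then obtain g where g: "lsol p a g (ball (of_real c) d)" "\<forall>z\<in>strip e \<inter> ball (of_real c) d. f z = g z"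
    using lsol_continue[OF f open_strip convex_strip open_ball convex_ball _ a1] by blast
  have "g holomorphic_on left_disc d c" "g holomorphic_on low_disc d c" "g holomorphic_on right_disc d c"
    using lsol_holomorphic[OF g(1)] by (auto intro!: holomorphic_on_subset[of g "ball (of_real c) d"] simp: half_disc_defs)
  hence "turn_via e d c f f g g g"
    unfolding turn_via_def using lsol_holomorphic[OF f] g(2) by (simp add: half_disc_defs)
  thus ?thesis unfolding turn_def by blast
qed

text \<open>Covers both a polynomial in \<open>n\<close> functions and its product with further
  factors depending on \<open>t\<close>. The second clause says that only the first \<open>n\<close>
  entries matter, so functions need to be chosen only for \<open>i < n\<close>.\<close>

definition holomorphic_combination :: "nat \<Rightarrow> (complex \<Rightarrow> (nat \<Rightarrow> complex) \<Rightarrow> complex) \<Rightarrow> bool"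
  where "holomorphic_combination n \<Phi> \<longleftrightarrow>
    (\<forall>A h. (\<forall>i<n. h i holomorphic_on A) \<longrightarrow> (\<lambda>t. \<Phi> t (\<lambda>i. h i t)) holomorphic_on A) \<and>
    (\<forall>t v w. (\<forall>i<n. v i = w i) \<longrightarrow> \<Phi> t v = \<Phi> t w)"

lemma holomorphic_combinationD:
  assumes "holomorphic_combination n \<Phi>"
  shows "(\<And>i. i < n \<Longrightarrow> h i holomorphic_on A) \<Longrightarrow> (\<lambda>t. \<Phi> t (\<lambda>i. h i t)) holomorphic_on A"
    and "(\<And>i. i < n \<Longrightarrow> v i = w i) \<Longrightarrow> \<Phi> t v = \<Phi> t w"
proof -
  assume "\<And>i. i < n \<Longrightarrow> h i holomorphic_on A"
  thus "(\<lambda>t. \<Phi> t (\<lambda>i. h i t)) holomorphic_on A"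
    by (intro assms[unfolded holomorphic_combination_def, THEN conjunct1, rule_format])
next
  assume "\<And>i. i < n \<Longrightarrow> v i = w i"
  thus "\<Phi> t v = \<Phi> t w"
    by (intro assms[unfolded holomorphic_combination_def, THEN conjunct2, rule_format])
qed

lemma turn_combination:
  assumes \<Phi>: "holomorphic_combination n \<Phi>" and fg: "\<And>i. i < n \<Longrightarrow> turn e d c (f i) (g i)"
  shows "turn e d c (\<lambda>t. \<Phi> t (\<lambda>i. f i t)) (\<lambda>t. \<Phi> t (\<lambda>i. g i t))"
proof -
  note hol = holomorphic_combinationD(1)[OF \<Phi>] and cong = holomorphic_combinationD(2)[OF \<Phi>]
  from fg obtain l b r where *: "\<And>i. i < n \<Longrightarrow> turn_via e d c (f i) (g i) (l i) (b i) (r i)"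
    unfolding turn_def by metis
  note * = *[unfolded turn_via_def]
  have "turn_via e d c (\<lambda>t. \<Phi> t (\<lambda>i. f i t)) (\<lambda>t. \<Phi> t (\<lambda>i. g i t))
    (\<lambda>t. \<Phi> t (\<lambda>i. l i t)) (\<lambda>t. \<Phi> t (\<lambda>i. b i t)) (\<lambda>t. \<Phi> t (\<lambda>i. r i t))"
    unfolding turn_via_def by (intro conjI ballI hol cong) (use * in blast)+
  thus ?thesis unfolding turn_def by blast
qed

text \<open>For each component one of the two turns is trivial, both on the function and on its
  image under the other turn, since that image solves the same equation. Hence both orders give the
  same result, and a combination inherits it.\<close>

lemma turns_commute:
  assumes \<Phi>: "holomorphic_combination n \<Phi>" and d: "0 < d" "d \<le> e"
    and f: "\<And>i. i < n \<Longrightarrow> lsol (p i) (a i) (f i) (strip e)"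
    and a1: "\<And>i j. i < n \<Longrightarrow> j < p i \<Longrightarrow> a i j holomorphic_on (strip e \<union> (ball (of_real c1) d - {of_real c1}))"
    and a2: "\<And>i j. i < n \<Longrightarrow> j < p i \<Longrightarrow> a i j holomorphic_on (strip e \<union> (ball (of_real c2) d - {of_real c2}))"
    and a12: "\<And>i. i < n \<Longrightarrow> (\<forall>j<p i. a i j holomorphic_on (strip e \<union> ball (of_real c1) d)) \<or>
       (\<forall>j<p i. a i j holomorphic_on (strip e \<union> ball (of_real c2) d))"
  shows "\<exists>y1 y2 y12. turn e d c1 (\<lambda>t. \<Phi> t (\<lambda>i. f i t)) y1 \<and> turn e d c2 (\<lambda>t. \<Phi> t (\<lambda>i. f i t)) y2 \<and>
     turn e d c2 y1 y12 \<and> turn e d c1 y2 y12"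
proof -
  have "\<exists>f1 f2 f12. turn e d c1 (f i) f1 \<and> turn e d c2 (f i) f2 \<and> turn e d c2 f1 f12 \<and> turn e d c1 f2 f12"
    if i: "i < n" for i
  proof (rule disjE[OF a12[OF i]])
    assume *: "\<forall>j<p i. a i j holomorphic_on (strip e \<union> ball (of_real c1) d)"
    obtain g where g: "turn e d c2 (f i) g" "lsol (p i) (a i) g (strip e)"
      using turn_exists[OF f[OF i] d a2[OF i]] by blast
    have "turn e d c1 (f i) (f i)" "turn e d c1 g g"
      using turn_trivial[OF f[OF i] d] turn_trivial[OF g(2) d] * by blast+
    thus ?thesis using g by blast
  next
    assume *: "\<forall>j<p i. a i j holomorphic_on (strip e \<union> ball (of_real c2) d)"
    obtain g where g: "turn e d c1 (f i) g" "lsol (p i) (a i) g (strip e)"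
      using turn_exists[OF f[OF i] d a1[OF i]] by blast
    have "turn e d c2 (f i) (f i)" "turn e d c2 g g"
      using turn_trivial[OF f[OF i] d] turn_trivial[OF g(2) d] * by blast+
    thus ?thesis using g by blast
  qed
  then obtain f1 f2 f12 where "\<And>i. i < n \<Longrightarrow> turn e d c1 (f i) (f1 i) \<and> turn e d c2 (f i) (f2 i) \<and>
      turn e d c2 (f1 i) (f12 i) \<and> turn e d c1 (f2 i) (f12 i)"
    by metis
  thus ?thesis using turn_combination[OF \<Phi>] by blast
qed

section \<open>A barrier for real solutions\<close>


text \<open>Minus the leading coefficient of the equation of \<open>\<alpha>\<close> on the real
  axis, with the sign that is positive between the singular points.\<close>

definition apery_N :: "real \<Rightarrow> real"
  where "apery_N t = 34 * exp t - 1 - exp t ^ 2"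

text \<open>Where \<open>r0\<close> vanishes, the normalisation \<open>J = 1/2\<close> reads
  \<open>N * r1^2 = 1\<close>, that is \<open>M = 1\<close> or \<open>M = -1\<close>. This makes 1
  the natural barrier for \<open>M\<close>.\<close>

definition apery_M :: "(real \<Rightarrow> real) \<Rightarrow> (real \<Rightarrow> real) \<Rightarrow> real \<Rightarrow> real"
  where "apery_M r0 r1 t = sqrt (apery_N t) * (r1 t + (5 * exp t + 3) / (8 * (exp t + 1)) * r0 t)"

text \<open>The left side is the coefficient of \<open>r0^2\<close> that remains after completing
  the square. Its form as a sum of squares over a square shows that the chosen correction term makes
  it positive.\<close>

lemma apery_weight_identity:
  fixes x :: real
  assumes "x > 0"
  shows "(34 * x - 2 * x^2) / 2 * ((5*x+3) / (8*(x+1))) + (x^2 - 10 * x) / 2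
     + (34*x-1-x^2) * (x / (4*(x+1)^2)) - (34*x-1-x^2) / 2 * ((5*x+3) / (8*(x+1)))^2
     = ((3*x^2-22*x+3)^2 + 512*x^2) / (128*(x+1)^2)"
proof -
  have "x + 1 \<noteq> 0" using assms by simp
  thus ?thesis
    by (simp add: power2_eq_square divide_simps) (simp add: algebra_simps)
qed

text \<open>The assumption is \<open>J = 1/2\<close> solved for the term with \<open>r2\<close>;
  substituting it leaves a square in \<open>r1 + h * r0\<close>. In the application \<open>A\<close>
  is half the derivative of \<open>n\<close>, and \<open>k\<close> is the derivative of
  \<open>h\<close>.\<close>

lemma apery_square_completion:
  fixes n A Q k h r0 r1 r2 :: real
  assumes "n * (r0 * r2) = n * r1^2 / 2 - A * r0 * r1 + Q * r0^2 - 1/2"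
  shows "r0 * (A * (r1 + h * r0) + n * (r2 + (k * r0 + h * r1)))
    = (n * (r1 + h * r0)^2 - 1) / 2 + (A * h + Q + n * k - n / 2 * h^2) * r0^2"
proof -
  have "r0 * (A * (r1 + h * r0) + n * (r2 + (k * r0 + h * r1)))
    = A * (r0 * r1) + A * h * r0^2 + n * (r0 * r2) + n * k * r0^2 + n * h * (r0 * r1)"
    by (simp add: algebra_simps power2_eq_square)
  also have "\<dots> = (n * (r1 + h * r0)^2 - 1) / 2 + (A * h + Q + n * k - n / 2 * h^2) * r0^2"
    unfolding assms by (simp add: field_simps power2_eq_square)
  finally show ?thesis .
qed

text \<open>With \<open>J = 1/2\<close> one has \<open>r0 \<surd>N M' = (M\<^sup>2 - 1) / 2 + B r0\<^sup>2\<close>. The correction term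
  \<open>(5 e\<^sup>t + 3) / (8 (e\<^sup>t + 1))\<close> in \<open>M\<close> is chosen so that \<open>B > 0\<close>; hence \<open>M\<close> cannot come down to \<open>1\<close>
  and \<open>r0\<close> cannot come down to \<open>0\<close>.\<close>

lemma apery_barrier:
  fixes r0 r1 r2 :: "real \<Rightarrow> real"
  defines "M \<equiv> apery_M r0 r1"
  assumes ab: "a < b" and N: "\<And>t. a < t \<Longrightarrow> t < b \<Longrightarrow> apery_N t > 0" and Na: "apery_N a = 0"
    and d0: "\<And>t. a < t \<Longrightarrow> t < b \<Longrightarrow> (r0 has_real_derivative r1 t) (at t)"
    and d1: "\<And>t. a < t \<Longrightarrow> t < b \<Longrightarrow> (r1 has_real_derivative r2 t) (at t)"
    and J: "\<And>t. a < t \<Longrightarrow> t < b \<Longrightarrow> - apery_N t * (r0 t * r2 t - (r1 t)^2 / 2)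
       - (34 * exp t - 2 * exp t ^ 2) / 2 * r0 t * r1 t + (exp t ^ 2 - 10 * exp t) / 2 * (r0 t)^2 = 1 / 2"
    and pos: "eventually (\<lambda>t. r0 t > 0) (at_right a)"
    and lim: "((\<lambda>t. (M t - 1) / r0 t) \<longlongrightarrow> 0) (at_right a)"
    and t: "a < t" "t < b"
  shows "r0 t > 0 \<and> M t > 1"
proof -
  define h where "h = (\<lambda>t::real. (5 * exp t + 3) / (8 * (exp t + 1)))"
  define B where "B = (\<lambda>t::real. ((3*exp t^2-22*exp t+3)^2 + 512*exp t^2) / (128*(exp t+1)^2))"
  have Bpos: "B t > 0" for t
    unfolding B_def by (intro divide_pos_pos add_nonneg_pos mult_pos_pos zero_less_power) (auto intro: add_pos_pos)
  have dh: "(h has_real_derivative exp t / (4 * (exp t + 1)^2)) (at t)" for t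
  proof -
    have "exp t + 1 \<noteq> 0" using exp_gt_zero[of t] by linarith
    thus ?thesis unfolding h_def
      by (auto intro!: derivative_eq_intros simp: power2_eq_square divide_simps) (simp add: algebra_simps)?
  qed
  have Mdef: "M t = sqrt (apery_N t) * (r1 t + h t * r0 t)" for t
    by (simp add: M_def apery_M_def h_def)
  define M1 where "M1 = (\<lambda>t. (34 * exp t - 2 * exp t ^ 2) / (2 * sqrt (apery_N t)) * (r1 t + h t * r0 t)
     + sqrt (apery_N t) * (r2 t + (exp t / (4 * (exp t + 1)^2) * r0 t + h t * r1 t)))"
  have dN: "(apery_N has_real_derivative (34 * exp t - 2 * exp t ^ 2)) (at t)" for t
    unfolding apery_N_def by (auto intro!: derivative_eq_intros simp: power2_eq_square)
  have dM: "(M has_real_derivative M1 t) (at t)" if "a < t" "t < b" for t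
  proof -
    have 1: "((\<lambda>t. sqrt (apery_N t)) has_real_derivative (34 * exp t - 2 * exp t ^ 2) / (2 * sqrt (apery_N t))) (at t)"
      using DERIV_chain2[OF DERIV_real_sqrt[OF N[OF that]] dN] by (simp add: field_simps)
    have 2: "((\<lambda>t. r1 t + h t * r0 t) has_real_derivative
        (r2 t + (exp t / (4 * (exp t + 1)^2) * r0 t + h t * r1 t))) (at t)"
      using DERIV_add[OF d1[OF that] DERIV_mult[OF dh d0[OF that]]] by (simp add: algebra_simps)
    show ?thesis
      using DERIV_mult[OF 1 2] unfolding Mdef M1_def by (simp add: algebra_simps)
  qed
  have key: "r0 t * (sqrt (apery_N t) * M1 t) = ((M t)^2 - 1) / 2 + B t * (r0 t)^2" if "a < t" "t < b" for t
  proof -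
    define x where "x = exp t"
    have x: "x > 0" by (simp add: x_def)
    define n where "n = apery_N t"
    have n: "n > 0" "n = 34 * x - 1 - x^2" using N[OF that] by (auto simp: n_def x_def apery_N_def)
    have nn: "sqrt n * sqrt n = n" using n by simp
    have "sqrt n * M1 t = (34 * x - 2 * x^2) / 2 * (r1 t + h t * r0 t)
       + n * (r2 t + (x / (4 * (x + 1)^2) * r0 t + h t * r1 t))"
    proof -
      define s where "s = sqrt n"
      have s: "s > 0" "s * s = n" using n nn by (auto simp: s_def)
      have *: "s * (A / (2 * s) * u + s * v) = A / 2 * u + s * s * v" for A u v
        using s(1) by (simp add: field_simps)
      show ?thesis
        unfolding M1_def n_def[symmetric] x_def[symmetric] s_def[symmetric] * s(2) ..
    qed
    moreover have "n * (r0 t * r2 t) = n * (r1 t)^2 / 2 - (34 * x - 2 * x ^ 2) / 2 * r0 t * r1 t + (x ^ 2 - 10 * x) / 2 * (r0 t)^2 - 1/2"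
      using J[OF that] unfolding n_def[symmetric] x_def[symmetric] by (simp add: field_simps)
    moreover have "(M t)^2 = n * (r1 t + h t * r0 t)^2"
      using n(1) by (simp add: Mdef n_def[symmetric] power_mult_distrib)
    moreover have "B t = (34 * x - 2 * x^2) / 2 * h t + (x^2 - 10 * x) / 2
     + n * (x / (4*(x+1)^2)) - n / 2 * (h t)^2"
      using apery_weight_identity[OF x] by (simp add: B_def h_def n(2) x_def[symmetric])
    ultimately show ?thesis
      using apery_square_completion[of n "r0 t" "r2 t" "r1 t" "(34 * x - 2 * x^2) / 2" "(x^2 - 10 * x) / 2"
        "h t" "x / (4*(x+1)^2)"] by (simp only: n_def)
  qed
  \<comment> \<open>That \<open>M > 1\<close> near \<open>a\<close> does not follow from limits
    alone. The quotient \<open>\<eta>\<close> satisfies a Riccati equation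
    \<open>sqrt N * \<eta>' = - \<eta>^2 / 2 + B + sqrt N * h * \<eta>\<close>, whose right side
    tends to \<open>B a > 0\<close>; so \<open>\<eta>\<close> increases from its limit 0 and is
    positive.\<close>
  define \<eta> where "\<eta> = (\<lambda>t. (M t - 1) / r0 t)"
  define \<eta>1 where "\<eta>1 = (\<lambda>t. (M1 t * r0 t - (M t - 1) * r1 t) / (r0 t * r0 t))"
  have d\<eta>: "(\<eta> has_real_derivative \<eta>1 t) (at t)" if "a < t" "t < b" "r0 t > 0" for t
    unfolding \<eta>_def \<eta>1_def using that
    by (intro DERIV_divide d0 DERIV_diff[OF dM DERIV_const, of _ 1, simplified]) auto
  have \<eta>eq: "sqrt (apery_N t) * \<eta>1 t = - ((\<eta> t)^2) / 2 + B t + sqrt (apery_N t) * h t * \<eta> t"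
    if "a < t" "t < b" "r0 t > 0" for t
  proof -
    define s where "s = sqrt (apery_N t)"
    have "s * r1 t = M t - s * h t * r0 t" by (simp add: Mdef s_def algebra_simps)
    have "s * (M1 t * r0 t - (M t - 1) * r1 t) = r0 t * (s * M1 t) - (M t - 1) * (s * r1 t)"
      by (simp add: algebra_simps)
    also have "\<dots> = ((M t)^2 - 1) / 2 + B t * (r0 t)^2 - (M t - 1) * (M t - s * h t * r0 t)"
      using key[OF that(1,2)] \<open>s * r1 t = M t - s * h t * r0 t\<close> by (simp only: s_def)
    also have "\<dots> = - ((M t - 1)^2) / 2 + B t * (r0 t)^2 + s * h t * (M t - 1) * r0 t"
      by (simp add: algebra_simps power2_eq_square add_divide_distrib diff_divide_distrib)
    finally have "s * \<eta>1 t = (- ((M t - 1)^2) / 2 + B t * (r0 t)^2 + s * h t * (M t - 1) * r0 t) / (r0 t * r0 t)"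
      by (simp add: \<eta>1_def)
    also have "\<dots> = - ((\<eta> t)^2) / 2 + B t + s * h t * \<eta> t"
      using that(3) by (simp add: \<eta>_def field_simps power2_eq_square)
    finally show ?thesis by (simp add: s_def)
  qed
  have near: "\<exists>c>a. c < b \<and> (\<forall>t. a < t \<and> t < c \<longrightarrow> r0 t > 0 \<and> M t > 1)"
  proof -
    have cN: "(apery_N \<longlongrightarrow> apery_N a) (at_right a)"
      unfolding apery_N_def[abs_def] by (intro tendsto_intros)
    have ch: "(h \<longlongrightarrow> h a) (at_right a)"
      using DERIV_isCont[OF dh] by (simp add: isCont_def filterlim_at_split)
    have cB: "(B \<longlongrightarrow> B a) (at_right a)"
    proof -
      have "exp a + 1 \<noteq> 0" using exp_gt_zero[of a] by linarith
      thus ?thesis unfolding B_def by (intro tendsto_intros) auto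
    qed
    have "((\<lambda>t. - ((\<eta> t)^2) / 2 + B t + sqrt (apery_N t) * h t * \<eta> t) \<longlongrightarrow>
        (- (0^2) / 2 + B a + sqrt (apery_N a) * h a * 0)) (at_right a)"
      using lim[folded \<eta>_def] by (intro tendsto_intros cN ch cB) auto
    hence "eventually (\<lambda>t. - ((\<eta> t)^2) / 2 + B t + sqrt (apery_N t) * h t * \<eta> t > 0) (at_right a)"
      using Bpos[of a] by (intro order_tendstoD(1)) auto
    with pos have "eventually (\<lambda>t. r0 t > 0 \<and> - ((\<eta> t)^2) / 2 + B t + sqrt (apery_N t) * h t * \<eta> t > 0) (at_right a)"
      by eventually_elim auto
    then obtain c where c: "c > a" "\<And>t. a < t \<Longrightarrow> t < c \<Longrightarrow>
        r0 t > 0 \<and> - ((\<eta> t)^2) / 2 + B t + sqrt (apery_N t) * h t * \<eta> t > 0"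
      unfolding eventually_at_right_field by blast
    define c' where "c' = (a + min b c) / 2"
    have c': "a < c'" "c' < b" "c' < c" using ab c(1) by (auto simp: c'_def)
    have \<eta>1: "\<eta>1 t > 0" if "a < t" "t < c'" for t
    proof -
      have "0 < sqrt (apery_N t) * \<eta>1 t" using c(2)[of t] \<eta>eq[of t] that c' by auto
      moreover have "0 < sqrt (apery_N t)" using N[of t] that c' by simp
      ultimately show ?thesis by (rule zero_less_mult_pos)
    qed
    have mono: "\<eta> s < \<eta> t" if "a < s" "s < t" "t < c'" for s t
    proof (rule DERIV_pos_imp_increasing[OF that(2)])
      fix x assume "s \<le> x" "x \<le> t"
      thus "\<exists>y. (\<eta> has_real_derivative y) (at x) \<and> 0 < y"
        using d\<eta>[of x] \<eta>1[of x] c(2)[of x] that c' by (intro exI[of _ "\<eta>1 x"]) auto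
    qed
    have \<eta>pos: "\<eta> t > 0" if "a < t" "t < c'" for t
    proof -
      define s where "s = (a + t) / 2"
      have s: "a < s" "s < t" using that by (auto simp: s_def)
      have "eventually (\<lambda>u. \<eta> u < \<eta> s) (at_right a)"
        unfolding eventually_at_right_field using mono s that by (intro exI[of _ s]) auto
      hence "0 \<le> \<eta> s"
        using lim[folded \<eta>_def] by (intro tendsto_upperbound[of \<eta> 0 "at_right a"]) (auto elim: eventually_mono)
      also have "\<dots> < \<eta> t" using s that by (intro mono) auto
      finally show ?thesis .
    qed
    show ?thesis
    proof (intro exI[of _ c'] conjI allI impI c')
      fix t assume t: "a < t \<and> t < c'"
      show "r0 t > 0" using c(2)[of t] t c' by auto
      thus "M t > 1" using \<eta>pos[of t] t by (simp add: \<eta>_def zero_less_divide_iff)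
    qed
  qed
  then obtain c where c: "a < c" "c < b" "\<And>t. a < t \<Longrightarrow> t < c \<Longrightarrow> r0 t > 0 \<and> M t > 1" by blast
  show ?thesis
  proof (rule ccontr)
    assume neg: "\<not> (r0 t > 0 \<and> M t > 1)"
    define u where "u = (a + min c t) / 2"
    have u: "a < u" "u < c" "u < t" using c t by (auto simp: u_def)
    have cont0: "continuous_on {u..t} r0"
      using u t by (intro continuous_at_imp_continuous_on ballI DERIV_isCont[OF d0]) auto
    have contM: "continuous_on {u..t} M"
      using u t by (intro continuous_at_imp_continuous_on ballI DERIV_isCont[OF dM]) auto
    \<comment> \<open>The least element \<open>v\<close> of this compact set is the first failure.
      There \<open>r0 v = 0\<close> is impossible, because \<open>M v \<ge> 1\<close> would force
      \<open>r1 v > 0\<close> and so negative values of \<open>r0\<close> just before; and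
      \<open>M v = 1\<close> forces a positive derivative of \<open>M\<close>, so values below 1
      just before.\<close>
    define A where "A = {x \<in> {u..t}. r0 x \<le> 0} \<union> {x \<in> {u..t}. M x \<le> 1}"
    have "closed A"
      unfolding A_def using cont0 contM
      by (intro closed_Un continuous_on_closed_Collect_le continuous_on_const closed_atLeastAtMost)
    moreover have "bounded A"
      by (rule bounded_subset[of "{u..t}"]) (auto simp: A_def)
    ultimately have "compact A" by (simp add: compact_eq_bounded_closed)
    moreover have "t \<in> A" using neg u by (auto simp: A_def)
    ultimately obtain v where v: "v \<in> A" "\<And>x. x \<in> A \<Longrightarrow> v \<le> x"
      using compact_attains_inf[of A] by blast
    have uA: "u \<notin> A" using c(3)[of u] u by (auto simp: A_def)
    have vt: "u < v" "v \<le> t" "a < v" "v < b"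
      using v(1) uA u t by (auto simp: A_def less_le)
    have good: "r0 x > 0 \<and> M x > 1" if "u \<le> x" "x < v" for x
      using v(2)[of x] that vt by (force simp: A_def)
    have ev: "eventually (\<lambda>x. r0 x > 0 \<and> M x > 1) (at_left v)"
      unfolding eventually_at_left_field using good vt by (intro exI[of _ u]) auto
    have l0: "(r0 \<longlongrightarrow> r0 v) (at_left v)" and lM: "(M \<longlongrightarrow> M v) (at_left v)"
      using DERIV_isCont[OF d0[OF vt(3,4)]] DERIV_isCont[OF dM[OF vt(3,4)]]
      by (simp_all add: isCont_def filterlim_at_split)
    have ge: "r0 v \<ge> 0" "M v \<ge> 1"
      using ev by (auto intro!: tendsto_lowerbound[OF l0] tendsto_lowerbound[OF lM] elim: eventually_mono)
    have r0v: "r0 v > 0"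
    proof (rule ccontr)
      assume "\<not> r0 v > 0"
      hence z: "r0 v = 0" using ge by simp
      hence "sqrt (apery_N v) * r1 v \<ge> 1" using ge by (simp add: Mdef)
      hence "r1 v > 0" using N[OF vt(3,4)] by (smt (verit) mult_nonneg_nonpos real_sqrt_ge_zero)
      from DERIV_pos_inc_left[OF d0[OF vt(3,4)] this] obtain e where
        e: "e > 0" "\<And>h. 0 < h \<Longrightarrow> h < e \<Longrightarrow> r0 (v - h) < r0 v" by blast
      define k where "k = min (e/2) (v - u)"
      have "0 < k" "k < e" "k \<le> v - u" using e vt by (auto simp: k_def)
      thus False using e(2)[of k] good[of "v - k"] z by auto
    qed
    hence "M v = 1" using v(1) ge by (auto simp: A_def)
    hence "r0 v * (sqrt (apery_N v) * M1 v) = B v * (r0 v)^2" using key[OF vt(3,4)] by simp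
    hence "sqrt (apery_N v) * M1 v > 0"
      using Bpos[of v] r0v by (metis mult_pos_pos zero_less_mult_pos zero_less_power)
    hence "M1 v > 0" using N[OF vt(3,4)] by (simp add: zero_less_mult_iff)
    from DERIV_pos_inc_left[OF dM[OF vt(3,4)] this] obtain e where
      e: "e > 0" "\<And>h. 0 < h \<Longrightarrow> h < e \<Longrightarrow> M (v - h) < M v" by blast
    define k where "k = min (e/2) (v - u)"
    have "0 < k" "k < e" "k \<le> v - u" using e vt by (auto simp: k_def)
    thus False using e(2)[of k] good[of "v - k"] \<open>M v = 1\<close> by auto
  qed
qed

section \<open>The differential equation of the Apery numbers\<close>

definition apery_P :: "complex \<Rightarrow> complex"
  where "apery_P t = exp t ^ 2 - 34 * exp t + 1"

definition apery_P' :: "complex \<Rightarrow> complex"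
  where "apery_P' t = 2 * exp t ^ 2 - 34 * exp t"

text \<open>This is the operator \<open>\<theta>^3 - x (34 \<theta>^3 + 51 \<theta>^2 + 27 \<theta>
  + 5) + x^2 (\<theta> + 1)^3\<close> that encodes the recurrence of the Apery numbers, with
  \<open>x = exp t\<close> and \<open>\<theta> = d/dt\<close>, divided by its leading coefficient
  \<open>apery_P\<close>.\<close>

definition apery_coeff :: "nat \<Rightarrow> complex \<Rightarrow> complex"
  where "apery_coeff j t = - (if j = 2 then 3 / 2 * apery_P' t else if j = 1 then 3 * exp t ^ 2 - 27 * exp t
     else exp t ^ 2 - 5 * exp t) / apery_P t"

abbreviation apery_sol :: "(complex \<Rightarrow> complex) \<Rightarrow> complex set \<Rightarrow> bool"
  where "apery_sol \<equiv> lsol 3 apery_coeff"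

lemma sum_lessThan_3: "(\<Sum>j<(3::nat). f j) = f 0 + f 1 + (f 2 :: complex)"
  by (simp add: numeral_3_eq_3 numeral_2_eq_2)

lemma apery_sol_iff:
  assumes "\<And>t. t \<in> D \<Longrightarrow> apery_P t \<noteq> 0"
  shows "apery_sol y D \<longleftrightarrow> y holomorphic_on D \<and>
    (\<forall>t\<in>D. apery_P t * (deriv ^^ 3) y t + 3 / 2 * apery_P' t * (deriv ^^ 2) y t
      + (3 * exp t ^ 2 - 27 * exp t) * deriv y t + (exp t ^ 2 - 5 * exp t) * y t = 0)"
proof -
  have "((deriv ^^ 3) y t = (\<Sum>j<3. apery_coeff j t * (deriv ^^ j) y t)) \<longleftrightarrow>
     apery_P t * (deriv ^^ 3) y t + 3 / 2 * apery_P' t * (deriv ^^ 2) y t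
      + (3 * exp t ^ 2 - 27 * exp t) * deriv y t + (exp t ^ 2 - 5 * exp t) * y t = 0" if "t \<in> D" for t
  proof -
    have *: "Y = - a / P * y0 + - b / P * y1 + - c / P * y2 \<longleftrightarrow> P * Y + c * y2 + b * y1 + a * y0 = 0"
      if "P \<noteq> 0" for Y a b c P y0 y1 y2 :: complex
    proof -
      have "Y = - a / P * y0 + - b / P * y1 + - c / P * y2 \<longleftrightarrow>
        P * Y = P * (- a / P * y0 + - b / P * y1 + - c / P * y2)" using that by simp
      also have "P * (- a / P * y0 + - b / P * y1 + - c / P * y2) = - a * y0 - b * y1 - c * y2"
        using that by (simp add: field_simps)
      also have "P * Y = - a * y0 - b * y1 - c * y2 \<longleftrightarrow> P * Y + c * y2 + b * y1 + a * y0 = 0"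
      proof -
        have "P * Y + c * y2 + b * y1 + a * y0 = P * Y - (- a * y0 - b * y1 - c * y2)" by simp
        thus ?thesis by (simp only: eq_iff_diff_eq_0[symmetric])
      qed
      finally show ?thesis .
    qed
    show ?thesis
    proof -
      have e: "(\<Sum>j<3. apery_coeff j t * (deriv ^^ j) y t) = - (exp t ^ 2 - 5 * exp t) / apery_P t * y t
         + - (3 * exp t ^ 2 - 27 * exp t) / apery_P t * deriv y t + - (3 / 2 * apery_P' t) / apery_P t * (deriv ^^ 2) y t"
        by (simp add: sum_lessThan_3 apery_coeff_def del: minus_diff_eq)
      show ?thesis unfolding e by (rule *[OF assms[OF that]])
    qed
  qed
  thus ?thesis unfolding lsol_def by blast
qed

lemma has_field_derivative_derivs:
  assumes "y holomorphic_on D" "open D" "t \<in> D"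
  shows "(y has_field_derivative deriv y t) (at t)"
    "(deriv y has_field_derivative (deriv ^^ 2) y t) (at t)"
    "((deriv ^^ 2) y has_field_derivative (deriv ^^ 3) y t) (at t)"
  using has_field_derivative_higher_deriv[OF assms, of 0] has_field_derivative_higher_deriv[OF assms, of 1]
    has_field_derivative_higher_deriv[OF assms, of 2]
  by (simp_all add: numeral_2_eq_2 numeral_3_eq_3)

text \<open>The equation is the symmetric square of
  \<open>P u'' + P'/2 u' + (x^2 - 10 x)/4 u = 0\<close>. For a product \<open>y = u1 u2\<close> of
  two solutions of the latter, this expression is \<open>- P W^2 / 2\<close> with \<open>W\<close>
  their Wronskian, and \<open>P W^2\<close> is constant by Abel's formula. It vanishes on squares of
  solutions.\<close>

definition apery_J :: "(complex \<Rightarrow> complex) \<Rightarrow> complex \<Rightarrow> complex"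
  where "apery_J y t = apery_P t * (y t * (deriv ^^ 2) y t - (deriv y t)^2 / 2)
     + apery_P' t / 2 * y t * deriv y t + (exp t ^ 2 - 10 * exp t) / 2 * (y t)^2"

lemma apery_P_derivative [derivative_intros]: "(apery_P has_field_derivative apery_P' t) (at t)"
  unfolding apery_P_def[abs_def] apery_P'_def
  by (auto intro!: derivative_eq_intros simp: power2_eq_square)

lemma apery_P'_derivative [derivative_intros]:
  "(apery_P' has_field_derivative 4 * exp t ^ 2 - 34 * exp t) (at t)"
  unfolding apery_P'_def[abs_def] by (auto intro!: derivative_eq_intros simp: power2_eq_square)

lemma deriv_apery_P: "deriv apery_P t = apery_P' t"
  by (rule DERIV_imp_deriv[OF apery_P_derivative])

lemma holomorphic_apery_P [holomorphic_intros]: "apery_P holomorphic_on A" "apery_P' holomorphic_on A"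
  unfolding apery_P_def[abs_def] apery_P'_def[abs_def] by (intro holomorphic_intros)+

text \<open>The derivative of the first integral is \<open>y\<close> times the left side of the
  equation. Stated over a general field because it is used for complex solutions and again for their
  real parts.\<close>

lemma apery_J_algebra:
  fixes P P' x Y0 Y1 Y2 Y3 :: "'a :: field_char_0"
  assumes "P * Y3 + 3 / 2 * P' * Y2 + (3 * x ^ 2 - 27 * x) * Y1 + (x ^ 2 - 5 * x) * Y0 = 0"
  shows "P' * (Y0 * Y2 - Y1^2 / 2) + P * (Y1 * Y2 + Y0 * Y3 - Y1 * Y2)
     + (4 * x^2 - 34 * x) / 2 * Y0 * Y1 + P' / 2 * (Y1 * Y1 + Y0 * Y2)
     + (2 * x^2 - 10 * x) / 2 * Y0^2 + (x ^ 2 - 10 * x) / 2 * (2 * Y0 * Y1) = 0"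
proof -
  have "P' * (Y0 * Y2 - Y1^2 / 2) + P * (Y1 * Y2 + Y0 * Y3 - Y1 * Y2)
     + (4 * x^2 - 34 * x) / 2 * Y0 * Y1 + P' / 2 * (Y1 * Y1 + Y0 * Y2)
     + (2 * x^2 - 10 * x) / 2 * Y0^2 + (x ^ 2 - 10 * x) / 2 * (2 * Y0 * Y1)
    = Y0 * (P * Y3 + 3 / 2 * P' * Y2 + (3 * x ^ 2 - 27 * x) * Y1 + (x ^ 2 - 5 * x) * Y0)"
    by (simp add: field_simps power2_eq_square)
  thus ?thesis using assms by simp
qed

lemma apery_J_constant:
  assumes y: "apery_sol y D" and D: "open D" "connected D"
    and P: "\<And>t. t \<in> D \<Longrightarrow> apery_P t \<noteq> 0" and st: "s \<in> D" "t \<in> D"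
  shows "apery_J y s = apery_J y t"
proof -
  have hol: "y holomorphic_on D" using y by (rule lsol_holomorphic)
  have der: "(apery_J y has_field_derivative 0) (at t)" if t: "t \<in> D" for t
  proof -
    note d = has_field_derivative_derivs[OF hol D(1) t]
    have ode: "apery_P t * (deriv ^^ 3) y t + 3 / 2 * apery_P' t * (deriv ^^ 2) y t
      + (3 * exp t ^ 2 - 27 * exp t) * deriv y t + (exp t ^ 2 - 5 * exp t) * y t = 0"
      using y apery_sol_iff[OF P] t by auto
    have "(apery_J y has_field_derivative
       (apery_P' t * (y t * (deriv ^^ 2) y t - (deriv y t)^2 / 2)
       + apery_P t * (deriv y t * (deriv ^^ 2) y t + y t * (deriv ^^ 3) y t - deriv y t * (deriv ^^ 2) y t)
       + (4 * exp t^2 - 34 * exp t) / 2 * y t * deriv y t + apery_P' t / 2 * (deriv y t * deriv y t + y t * (deriv ^^ 2) y t)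
       + (2 * exp t^2 - 10 * exp t) / 2 * (y t)^2 + (exp t ^ 2 - 10 * exp t) / 2 * (2 * y t * deriv y t))) (at t)"
      unfolding apery_J_def[abs_def]
      by (rule DERIV_cong, (rule d apery_P_derivative apery_P'_derivative DERIV_add DERIV_diff DERIV_cdivide
            DERIV_cmult DERIV_power DERIV_mult DERIV_exp)+) (simp add: field_simps power2_eq_square)
    thus ?thesis by (simp only: apery_J_algebra[OF ode])
  qed
  have "continuous_on D (apery_J y)"
    by (intro continuous_at_imp_continuous_on ballI DERIV_isCont[OF der])
  from DERIV_zero_connected_constant[OF D(2,1) finite.emptyI this] der
  obtain c where "\<And>x. x \<in> D \<Longrightarrow> apery_J y x = c" by blast
  thus ?thesis using st by simp
qed

subsection \<open>Uniformization at a singular point\<close>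

text \<open>The quotient by \<open>t - c\<close> with its removable singularity filled in, so that
  the local equation can be written without a pole at \<open>c\<close>.\<close>

definition apery_P1 :: "complex \<Rightarrow> complex \<Rightarrow> complex"
  where "apery_P1 c t = (if t = c then apery_P' c else apery_P t / (t - c))"

definition apery_P1' :: "complex \<Rightarrow> complex \<Rightarrow> complex"
  where "apery_P1' c = deriv (apery_P1 c)"

lemma holomorphic_apery_P1:
  assumes "apery_P c = 0"
  shows "apery_P1 c holomorphic_on A"
proof -
  have "apery_P1 c = (\<lambda>z. if z = c then deriv apery_P c else (apery_P z - apery_P c) / (z - c))"
    by (auto simp: apery_P1_def assms deriv_apery_P)
  moreover have "\<dots> holomorphic_on UNIV"
    by (intro pole_lemma_open holomorphic_intros) auto
  ultimately show ?thesis using holomorphic_on_subset by auto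
qed

lemma holomorphic_apery_P1':
  assumes "apery_P c = 0"
  shows "apery_P1' c holomorphic_on A"
proof -
  have "deriv (apery_P1 c) holomorphic_on UNIV"
    by (intro holomorphic_deriv holomorphic_apery_P1 assms open_UNIV)
  thus ?thesis unfolding apery_P1'_def by (rule holomorphic_on_subset) auto
qed

lemma apery_P_factor:
  assumes "apery_P c = 0"
  shows "apery_P t = (t - c) * apery_P1 c t"
  using assms by (simp add: apery_P1_def)

lemma apery_P'_factor:
  assumes "apery_P c = 0"
  shows "apery_P' t = apery_P1 c t + (t - c) * apery_P1' c t"
proof -
  have "(apery_P1 c has_field_derivative apery_P1' c t) (at t)"
    unfolding apery_P1'_def by (rule holomorphic_derivI[OF holomorphic_apery_P1[OF assms, of UNIV]]) auto
  from DERIV_mult[OF DERIV_diff[OF DERIV_ident DERIV_const, of c] this]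
  have "((\<lambda>t. (t - c) * apery_P1 c t) has_field_derivative (apery_P1 c t + (t - c) * apery_P1' c t)) (at t)"
    by (simp add: algebra_simps)
  moreover have "(\<lambda>t. (t - c) * apery_P1 c t) = apery_P"
    using apery_P_factor[OF assms] by auto
  ultimately show ?thesis using apery_P_derivative DERIV_unique by metis
qed

text \<open>The local exponents at a singular point are 0, 1/2 and 1, hence 0, 1 and 2 in
  \<open>w\<close>: an ordinary point. Accordingly \<open>apery_P1\<close> is the only denominator
  left.\<close>

definition apery_local_coeff :: "complex \<Rightarrow> nat \<Rightarrow> complex \<Rightarrow> complex"
  where "apery_local_coeff c j w = (let t = c + w^2 in
    (if j = 2 then - 3 * w * apery_P1' c t
     else if j = 1 then 3 * apery_P1' c t - 4 * (3 * exp t ^ 2 - 27 * exp t)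
     else - 8 * w * (exp t ^ 2 - 5 * exp t)) / apery_P1 c t)"

lemma holomorphic_apery_local_coeff:
  assumes "apery_P c = 0" "\<And>w. w \<in> W \<Longrightarrow> apery_P1 c (c + w^2) \<noteq> 0"
  shows "apery_local_coeff c j holomorphic_on W"
proof -
  have 1: "(\<lambda>w. apery_P1 c (c + w^2)) holomorphic_on W"
    by (rule holomorphic_on_compose_gen[unfolded o_def, OF _ holomorphic_apery_P1[OF assms(1), of UNIV]])
      (auto intro!: holomorphic_intros)
  have 2: "(\<lambda>w. apery_P1' c (c + w^2)) holomorphic_on W"
    by (rule holomorphic_on_compose_gen[unfolded o_def, OF _ holomorphic_apery_P1'[OF assms(1), of UNIV]])
      (auto intro!: holomorphic_intros)
  show ?thesis
    unfolding apery_local_coeff_def[abs_def] Let_def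
    by (cases "j = 2"; cases "j = 1") (auto intro!: holomorphic_intros 1 2 simp: assms(2))
qed

lemma derivs_square_substitution:
  assumes y: "y holomorphic_on Y" "open Y" and W: "open W" "\<And>w. w \<in> W \<Longrightarrow> c + w^2 \<in> Y"
    and G: "\<And>w. w \<in> W \<Longrightarrow> G w = y (c + w^2)" and w: "w \<in> W"
  shows "deriv G w = 2 * w * deriv y (c + w^2)"
    "(deriv ^^ 2) G w = 2 * deriv y (c + w^2) + 4 * w^2 * (deriv ^^ 2) y (c + w^2)"
    "(deriv ^^ 3) G w = 12 * w * (deriv ^^ 2) y (c + w^2) + 8 * w^3 * (deriv ^^ 3) y (c + w^2)"
proof -
  have sq: "((\<lambda>w. c + w^2) has_field_derivative 2 * w) (at w)" for w :: complex
    by (auto intro!: derivative_eq_intros)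
  note d = has_field_derivative_derivs[OF y W(2)]
  have D0: "((\<lambda>w. y (c + w^2)) has_field_derivative 2 * w * deriv y (c + w^2)) (at w)" if "w \<in> W" for w
    using DERIV_chain2[OF d(1)[OF that] sq] by (simp add: algebra_simps)
  have e1: "deriv G w = 2 * w * deriv y (c + w^2)" if "w \<in> W" for w
  proof -
    have "(G has_field_derivative 2 * w * deriv y (c + w^2)) (at w)"
      by (rule has_field_derivative_transform_within_open[OF D0[OF that] W(1) that]) (simp add: G)
    thus ?thesis by (rule DERIV_imp_deriv)
  qed
  have D1: "((\<lambda>w. 2 * w * deriv y (c + w^2)) has_field_derivative
      2 * deriv y (c + w^2) + 4 * w^2 * (deriv ^^ 2) y (c + w^2)) (at w)" if "w \<in> W" for w
    using DERIV_mult[OF DERIV_cmult[OF DERIV_ident, of 2] DERIV_chain2[OF d(2)[OF that] sq]]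
    by (simp add: algebra_simps power2_eq_square)
  have e2: "deriv (deriv G) w = 2 * deriv y (c + w^2) + 4 * w^2 * (deriv ^^ 2) y (c + w^2)" if "w \<in> W" for w
  proof -
    have "(deriv G has_field_derivative 2 * deriv y (c + w^2) + 4 * w^2 * (deriv ^^ 2) y (c + w^2)) (at w)"
      by (rule has_field_derivative_transform_within_open[OF D1[OF that] W(1) that]) (simp add: e1)
    thus ?thesis by (rule DERIV_imp_deriv)
  qed
  have D2: "((\<lambda>w. 2 * deriv y (c + w^2) + 4 * w^2 * (deriv ^^ 2) y (c + w^2)) has_field_derivative
      12 * w * (deriv ^^ 2) y (c + w^2) + 8 * w^3 * (deriv ^^ 3) y (c + w^2)) (at w)" if "w \<in> W" for w
  proof -
    have "((\<lambda>w. 4 * w^2) has_field_derivative 8 * w) (at w)" by (auto intro!: derivative_eq_intros)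
    from DERIV_add[OF DERIV_cmult[OF DERIV_chain2[OF d(2)[OF that] sq], of 2]
       DERIV_mult[OF this DERIV_chain2[OF d(3)[OF that] sq]]]
    show ?thesis by (simp add: algebra_simps power2_eq_square power3_eq_cube)
  qed
  have e3: "deriv (deriv (deriv G)) w = 12 * w * (deriv ^^ 2) y (c + w^2) + 8 * w^3 * (deriv ^^ 3) y (c + w^2)"
    if "w \<in> W" for w
  proof -
    have "(deriv (deriv G) has_field_derivative 12 * w * (deriv ^^ 2) y (c + w^2) + 8 * w^3 * (deriv ^^ 3) y (c + w^2)) (at w)"
      by (rule has_field_derivative_transform_within_open[OF D2[OF that] W(1) that]) (simp add: e2)
    thus ?thesis by (rule DERIV_imp_deriv)
  qed
  show "deriv G w = 2 * w * deriv y (c + w^2)"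
    "(deriv ^^ 2) G w = 2 * deriv y (c + w^2) + 4 * w^2 * (deriv ^^ 2) y (c + w^2)"
    "(deriv ^^ 3) G w = 12 * w * (deriv ^^ 2) y (c + w^2) + 8 * w^3 * (deriv ^^ 3) y (c + w^2)"
    using e1[OF w] e2[OF w] e3[OF w] by (simp_all add: numeral_2_eq_2 numeral_3_eq_3)
qed

text \<open>After multiplication by \<open>p\<close> the difference of the two sides is
  \<open>8 * w\<close> times the equation. The term \<open>12 * w * Y2\<close>, which stems from the
  third derivative of \<open>y (c + w^2)\<close>, is exactly the contribution of
  \<open>3/2 * p * Y2\<close>; this is why no pole at \<open>w = 0\<close> survives.\<close>

lemma apery_local_algebra:
  fixes w p p' x Y0 Y1 Y2 Y3 :: complex
  assumes ode: "w^2 * p * Y3 + 3 / 2 * (p + w^2 * p') * Y2 + (3 * x ^ 2 - 27 * x) * Y1 + (x ^ 2 - 5 * x) * Y0 = 0"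
    and p: "p \<noteq> 0"
  shows "12 * w * Y2 + 8 * w^3 * Y3 = - 8 * w * (x^2 - 5 * x) / p * Y0
      + (3 * p' - 4 * (3 * x^2 - 27 * x)) / p * (2 * w * Y1) + - 3 * w * p' / p * (2 * Y1 + 4 * w^2 * Y2)"
proof -
  have "p * (12 * w * Y2 + 8 * w^3 * Y3) - p * (- 8 * w * (x^2 - 5 * x) / p * Y0
      + (3 * p' - 4 * (3 * x^2 - 27 * x)) / p * (2 * w * Y1) + - 3 * w * p' / p * (2 * Y1 + 4 * w^2 * Y2))
    = p * (12 * w * Y2 + 8 * w^3 * Y3) - (- 8 * w * (x^2 - 5 * x) * Y0
      + (3 * p' - 4 * (3 * x^2 - 27 * x)) * (2 * w * Y1) + - 3 * w * p' * (2 * Y1 + 4 * w^2 * Y2))"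
    using p by (simp add: field_simps)
  also have "\<dots> = 8 * w * (w^2 * p * Y3 + 3 / 2 * (p + w^2 * p') * Y2 + (3 * x ^ 2 - 27 * x) * Y1 + (x ^ 2 - 5 * x) * Y0)"
    by (simp add: field_simps power2_eq_square power3_eq_cube)
  also have "\<dots> = 0" by (simp only: ode mult_zero_right)
  finally show ?thesis using p by simp
qed

lemma apery_local_lsol:
  assumes c: "apery_P c = 0" and y: "apery_sol y Y" "open Y"
    and W: "open W" "\<And>w. w \<in> W \<Longrightarrow> c + w^2 \<in> Y" "\<And>w. w \<in> W \<Longrightarrow> apery_P1 c (c + w^2) \<noteq> 0"
    "\<And>w. w \<in> W \<Longrightarrow> w \<noteq> 0"
  shows "lsol 3 (apery_local_coeff c) (\<lambda>w. y (c + w^2)) W"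
  unfolding lsol_def
proof (intro conjI ballI)
  have hol: "y holomorphic_on Y" using y(1) by (rule lsol_holomorphic)
  show "(\<lambda>w. y (c + w^2)) holomorphic_on W"
    by (rule holomorphic_on_compose_gen[unfolded o_def, OF _ hol]) (auto intro!: holomorphic_intros W(2))
  fix w assume w: "w \<in> W"
  define t where "t = c + w^2"
  have P: "apery_P t = w^2 * apery_P1 c t" "apery_P' t = apery_P1 c t + w^2 * apery_P1' c t"
    using apery_P_factor[OF c, of t] apery_P'_factor[OF c, of t] by (simp_all add: t_def)
  have Pt: "apery_P t \<noteq> 0" using P W(3,4) w by (simp add: t_def)
  have "(deriv ^^ 3) y t = (\<Sum>j<3. apery_coeff j t * (deriv ^^ j) y t)"
    using y W(2)[OF w] by (auto simp: lsol_def t_def)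
  hence "lsol 3 apery_coeff y (Y \<inter> {t. apery_P t \<noteq> 0})" using y lsol_subset by blast
  hence ode: "w^2 * apery_P1 c t * (deriv ^^ 3) y t + 3 / 2 * (apery_P1 c t + w^2 * apery_P1' c t) * (deriv ^^ 2) y t
      + (3 * exp t ^ 2 - 27 * exp t) * deriv y t + (exp t ^ 2 - 5 * exp t) * y t = 0"
    using apery_sol_iff[of "Y \<inter> {t. apery_P t \<noteq> 0}" y, THEN iffD1, THEN conjunct2, THEN bspec, of t]
      W(2)[OF w] Pt by (simp add: P[symmetric]) (simp add: t_def)
  note ds = derivs_square_substitution[OF hol y(2) W(1,2) HOL.refl w, folded t_def]
  have p: "apery_P1 c t \<noteq> 0" using W(3)[OF w] by (simp add: t_def)
  show "(deriv ^^ 3) (\<lambda>w. y (c + w^2)) w = (\<Sum>j<3. apery_local_coeff c j w * (deriv ^^ j) (\<lambda>w. y (c + w^2)) w)"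
    unfolding sum_lessThan_3 using ds apery_local_algebra[OF ode p]
    by (simp add: apery_local_coeff_def Let_def t_def[symmetric])
qed

text \<open>In the coordinate \<open>w\<close> all negative powers cancel. The right side makes
  sense at \<open>w = 0\<close>, where it can be evaluated from the Taylor coefficients of
  \<open>G\<close>.\<close>

lemma apery_J_local:
  assumes c: "apery_P c = 0" and y: "y holomorphic_on Y" "open Y"
    and W: "open W" "\<And>w. w \<in> W \<Longrightarrow> c + w^2 \<in> Y"
    and G: "\<And>w. w \<in> W \<Longrightarrow> G w = y (c + w^2)" and w: "w \<in> W" "w \<noteq> 0"
  shows "apery_J y (c + w^2) = apery_P1 c (c + w^2) * (G w * (deriv ^^ 2) G w / 4 - (deriv G w)^2 / 8)
     + w / 4 * apery_P1' c (c + w^2) * G w * deriv G w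
     + (exp (c + w^2) ^ 2 - 10 * exp (c + w^2)) / 2 * (G w)^2"
proof -
  define t where "t = c + w^2"
  have P: "apery_P t = w^2 * apery_P1 c t" "apery_P' t = apery_P1 c t + w^2 * apery_P1' c t"
    using apery_P_factor[OF c, of t] apery_P'_factor[OF c, of t] by (simp_all add: t_def)
  have ds: "deriv G w = 2 * w * deriv y t" "(deriv ^^ 2) G w = 2 * deriv y t + 4 * w^2 * (deriv ^^ 2) y t"
    using derivs_square_substitution(1,2)[OF y W G w(1)] by (simp_all add: t_def)
  show ?thesis
    unfolding apery_J_def t_def[symmetric] ds P G[OF w(1), folded t_def]
    by (simp add: field_simps power2_eq_square)
qed

section \<open>The zeros 17 + 12 sqrt 2 and 17 - 12 sqrt 2 of x^2 - 34 x + 1 and the regions free of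
  them\<close>

definition apery_L :: real
  where "apery_L = ln (17 + 12 * sqrt 2)"

lemma exp_apery_L: "exp apery_L = 17 + 12 * sqrt 2"
  unfolding apery_L_def by (intro exp_ln) (auto intro: add_pos_pos)

lemma exp_minus_apery_L: "exp (- apery_L) = 17 - 12 * sqrt 2"
proof -
  have "(17 + 12 * sqrt 2) * (17 - 12 * sqrt 2) = (1 :: real)"
    by (simp add: algebra_simps)
  thus ?thesis unfolding exp_minus exp_apery_L by (rule inverse_unique)
qed

lemma apery_L_gt_1: "apery_L > 1"
proof -
  have "exp 1 < (3 :: real)" using e_less_272 by linarith
  also have "\<dots> < exp apery_L" unfolding exp_apery_L by (simp add: add_strict_increasing)
  finally show ?thesis by simp
qed

lemma apery_P_roots:
  "apery_P t = (exp t - exp (of_real apery_L)) * (exp t - exp (of_real (- apery_L)))"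
proof -
  have "exp (complex_of_real apery_L) * exp (of_real (- apery_L)) = 1"
    by (simp flip: exp_add)
  moreover have "exp (complex_of_real apery_L) + exp (of_real (- apery_L)) = 34"
    unfolding exp_of_real exp_apery_L exp_minus_apery_L by simp
  moreover have "(X - A) * (X - B) = X ^ 2 - (A + B) * X + A * B" for X A B :: complex
    by (simp add: algebra_simps power2_eq_square)
  ultimately show ?thesis by (simp only: apery_P_def)
qed

lemma apery_P_eq_0:
  assumes "apery_P t = 0"
  obtains "exp t = exp (of_real apery_L)" "Re t = apery_L"
  | "exp t = exp (of_real (- apery_L))" "Re t = - apery_L"
proof -
  have "Re t = a" if "exp t = exp (of_real a)" for a
    using arg_cong[OF that, of norm] by simp
  thus ?thesis using assms that unfolding apery_P_roots by (metis eq_iff_diff_eq_0 mult_eq_0_iff)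
qed

definition apery_point :: "real \<Rightarrow> bool"
  where "apery_point c \<longleftrightarrow> c = apery_L \<or> c = - apery_L"

lemma apery_P_apery_point: "apery_point c \<Longrightarrow> apery_P (of_real c) = 0"
  by (auto simp: apery_point_def apery_P_roots)

lemma apery_P_nonzero_Re: "\<bar>Re t\<bar> \<noteq> apery_L \<Longrightarrow> apery_P t \<noteq> 0"
  by (rule notI, erule apery_P_eq_0) (use apery_L_gt_1 in auto)

lemma exp_eq_small:
  assumes "exp t = exp (of_real c)" "\<bar>Im t\<bar> < 2 * pi"
  shows "t = of_real c"
proof -
  obtain n :: int where n: "t = of_real c + of_int (2 * n) * pi * \<i>"
    using assms(1) unfolding exp_eq by auto
  hence "\<bar>of_int (2 * n) * pi\<bar> < 2 * pi" using assms(2) by simp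
  hence "\<bar>real_of_int n\<bar> < 1" by (simp add: abs_mult)
  hence "n = 0" by linarith
  thus ?thesis using n by simp
qed

lemma apery_P_nonzero_strip: "t \<in> strip e \<Longrightarrow> e \<le> 3 \<Longrightarrow> apery_P t \<noteq> 0"
proof
  assume t: "t \<in> strip e" "e \<le> 3" and "apery_P t = 0"
  hence "0 < Im t" "\<bar>Im t\<bar> < 2 * pi" using pi_gt3 by (auto simp: strip_def)
  with \<open>apery_P t = 0\<close> show False
    by (auto elim!: apery_P_eq_0 dest!: exp_eq_small)
qed

lemma apery_P_nonzero_ball:
  assumes c: "apery_point c" and t: "t \<in> ball (of_real c) 1" "t \<noteq> of_real c"
  shows "apery_P t \<noteq> 0"
proof
  assume *: "apery_P t = 0"
  have n: "norm (t - of_real c) < 1" using t(1) by (simp add: dist_norm norm_minus_commute)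
  have "\<bar>Re (t - of_real c)\<bar> < 1" "\<bar>Im (t - of_real c)\<bar> < 1"
    using n abs_Re_le_cmod[of "t - of_real c"] abs_Im_le_cmod[of "t - of_real c"] by linarith+
  hence b: "\<bar>Re t - c\<bar> < 1" "\<bar>Im t\<bar> < 2 * pi" using pi_gt3 by auto
  from * show False
    using c b t(2) apery_L_gt_1 by (auto elim!: apery_P_eq_0 dest!: exp_eq_small simp: apery_point_def)
qed

lemma apery_P'_apery_point: "apery_P' (of_real c) = of_real (2 * exp c * (exp c - 17))"
  by (simp add: apery_P'_def exp_of_real algebra_simps power2_eq_square)

lemma apery_P1_apery_point: "apery_P1 (of_real c) (of_real c) = of_real (2 * exp c * (exp c - 17))"
  by (simp add: apery_P1_def apery_P'_apery_point)

lemma apery_P1_nonzero_ball: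
  assumes c: "apery_point c" and t: "t \<in> ball (of_real c) 1"
  shows "apery_P1 (of_real c) t \<noteq> 0"
proof (cases "t = of_real c")
  case True
  thus ?thesis using c apery_P1_apery_point[of c]
    by (auto simp: apery_point_def exp_apery_L exp_minus_apery_L)
next
  case False
  thus ?thesis using apery_P_nonzero_ball[OF c t] by (simp add: apery_P1_def)
qed

lemma holomorphic_apery_coeff:
  assumes "\<And>t. t \<in> A \<Longrightarrow> apery_P t \<noteq> 0"
  shows "apery_coeff j holomorphic_on A"
  unfolding apery_coeff_def[abs_def] using assms
  by (cases "j = 2"; cases "j = 1") (auto intro!: holomorphic_intros)

subsection \<open>Sectors\<close>

text \<open>Half-plane conditions keep these sets convex, as continuation through overlaps requires.
  Under \<open>w \<mapsto> c + w^2\<close> the quarters go to the upper or lower side of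
  \<open>c\<close> and the cones to the left or right side, so half a turn in \<open>w\<close> lies
  over a full turn around \<open>c\<close>.\<close>

definition sector :: "complex \<Rightarrow> complex \<Rightarrow> real \<Rightarrow> complex set"
  where "sector u v r = {w. u \<bullet> w > 0} \<inter> {w. v \<bullet> w > 0} \<inter> ball 0 r"

lemma open_sector: "open (sector u v r)" and convex_sector: "convex (sector u v r)"
  unfolding sector_def
  by (auto intro!: open_Int convex_Int simp: open_halfspace_gt convex_halfspace_gt)

abbreviation "quarter1 \<equiv> sector 1 \<i>"
abbreviation "cone_up \<equiv> sector (Complex (-1) 1) (Complex 1 1)"
abbreviation "quarter2 \<equiv> sector (-1) \<i>"
abbreviation "cone_left \<equiv> sector (Complex (-1) 1) (Complex (-1) (-1))"
abbreviation "quarter3 \<equiv> sector (-1) (-\<i>)"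
abbreviation "cone_right \<equiv> sector (Complex 1 (-1)) (Complex 1 1)"

lemma in_sector: "w \<in> sector u v r \<longleftrightarrow>
  Re u * Re w + Im u * Im w > 0 \<and> Re v * Re w + Im v * Im w > 0 \<and> norm w < r"
  by (auto simp: sector_def inner_complex_def)

lemma sector_overlap:
  assumes "r > 0"
  shows "quarter1 r \<inter> cone_up r \<noteq> {}" "cone_up r \<inter> quarter2 r \<noteq> {}"
    "quarter2 r \<inter> cone_left r \<noteq> {}" "cone_left r \<inter> quarter3 r \<noteq> {}"
    "quarter1 r \<inter> cone_right r \<noteq> {}"
proof -
  have b: "norm (Complex (r * u) (r * v)) < r" if "\<bar>u\<bar> + \<bar>v\<bar> < 1" for u v
  proof -
    have "norm (Complex (r * u) (r * v)) \<le> \<bar>r * u\<bar> + \<bar>r * v\<bar>"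
      using cmod_le[of "Complex (r * u) (r * v)"] by simp
    also have "\<dots> = r * (\<bar>u\<bar> + \<bar>v\<bar>)" using assms by (simp add: abs_mult distrib_left)
    also have "\<dots> < r * 1" using that assms by (intro mult_strict_left_mono)
    finally show ?thesis by simp
  qed
  have "Complex (r * (1/5)) (r * (2/5)) \<in> quarter1 r \<inter> cone_up r"
    "Complex (r * (-1/5)) (r * (2/5)) \<in> cone_up r \<inter> quarter2 r"
    "Complex (r * (-2/5)) (r * (1/5)) \<in> quarter2 r \<inter> cone_left r"
    "Complex (r * (-2/5)) (r * (-1/5)) \<in> cone_left r \<inter> quarter3 r"
    "Complex (r * (2/5)) (r * (1/5)) \<in> quarter1 r \<inter> cone_right r"
    unfolding Int_iff in_sector using assms b[of "1/5" "2/5"] b[of "-1/5" "2/5"] b[of "-2/5" "1/5"]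
      b[of "-2/5" "-1/5"] b[of "2/5" "1/5"] by simp_all
  thus "quarter1 r \<inter> cone_up r \<noteq> {}" "cone_up r \<inter> quarter2 r \<noteq> {}"
    "quarter2 r \<inter> cone_left r \<noteq> {}" "cone_left r \<inter> quarter3 r \<noteq> {}"
    "quarter1 r \<inter> cone_right r \<noteq> {}" by blast+
qed

lemma square_in_ball:
  fixes w :: complex
  assumes "norm w < sqrt d"
  shows "of_real c + w^2 \<in> ball (of_real c) d" "norm (w^2) < d"
proof -
  have "norm w ^ 2 < sqrt d ^ 2" using assms by (intro power_strict_mono) auto
  moreover have "d > 0" using assms norm_ge_zero[of w] real_sqrt_gt_zero by (metis order_le_less_trans real_sqrt_gt_0_iff)
  ultimately show "of_real c + w^2 \<in> ball (of_real c) d" "norm (w^2) < d"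
    by (simp_all add: dist_norm norm_power)
qed

lemma Re_Im_square: "Re (w^2) = (Re w)^2 - (Im w)^2" "Im (w^2) = 2 * (Re w * Im w)"
  by (simp_all add: power2_eq_square)

lemma square_quarter13:
  assumes "w \<in> quarter1 (sqrt d) \<union> quarter3 (sqrt d)" "d \<le> e"
  shows "of_real c + w^2 \<in> strip e"
proof -
  have "Re w * Im w > 0" "norm w < sqrt d" using assms by (auto simp: in_sector mult_neg_neg)
  moreover have "Im (w^2) \<le> norm (w^2)" using abs_Im_le_cmod[of "w^2"] by linarith
  ultimately show ?thesis using square_in_ball(2)[of w d] assms(2)
    by (simp add: strip_def Re_Im_square)
qed

lemma square_quarter2: "w \<in> quarter2 (sqrt d) \<Longrightarrow> of_real c + w^2 \<in> low_disc d c"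
  using square_in_ball(1)[of w d c] by (auto simp: in_sector low_disc_def Re_Im_square mult_neg_pos mult_pos_neg)

lemma square_cone_up: "w \<in> cone_up (sqrt d) \<Longrightarrow> of_real c + w^2 \<in> left_disc d c"
proof -
  assume w: "w \<in> cone_up (sqrt d)"
  hence "Im w > \<bar>Re w\<bar>" "norm w < sqrt d" by (auto simp: in_sector)
  moreover from this(1) have "(Re w)^2 < (Im w)^2"
    by (metis abs_ge_zero abs_le_square_iff abs_of_nonneg less_le_trans linorder_not_less order_less_imp_le)
  ultimately show ?thesis using square_in_ball(1)[of w d c]
    by (auto simp: left_disc_def Re_Im_square)
qed

lemma square_cone_left_right:
  "w \<in> cone_left (sqrt d) \<union> cone_right (sqrt d) \<Longrightarrow> of_real c + w^2 \<in> right_disc d c"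
proof -
  assume w: "w \<in> cone_left (sqrt d) \<union> cone_right (sqrt d)"
  hence "\<bar>Re w\<bar> > \<bar>Im w\<bar>" "norm w < sqrt d" by (auto simp: in_sector)
  moreover from this(1) have "(Im w)^2 < (Re w)^2"
    by (metis abs_le_square_iff linorder_not_less)
  ultimately show ?thesis using square_in_ball(1)[of w d c]
    by (auto simp: right_disc_def Re_Im_square)
qed

text \<open>\<open>G\<close> is \<open>y\<close> in the coordinate \<open>w = sqrt (t - c)\<close>;
  the branch of the root is fixed by the first quadrant, which lies over the upper half
  disc.\<close>

definition uniformizes :: "real \<Rightarrow> real \<Rightarrow> (complex \<Rightarrow> complex) \<Rightarrow> (complex \<Rightarrow> complex) \<Rightarrow> bool"
  where "uniformizes d c y G \<longleftrightarrow> G holomorphic_on ball 0 (sqrt d) \<and>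
    (\<forall>w\<in>quarter1 (sqrt d). G w = y (of_real c + w^2))"

lemma quarter1_subset: "quarter1 r \<subseteq> ball 0 r"
  by (auto simp: sector_def)

lemma holomorphic_square_shift:
  assumes "f holomorphic_on A" "\<And>w. w \<in> W \<Longrightarrow> c + w^2 \<in> A"
  shows "(\<lambda>w. f (c + w^2)) holomorphic_on W"
  by (rule holomorphic_on_compose_gen[unfolded o_def, OF _ assms(1)])
    (auto intro!: holomorphic_intros assms(2))

lemma apery_uniformizes_exists:
  assumes c: "apery_point c" and d: "0 < d" "d \<le> 1" "d \<le> e" and y: "apery_sol y (strip e)"
  shows "\<exists>G. uniformizes d c y G \<and> lsol 3 (apery_local_coeff (of_real c)) G (ball 0 (sqrt d))"
proof -
  note c0 = apery_P_apery_point[OF c]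
  have P1: "apery_P1 (of_real c) (of_real c + w^2) \<noteq> 0" if "w \<in> ball 0 (sqrt d)" for w
    using square_in_ball(1)[of w d c] that d by (intro apery_P1_nonzero_ball[OF c]) auto
  have 1: "lsol 3 (apery_local_coeff (of_real c)) (\<lambda>w. y (of_real c + w^2)) (quarter1 (sqrt d))"
  proof (rule apery_local_lsol[OF c0 y open_strip open_sector])
    fix w assume w: "w \<in> quarter1 (sqrt d)"
    show "of_real c + w^2 \<in> strip e" by (rule square_quarter13) (use w d in auto)
    show "apery_P1 (of_real c) (of_real c + w^2) \<noteq> 0" using w P1 quarter1_subset by blast
    show "w \<noteq> 0" using w by (auto simp: in_sector)
  qed
  have "quarter1 (sqrt d) \<noteq> {}" using sector_overlap(1)[of "sqrt d"] d by auto
  from lsol_extend[OF 1 open_sector convex_connected[OF convex_sector] this quarter1_subset open_ball convex_ball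
      holomorphic_apery_local_coeff[OF c0 P1]]
  obtain G where G: "lsol 3 (apery_local_coeff (of_real c)) G (ball 0 (sqrt d))"
    "\<forall>w\<in>quarter1 (sqrt d). G w = y (of_real c + w^2)" by auto
  thus ?thesis using lsol_holomorphic[OF G(1)] unfolding uniformizes_def by blast
qed

lemma uniformizes_unique:
  assumes "uniformizes d c y G" "uniformizes d c z K" "0 < d" "d \<le> e"
    and yz: "\<And>t. t \<in> strip e \<Longrightarrow> y t = z t" and w: "w \<in> ball 0 (sqrt d)"
  shows "G w = K w"
proof (rule analytic_continuation_open[of "quarter1 (sqrt d)" "ball 0 (sqrt d)" G K])
  show "open (quarter1 (sqrt d))" by (rule open_sector)
  show "quarter1 (sqrt d) \<subseteq> ball 0 (sqrt d)" by (rule quarter1_subset)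
  show "quarter1 (sqrt d) \<noteq> {}" using sector_overlap(1)[of "sqrt d"] assms by auto
  fix v assume "v \<in> quarter1 (sqrt d)"
  thus "G v = K v" using assms square_quarter13[of v d e c] by (auto simp: uniformizes_def)
qed (use assms in \<open>auto simp: uniformizes_def\<close>)

text \<open>\<open>G\<close> is compared successively on \<open>cone_up\<close>,
  \<open>quarter2\<close>, \<open>cone_left\<close> and \<open>quarter3\<close> with the
  continuations over the left, lower and right half discs and back over the strip. Since
  \<open>-w\<close> is in \<open>quarter3\<close> for \<open>w\<close> in \<open>quarter1\<close>,
  the turn becomes the reflection of \<open>w\<close>.\<close>

lemma uniformizes_turn:
  assumes G: "uniformizes d c y G" and d: "0 < d" "d \<le> e" and turn: "turn e d c y z"
  shows "uniformizes d c z (\<lambda>w. G (- w))"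
proof -
  define r where "r = sqrt d"
  have r: "r > 0" using d by (simp add: r_def)
  note ov = sector_overlap[OF r]
  have G1: "G holomorphic_on ball 0 r" "\<And>w. w \<in> quarter1 r \<Longrightarrow> G w = y (of_real c + w^2)"
    using G by (auto simp: uniformizes_def r_def)
  have Gs: "G holomorphic_on sector u v r" for u v
    by (rule holomorphic_on_subset[OF G1(1)]) (auto simp: sector_def)
  obtain l b q where t: "y holomorphic_on strip e" "z holomorphic_on strip e"
     "l holomorphic_on left_disc d c" "b holomorphic_on low_disc d c" "q holomorphic_on right_disc d c"
     "\<And>t. t \<in> strip e \<Longrightarrow> t \<in> left_disc d c \<Longrightarrow> y t = l t"
     "\<And>t. t \<in> left_disc d c \<Longrightarrow> t \<in> low_disc d c \<Longrightarrow> l t = b t"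
     "\<And>t. t \<in> low_disc d c \<Longrightarrow> t \<in> right_disc d c \<Longrightarrow> b t = q t"
     "\<And>t. t \<in> right_disc d c \<Longrightarrow> t \<in> strip e \<Longrightarrow> q t = z t"
    using turn unfolding turn_def turn_via_def by blast
  note sq = square_quarter13[where d = d and e = e and c = c, folded r_def]
    square_quarter2[of _ d c, folded r_def] square_cone_up[of _ d c, folded r_def]
    square_cone_left_right[of _ d c, folded r_def]
  have 1: "G w = l (of_real c + w^2)" if "w \<in> cone_up r" for w
    by (rule convex_overlap_unique[OF Gs holomorphic_square_shift[OF t(3)] open_sector open_sector convex_sector ov(1) _ that])
      (use sq d G1 t in auto)
  have 2: "G w = b (of_real c + w^2)" if "w \<in> quarter2 r" for w
    by (rule convex_overlap_unique[OF Gs holomorphic_square_shift[OF t(4)] open_sector open_sector convex_sector ov(2) _ that])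
      (use sq 1 t in auto)
  have 3: "G w = q (of_real c + w^2)" if "w \<in> cone_left r" for w
    by (rule convex_overlap_unique[OF Gs holomorphic_square_shift[OF t(5)] open_sector open_sector convex_sector ov(3) _ that])
      (use sq 2 t in auto)
  have 4: "G w = z (of_real c + w^2)" if "w \<in> quarter3 r" for w
    by (rule convex_overlap_unique[OF Gs holomorphic_square_shift[OF t(2)] open_sector open_sector convex_sector ov(4) _ that])
      (use sq 3 t d in auto)
  show ?thesis
    unfolding uniformizes_def r_def[symmetric]
  proof (intro conjI ballI)
    show "(\<lambda>w. G (- w)) holomorphic_on ball 0 r"
      by (rule holomorphic_on_compose_gen[unfolded o_def, OF _ G1(1)]) (auto intro!: holomorphic_intros)
    fix w assume "w \<in> quarter1 r"
    hence "- w \<in> quarter3 r" by (auto simp: in_sector)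
    from 4[OF this] show "G (- w) = z (of_real c + w^2)" by simp
  qed
qed

lemma uniformizes_diff:
  assumes "uniformizes d c y G" "uniformizes d c z K"
  shows "uniformizes d c (\<lambda>t. y t - z t) (\<lambda>w. G w - K w)"
  using assms unfolding uniformizes_def by (auto intro!: holomorphic_intros)

lemma higher_deriv_reflect:
  assumes "G holomorphic_on ball 0 r" "r > 0"
  shows "(deriv ^^ n) (\<lambda>w. G (- w)) 0 = (-1)^n * (deriv ^^ n) G 0"
  using higher_deriv_compose_linear[OF assms(1), of "ball 0 r" 0 "-1" n] assms(2) by simp

lemma odd_function_deriv:
  assumes G: "G holomorphic_on ball 0 r" "r > 0"
    and *: "\<And>w. w \<in> ball 0 r \<Longrightarrow> G (- w) = - G w" and n: "even n"
  shows "(deriv ^^ n) G 0 = 0"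
proof -
  have "(\<lambda>w. G (- w)) holomorphic_on ball 0 r"
    by (rule holomorphic_on_compose_gen[unfolded o_def, OF _ G(1)]) (auto intro!: holomorphic_intros)
  hence "(deriv ^^ n) (\<lambda>w. G (- w)) 0 = (deriv ^^ n) (\<lambda>w. - G w) 0"
    using G * by (intro higher_deriv_transform_within_open[of _ "ball 0 r"]) (auto intro!: holomorphic_intros)
  also have "\<dots> = - (deriv ^^ n) G 0"
    using G by (intro higher_deriv_uminus[of _ "ball 0 r"]) auto
  finally show ?thesis using higher_deriv_reflect[OF G, of n] n by simp
qed

lemma even_function_deriv:
  assumes G: "G holomorphic_on ball 0 r" "r > 0"
    and *: "\<And>w. w \<in> ball 0 r \<Longrightarrow> G (- w) = G w" and n: "odd n"
  shows "(deriv ^^ n) G 0 = 0"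
proof -
  have "(\<lambda>w. G (- w)) holomorphic_on ball 0 r"
    by (rule holomorphic_on_compose_gen[unfolded o_def, OF _ G(1)]) (auto intro!: holomorphic_intros)
  hence "(deriv ^^ n) (\<lambda>w. G (- w)) 0 = (deriv ^^ n) G 0"
    using G * by (intro higher_deriv_transform_within_open[of _ "ball 0 r"]) auto
  thus ?thesis using higher_deriv_reflect[OF G, of n] n by simp
qed

subsection \<open>Real solutions between the singular points\<close>

lemma has_real_derivative_Re:
  assumes "(f has_field_derivative f') (at (of_real a))"
  shows "((\<lambda>x. Re (f (of_real x))) has_real_derivative Re f') (at a)"
  using bounded_linear.has_vector_derivative[OF bounded_linear_Re has_vector_derivative_real_field[OF assms]]
  by (simp add: has_real_derivative_iff_has_vector_derivative)

definition mid_strip :: "complex set"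
  where "mid_strip = {t. - apery_L < Re t \<and> Re t < apery_L}"

lemma open_mid_strip: "open mid_strip" and convex_mid_strip: "convex mid_strip"
proof -
  have *: "mid_strip = {t. - apery_L < Re t} \<inter> {t. Re t < apery_L}" by (auto simp: mid_strip_def)
  show "open mid_strip" unfolding * by (intro open_Int open_halfspace_Re_gt open_halfspace_Re_lt)
  show "convex mid_strip" unfolding * by (intro convex_Int convex_halfspace_Re_gt convex_halfspace_Re_lt)
qed

lemma apery_P_nonzero_mid_strip: "t \<in> mid_strip \<Longrightarrow> apery_P t \<noteq> 0"
  by (intro apery_P_nonzero_Re) (auto simp: mid_strip_def)

lemma apery_P_of_real:
  "apery_P (of_real t) = of_real (- apery_N t)"
  "apery_P' (of_real t) = of_real (2 * exp t ^ 2 - 34 * exp t)"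
  by (simp_all add: apery_P_def apery_P'_def apery_N_def exp_of_real)

lemma apery_N_pos:
  assumes "- apery_L < t" "t < apery_L"
  shows "apery_N t > 0"
proof -
  have "apery_P (of_real t) = of_real ((exp t - exp apery_L) * (exp t - exp (- apery_L)))"
    unfolding apery_P_roots by (simp only: exp_of_real of_real_diff of_real_mult)
  hence "- apery_N t = (exp t - exp apery_L) * (exp t - exp (- apery_L))"
    unfolding apery_P_of_real by (rule of_real_eq_iff[THEN iffD1])
  moreover have "\<dots> < 0" using assms by (intro mult_neg_pos) auto
  ultimately show ?thesis by linarith
qed

definition apery_p :: "real \<Rightarrow> real \<Rightarrow> real"
  where "apery_p c t = Re (apery_P1 (of_real c) (of_real t))"

definition apery_p' :: "real \<Rightarrow> real \<Rightarrow> real"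
  where "apery_p' c t = Re (apery_P1' (of_real c) (of_real t))"

lemma apery_p_props:
  assumes c: "apery_point c"
  shows "- apery_N (c + s) = s * apery_p c (c + s)"
    "2 * exp (c + s) ^ 2 - 34 * exp (c + s) = apery_p c (c + s) + s * apery_p' c (c + s)"
    "(apery_p c has_real_derivative apery_p' c t) (at t)"
    "apery_p c c = 2 * exp c * (exp c - 17)"
    "isCont (apery_p' c) t"
proof -
  note c0 = apery_P_apery_point[OF c]
  have "Re (apery_P (of_real (c + s))) = s * apery_p c (c + s)"
    unfolding apery_P_factor[OF c0] apery_p_def by simp
  thus "- apery_N (c + s) = s * apery_p c (c + s)" by (simp only: apery_P_of_real Re_complex_of_real)
  have "Re (apery_P' (of_real (c + s))) = apery_p c (c + s) + s * apery_p' c (c + s)"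
    unfolding apery_P'_factor[OF c0] apery_p_def apery_p'_def by simp
  thus "2 * exp (c + s) ^ 2 - 34 * exp (c + s) = apery_p c (c + s) + s * apery_p' c (c + s)"
    by (simp only: apery_P_of_real Re_complex_of_real)
  show "(apery_p c has_real_derivative apery_p' c t) (at t)"
    unfolding apery_p_def[abs_def] apery_p'_def apery_P1'_def
    by (intro has_real_derivative_Re holomorphic_derivI[OF holomorphic_apery_P1[OF c0, of UNIV]]) auto
  show "apery_p c c = 2 * exp c * (exp c - 17)"
    by (simp only: apery_p_def apery_P1_apery_point Re_complex_of_real)
  have "((\<lambda>x. Re (apery_P1' (of_real c) (of_real x))) has_real_derivative
      Re (deriv (apery_P1' (of_real c)) (of_real t))) (at t)"
    by (intro has_real_derivative_Re holomorphic_derivI[OF holomorphic_apery_P1'[OF c0, of UNIV]]) auto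
  thus "isCont (apery_p' c) t" unfolding apery_p'_def[abs_def] by (rule DERIV_isCont)
qed

lemma square_derivs_real:
  fixes c s :: real
  assumes Y: "Y holomorphic_on S" "open S"
    and W: "open W" "\<And>w. w \<in> W \<Longrightarrow> of_real c + w^2 \<in> S" "\<And>w. w \<in> W \<Longrightarrow> G w = Y (of_real c + w^2)"
    and s: "of_real s \<in> W"
  defines "t \<equiv> c + s^2"
  shows "Re (Y (of_real t)) = Re (G (of_real s))"
    "Re (deriv G (of_real s)) = 2 * s * Re (deriv Y (of_real t))"
    "Re ((deriv ^^ 2) G (of_real s)) = 2 * Re (deriv Y (of_real t)) + 4 * s^2 * Re ((deriv ^^ 2) Y (of_real t))"
proof -
  have t: "of_real t = (of_real c + of_real s ^ 2 :: complex)" by (simp add: t_def)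
  show "Re (Y (of_real t)) = Re (G (of_real s))" using W(3)[OF s] t by simp
  show "Re (deriv G (of_real s)) = 2 * s * Re (deriv Y (of_real t))"
    using arg_cong[OF derivs_square_substitution(1)[OF Y W s], of Re] by (simp add: t)
  have "(4 * of_real s ^ 2 :: complex) = of_real (4 * s^2)" by simp
  thus "Re ((deriv ^^ 2) G (of_real s)) = 2 * Re (deriv Y (of_real t)) + 4 * s^2 * Re ((deriv ^^ 2) Y (of_real t))"
    using arg_cong[OF derivs_square_substitution(2)[OF Y W s], of Re] unfolding t
    by (simp del: of_real_power of_real_mult)
qed

lemma isCont_Re_deriv:
  assumes "G holomorphic_on ball 0 r" "r > 0"
  shows "((\<lambda>s. Re ((deriv ^^ n) G (of_real s))) \<longlongrightarrow> Re ((deriv ^^ n) G 0)) (at_right 0)"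
proof -
  have "((deriv ^^ n) G has_field_derivative (deriv ^^ Suc n) G 0) (at (of_real 0))"
    using has_field_derivative_higher_deriv[OF assms(1), of 0 n] assms(2) by simp
  from DERIV_isCont[OF has_real_derivative_Re[OF this]] show ?thesis
    by (simp add: isCont_def filterlim_at_split)
qed

lemma filterlim_sqrt_shift: "filterlim (\<lambda>t. sqrt (t - c)) (at_right 0) (at_right c)"
proof -
  have "((\<lambda>t. sqrt (t - c)) \<longlongrightarrow> sqrt (c - c)) (at_right c)"
    by (intro tendsto_intros)
  moreover have "eventually (\<lambda>t. sqrt (t - c) \<in> {0<..}) (at_right c)"
    by (auto simp: eventually_at_right_field intro!: exI[of _ "c + 1"])
  ultimately show ?thesis by (auto simp: filterlim_at elim: eventually_mono)
qed

lemma tendsto_sqrt_shift: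
  assumes f: "(f \<longlongrightarrow> l) (at_right (0::real))" and fg: "\<And>s. 0 < s \<Longrightarrow> s < \<rho> \<Longrightarrow> g (c + s^2) = f s" and "\<rho> > 0"
  shows "(g \<longlongrightarrow> l) (at_right (c :: real))"
proof (rule Lim_transform_eventually[OF filterlim_compose[OF f filterlim_sqrt_shift]])
  have "eventually (\<lambda>t. c < t \<and> t < c + \<rho>^2) (at_right c)"
    using assms(3) by (auto simp: eventually_at_right_field intro!: exI[of _ "c + \<rho>^2"])
  thus "eventually (\<lambda>t. f (sqrt (t - c)) = g t) (at_right c)"
  proof eventually_elim
    case (elim t)
    have "sqrt (t - c) < \<rho>" using elim assms(3) by (intro real_less_lsqrt) auto
    thus ?case using fg[of "sqrt (t - c)"] elim by simp
  qed
qed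

text \<open>The equation has real coefficients on the real axis, so the real part of a solution
  solves it too. As \<open>J\<close> is quadratic, its constancy for real parts does not follow from
  the complex statement and is derived afresh; the constant is identified by the limit at
  \<open>- apery_L\<close>.\<close>

lemma apery_J_real_constant:
  fixes Y :: "complex \<Rightarrow> complex"
  defines "r0 \<equiv> \<lambda>t. Re (Y (of_real t))" and "r1 \<equiv> \<lambda>t. Re (deriv Y (of_real t))"
    and "r2 \<equiv> \<lambda>t. Re ((deriv ^^ 2) Y (of_real t))"
  defines "J \<equiv> \<lambda>t. - apery_N t * (r0 t * r2 t - (r1 t)^2 / 2)
       - (34 * exp t - 2 * exp t ^ 2) / 2 * r0 t * r1 t + (exp t ^ 2 - 10 * exp t) / 2 * (r0 t)^2"
  assumes Y: "apery_sol Y mid_strip"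
    and lim: "(J \<longlongrightarrow> l) (at_right (- apery_L))"
    and t: "- apery_L < t" "t < apery_L"
  shows "J t = l"
proof -
  have hol: "Y holomorphic_on mid_strip" using Y by (rule lsol_holomorphic)
  have der: "(J has_real_derivative 0) (at t)" if t: "- apery_L < t" "t < apery_L" for t
  proof -
    have tm: "of_real t \<in> mid_strip" using t by (simp add: mid_strip_def)
    note d = has_field_derivative_derivs[OF hol open_mid_strip tm, THEN has_real_derivative_Re]
    define r3 where "r3 = Re ((deriv ^^ 3) Y (of_real t))"
    have "apery_P (of_real t) * (deriv ^^ 3) Y (of_real t) + 3 / 2 * apery_P' (of_real t) * (deriv ^^ 2) Y (of_real t)
      + (3 * exp (of_real t) ^ 2 - 27 * exp (of_real t)) * deriv Y (of_real t)
      + (exp (of_real t) ^ 2 - 5 * exp (of_real t)) * Y (of_real t) = 0"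
      using Y apery_sol_iff[OF apery_P_nonzero_mid_strip] tm by auto
    moreover have "3 * exp (of_real t) ^ 2 - 27 * exp (of_real t) = complex_of_real (3 * exp t ^ 2 - 27 * exp t)"
      "exp (of_real t) ^ 2 - 5 * exp (of_real t) = complex_of_real (exp t ^ 2 - 5 * exp t)"
      "3 / 2 * apery_P' (of_real t) = complex_of_real (3 / 2 * (2 * exp t ^ 2 - 34 * exp t))"
      by (simp_all add: exp_of_real apery_P_of_real)
    ultimately have "Re (of_real (- apery_N t) * (deriv ^^ 3) Y (of_real t)
      + of_real (3 / 2 * (2 * exp t ^ 2 - 34 * exp t)) * (deriv ^^ 2) Y (of_real t)
      + of_real (3 * exp t ^ 2 - 27 * exp t) * deriv Y (of_real t)
      + of_real (exp t ^ 2 - 5 * exp t) * Y (of_real t)) = 0"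
      by (simp only: apery_P_of_real zero_complex.sel)
    hence ode: "- apery_N t * r3 + 3 / 2 * (2 * exp t ^ 2 - 34 * exp t) * r2 t
      + (3 * exp t ^ 2 - 27 * exp t) * r1 t + (exp t ^ 2 - 5 * exp t) * r0 t = 0"
      by (simp only: plus_complex.sel r0_def r1_def r2_def r3_def
        times_complex.sel Re_complex_of_real Im_complex_of_real mult_zero_left diff_zero)
    have dN: "(apery_N has_real_derivative (34 * exp t - 2 * exp t ^ 2)) (at t)"
      unfolding apery_N_def[abs_def] by (auto intro!: derivative_eq_intros simp: power2_eq_square)
    have "(J has_real_derivative
       ((2 * exp t ^ 2 - 34 * exp t) * (r0 t * r2 t - (r1 t)^2 / 2)
       + - apery_N t * (r1 t * r2 t + r0 t * r3 - r1 t * r2 t)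
       + (4 * exp t^2 - 34 * exp t) / 2 * r0 t * r1 t + (2 * exp t ^ 2 - 34 * exp t) / 2 * (r1 t * r1 t + r0 t * r2 t)
       + (2 * exp t^2 - 10 * exp t) / 2 * (r0 t)^2 + (exp t ^ 2 - 10 * exp t) / 2 * (2 * r0 t * r1 t))) (at t)"
      unfolding J_def
      by (rule DERIV_cong, (rule d[folded r0_def r1_def r2_def r3_def] dN DERIV_add DERIV_diff DERIV_minus DERIV_cdivide
            DERIV_cmult DERIV_power DERIV_mult DERIV_exp)+)
         (simp add: field_simps power2_eq_square r0_def r1_def r2_def r3_def)
    thus ?thesis by (simp only: apery_J_algebra[OF ode])
  qed
  define S where "S = {- apery_L<..<apery_L}"
  have der': "(J has_real_derivative 0) (at x)" if "x \<in> S" for x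
    using der that by (auto simp: S_def)
  have "continuous_on S J"
    by (intro continuous_at_imp_continuous_on ballI DERIV_isCont[OF der'])
  from DERIV_zero_connected_constant[of S, OF _ _ finite.emptyI this] der'
  obtain k where k: "\<And>x. x \<in> S \<Longrightarrow> J x = k" by (auto simp: S_def)
  have "eventually (\<lambda>x. J x = k) (at_right (- apery_L))"
    unfolding eventually_at_right_field using k apery_L_gt_1 by (intro exI[of _ apery_L]) (auto simp: S_def)
  hence "(J \<longlongrightarrow> k) (at_right (- apery_L))" by (rule tendsto_eventually)
  with lim have "k = l" using tendsto_unique[of "at_right (- apery_L)" J k l] by simp
  thus ?thesis using k t by (simp add: S_def)
qed

text \<open>The initial values are those of an odd function. At \<open>w = 0\<close> only
  \<open>- p * g^2 / 8\<close> remains of the first integral, with \<open>p < 0\<close> the value of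
  \<open>apery_P1\<close> at the singular point; the choice \<open>g^2 = - 4 / p\<close> makes this
  \<open>1/2\<close>, as the barrier demands.\<close>

lemma apery_odd_solution_grows:
  fixes Y G :: "complex \<Rightarrow> complex"
  defines "L \<equiv> apery_L"
  defines "g \<equiv> 2 / sqrt (- apery_p (- L) (- L))"
  assumes Y: "apery_sol Y mid_strip" and G: "G holomorphic_on ball 0 \<rho>" and \<rho>: "0 < \<rho>" "\<rho> \<le> 1"
    and GY: "\<And>w. w \<in> cone_right \<rho> \<Longrightarrow> G w = Y (of_real (- L) + w^2)"
    and init: "G 0 = 0" "(deriv ^^ 2) G 0 = 0" "deriv G 0 = of_real g"
    and t: "- L < t" "t < L"
  shows "Re (Y (of_real t)) > 0 \<and>
    apery_M (\<lambda>t. Re (Y (of_real t))) (\<lambda>t. Re (deriv Y (of_real t))) t > 1"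
proof -
  define c where "c = - L"
  have c: "apery_point c" by (simp add: apery_point_def c_def L_def)
  have hol: "Y holomorphic_on mid_strip" using Y by (rule lsol_holomorphic)
  define r0 where "r0 = (\<lambda>t. Re (Y (of_real t)))"
  define r1 where "r1 = (\<lambda>t. Re (deriv Y (of_real t)))"
  define r2 where "r2 = (\<lambda>t. Re ((deriv ^^ 2) Y (of_real t)))"
  define g0 where "g0 = (\<lambda>s. Re (G (of_real s)))"
  define g1 where "g1 = (\<lambda>s. Re (deriv G (of_real s)))"
  define g2 where "g2 = (\<lambda>s. Re ((deriv ^^ 2) G (of_real s)))"
  define p where "p = apery_p c"
  define p' where "p' = apery_p' c"
  note pp = apery_p_props[OF c, folded p_def p'_def]
  have pc: "p c < 0"
  proof -
    have "exp c < 1" using apery_L_gt_1 by (simp add: c_def L_def)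
    hence "exp c - 17 < 0" by linarith
    thus ?thesis unfolding pp(4) by (intro mult_pos_neg) simp
  qed
  have g: "g > 0" "g^2 = - 4 / p c"
    using pc by (auto simp: g_def p_def c_def power_divide)
  have sub: "of_real c + w^2 \<in> mid_strip" if "w \<in> cone_right \<rho>" for w
  proof -
    have "\<bar>Im w\<bar> < Re w" "norm w < \<rho>" using that by (auto simp: in_sector)
    moreover from this(1) have "(Im w)^2 < (Re w)^2"
      by (metis abs_le_square_iff abs_of_nonneg abs_ge_zero linorder_not_less order_less_imp_le order_le_less_trans)
    moreover have "Re (w^2) \<le> norm w ^ 2" using complex_Re_le_cmod[of "w^2"] by (simp add: norm_power)
    moreover have "norm w ^ 2 \<le> 1" using \<open>norm w < \<rho>\<close> \<rho> by (intro power_le_one) auto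
    ultimately show ?thesis
      using apery_L_gt_1 by (simp add: mid_strip_def c_def L_def Re_Im_square)
  qed
  have sin: "complex_of_real s \<in> cone_right \<rho>" if "0 < s" "s < \<rho>" for s
    using that by (simp add: in_sector)
  have GY': "G w = Y (of_real c + w^2)" if "w \<in> cone_right \<rho>" for w
    using GY[OF that] by (simp add: c_def)
  have sr: "r0 (c + s^2) = g0 s" "g1 s = 2 * s * r1 (c + s^2)" "g2 s = 2 * r1 (c + s^2) + 4 * s^2 * r2 (c + s^2)"
    if "0 < s" "s < \<rho>" for s
    using square_derivs_real[OF hol open_mid_strip open_sector sub GY' sin[OF that]]
    by (simp_all add: r0_def r1_def r2_def g0_def g1_def g2_def)
  have lim0: "(g0 \<longlongrightarrow> 0) (at_right 0)" "(g1 \<longlongrightarrow> g) (at_right 0)" "(g2 \<longlongrightarrow> 0) (at_right 0)"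
    using isCont_Re_deriv[OF G \<rho>(1), of 0] isCont_Re_deriv[OF G \<rho>(1), of 1] isCont_Re_deriv[OF G \<rho>(1), of 2]
      init unfolding g0_def g1_def g2_def by simp_all
  have limc: "((\<lambda>s. f (c + s^2)) \<longlongrightarrow> f c) (at_right 0)" if "isCont f c" for f :: "real \<Rightarrow> real"
    by (rule isCont_tendsto_compose[OF that]) (auto intro!: tendsto_eq_intros)
  have contp: "isCont p c" "isCont p' c" using DERIV_isCont[OF pp(3)] pp(5) by auto
  define J where "J = (\<lambda>t. - apery_N t * (r0 t * r2 t - (r1 t)^2 / 2)
       - (34 * exp t - 2 * exp t ^ 2) / 2 * r0 t * r1 t + (exp t ^ 2 - 10 * exp t) / 2 * (r0 t)^2)"
  have Js: "J (c + s^2) = p (c + s^2) * (g0 s * g2 s / 4 - (g1 s)^2 / 8) + s / 4 * p' (c + s^2) * g0 s * g1 s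
       + (exp (c + s^2) ^ 2 - 10 * exp (c + s^2)) / 2 * (g0 s)^2" if s: "0 < s" "s < \<rho>" for s
  proof -
    have *: "N * (a0 * a2 - a1^2 / 2) - q / 2 * a0 * a1 + k / 2 * a0^2 = P * (a0 * b2 / 4 - b1^2 / 8) + s / 4 * P' * a0 * b1 + k / 2 * a0^2"
      if "N = s^2 * P" "- q = P + s^2 * P'" "b1 = 2 * s * a1" "b2 = 2 * a1 + 4 * s^2 * a2" for N q a0 a1 a2 b1 b2 k P P' :: real
    proof -
      have q: "q = - (P + s^2 * P')" using that(2) by simp
      show ?thesis unfolding that(1,3,4) q by (simp add: field_simps power2_eq_square)
    qed
    show ?thesis unfolding J_def sr(1)[OF s, symmetric]
      by (rule *) (use pp(1)[of "s^2"] pp(2)[of "s^2"] sr[OF s] in simp_all)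
  qed
  have "((\<lambda>s. p (c + s^2) * (g0 s * g2 s / 4 - (g1 s)^2 / 8) + s / 4 * p' (c + s^2) * g0 s * g1 s
       + (exp (c + s^2) ^ 2 - 10 * exp (c + s^2)) / 2 * (g0 s)^2) \<longlongrightarrow>
       p c * (0 * 0 / 4 - g^2 / 8) + 0 / 4 * p' c * 0 * g + (exp c ^ 2 - 10 * exp c) / 2 * 0^2) (at_right 0)"
    using lim0 by (intro tendsto_intros limc contp) (auto intro!: tendsto_eq_intros)
  also have "p c * (0 * 0 / 4 - g^2 / 8) + 0 / 4 * p' c * 0 * g + (exp c ^ 2 - 10 * exp c) / 2 * 0^2 = 1 / 2"
    using pc by (simp add: g(2))
  finally have "(J \<longlongrightarrow> 1 / 2) (at_right c)"
    by (rule tendsto_sqrt_shift[where g = J and c = c and \<rho> = \<rho>]) (use Js \<rho> in auto)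
  hence Jhalf: "J t = 1 / 2" if "- L < t" "t < L" for t
    using apery_J_real_constant[OF Y, of "1/2" t] that
    unfolding J_def r0_def r1_def r2_def c_def L_def by simp
  define h where "h = (\<lambda>t::real. (5 * exp t + 3) / (8 * (exp t + 1)))"
  define M where "M = apery_M r0 r1"
  \<comment> \<open>This is \<open>M\<close> in the coordinate \<open>s = sqrt (t - c)\<close>: the
    factor \<open>s\<close> in \<open>sqrt N = s * sqrt (- p)\<close> cancels the one in
    \<open>r1 = g1 / (2 * s)\<close>. It is differentiable at 0 with value 1 and derivative 0,
    whereas \<open>g0\<close> has derivative \<open>g > 0\<close>; hence \<open>(M - 1) / r0\<close>
    tends to 0.\<close>
  define m where "m = (\<lambda>s. sqrt (- p (c + s^2)) * (g1 s / 2 + s * h (c + s^2) * g0 s))"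
  have Ms: "M (c + s^2) = m s" if s: "0 < s" "s < \<rho>" for s
  proof -
    have "apery_N (c + s^2) = s^2 * (- p (c + s^2))" using pp(1)[of "s^2"] by simp
    hence "sqrt (apery_N (c + s^2)) = s * sqrt (- p (c + s^2))"
      using s by (simp only: real_sqrt_mult) simp
    moreover have "s * (r1 (c + s^2) + h (c + s^2) * g0 s) = g1 s / 2 + s * h (c + s^2) * g0 s"
      using sr(2)[OF s] by (simp add: algebra_simps)
    moreover have "M t = sqrt (apery_N t) * (r1 t + h t * r0 t)" for t
      by (simp add: M_def apery_M_def h_def)
    ultimately show ?thesis
      by (simp only: m_def sr(1)[OF s]) (simp add: mult.assoc mult.left_commute)
  qed
  have hder: "\<exists>D. (h has_real_derivative D) (at t)" for t
  proof -
    have "exp t + 1 \<noteq> 0" using exp_gt_zero[of t] by linarith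
    thus ?thesis unfolding h_def by (auto intro!: exI derivative_eq_intros)
  qed
  obtain h' where h': "(h has_real_derivative h') (at c)" using hder by blast
  have G': "((deriv ^^ n) G has_field_derivative (deriv ^^ Suc n) G 0) (at (of_real 0))" for n
    using has_field_derivative_higher_deriv[OF G, of 0 n] \<rho> by simp
  have dg0: "(g0 has_real_derivative g) (at 0)"
    using has_real_derivative_Re[OF G'[of 0]] init by (simp add: g0_def)
  have dg1: "(g1 has_real_derivative 0) (at 0)"
    using has_real_derivative_Re[OF G'[of 1]] init by (simp add: g1_def numeral_2_eq_2)
  have g00: "g0 0 = 0" "g1 0 = g" using init by (simp_all add: g0_def g1_def)
  have dsq: "((\<lambda>s. f (c + s^2)) has_real_derivative 0) (at 0)" if "(f has_real_derivative D) (at c)" for f D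
  proof -
    have "((\<lambda>s. c + s^2) has_real_derivative 0) (at 0)" by (auto intro!: derivative_eq_intros)
    thus ?thesis using DERIV_chain2[of f D "\<lambda>s. c + s^2" 0 0 UNIV] that by simp
  qed
  have dm: "(m has_real_derivative 0) (at 0)"
  proof -
    have "((\<lambda>t. sqrt (- p t)) has_real_derivative (inverse (sqrt (- p c)) / 2 * (- p' c))) (at c)"
      using pc by (intro DERIV_chain2[OF DERIV_real_sqrt DERIV_minus[OF pp(3)]]) auto
    note 1 = dsq[OF this]
    have 2: "((\<lambda>s. s * h (c + s^2) * g0 s) has_real_derivative 0) (at 0)"
      using DERIV_mult[OF DERIV_mult[OF DERIV_ident dsq[OF h']] dg0] by (simp add: g00)
    show ?thesis
      using DERIV_mult[OF 1 DERIV_add[OF DERIV_cdivide[OF dg1, of 2] 2]] unfolding m_def by simp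
  qed
  have m0: "m 0 = 1" using pc g by (simp add: m_def g00 g_def p_def c_def)
  have "((\<lambda>s. (m s - 1) / s) \<longlongrightarrow> 0) (at 0)"
    using dm unfolding DERIV_def by (simp add: m0)
  moreover have gs: "((\<lambda>s. g0 s / s) \<longlongrightarrow> g) (at 0)"
    using dg0 unfolding DERIV_def by (simp add: g00)
  ultimately have "((\<lambda>s. ((m s - 1) / s) / (g0 s / s)) \<longlongrightarrow> 0 / g) (at 0)"
    using g by (intro tendsto_divide) auto
  hence "((\<lambda>s. ((m s - 1) / s) / (g0 s / s)) \<longlongrightarrow> 0) (at_right 0)"
    by (simp add: filterlim_at_split)
  hence limM: "((\<lambda>t. (M t - 1) / r0 t) \<longlongrightarrow> 0) (at_right c)"
    by (rule tendsto_sqrt_shift[where c = c and \<rho> = \<rho>]) (use \<rho> in \<open>auto simp: Ms sr(1)\<close>)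
  have "eventually (\<lambda>s. g0 s / s > 0) (at 0)"
    using order_tendstoD(1)[OF gs] g by auto
  hence "eventually (\<lambda>s. g0 s > 0) (at_right 0)"
    unfolding eventually_at_split using eventually_at_right_less[of 0]
    by (auto elim!: eventually_elim2 simp: zero_less_divide_iff)
  from filterlim_sqrt_shift[THEN filterlim_iff[THEN iffD1], rule_format, OF this]
  have "eventually (\<lambda>t. g0 (sqrt (t - c)) > 0) (at_right c)" .
  moreover have "eventually (\<lambda>t. c < t \<and> t < c + \<rho>^2) (at_right c)"
    using \<rho> by (auto simp: eventually_at_right_field intro!: exI[of _ "c + \<rho>^2"])
  ultimately have pos: "eventually (\<lambda>t. r0 t > 0) (at_right c)"
  proof eventually_elim
    case (elim t)
    have "sqrt (t - c) < \<rho>" using elim \<rho> by (intro real_less_lsqrt) auto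
    thus ?case using elim sr(1)[of "sqrt (t - c)"] by simp
  qed
  have der: "(r0 has_real_derivative r1 t) (at t)" "(r1 has_real_derivative r2 t) (at t)" if "c < t" "t < L" for t
  proof -
    have "of_real t \<in> mid_strip" using that by (simp add: mid_strip_def c_def L_def)
    from has_field_derivative_derivs(1,2)[OF hol open_mid_strip this, THEN has_real_derivative_Re]
    show "(r0 has_real_derivative r1 t) (at t)" "(r1 has_real_derivative r2 t) (at t)"
      by (simp_all add: r0_def r1_def r2_def)
  qed
  have "r0 t > 0 \<and> apery_M r0 r1 t > 1"
  proof (rule apery_barrier[where a = c and b = L and ?r2.0 = r2])
    show "apery_N c = 0" using pp(1)[of 0] by simp
    show "c < L" using apery_L_gt_1 by (simp add: c_def L_def)
    show "apery_N t > 0" if "c < t" "t < L" for t using that apery_N_pos by (simp add: c_def L_def)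
    show "- apery_N t * (r0 t * r2 t - (r1 t)^2 / 2)
       - (34 * exp t - 2 * exp t ^ 2) / 2 * r0 t * r1 t + (exp t ^ 2 - 10 * exp t) / 2 * (r0 t)^2 = 1 / 2"
      if "c < t" "t < L" for t using Jhalf[of t] that by (simp add: J_def c_def)
  qed (use der pos limM t in \<open>auto simp: c_def M_def\<close>)
  thus ?thesis by (simp add: r0_def r1_def)
qed

subsection \<open>The local monodromies do not commute\<close>

lemma csqrt_in_quarter1:
  assumes "t \<in> ball (of_real c) d" "Im t > 0"
  shows "csqrt (t - of_real c) \<in> quarter1 (sqrt d)"
proof -
  define w where "w = csqrt (t - of_real c)"
  have w2: "w^2 = t - of_real c" by (simp add: w_def)
  have "Im (w^2) > 0" using assms(2) by (simp add: w2)
  hence *: "Re w * Im w > 0" unfolding Re_Im_square by linarith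
  moreover have "Re w \<ge> 0" unfolding w_def using csqrt_principal[of "t - of_real c"] by auto
  ultimately have "Re w > 0" "Im w > 0" by (auto simp: zero_less_mult_iff)
  moreover have "norm w ^ 2 < d"
    using assms(1) by (simp add: w2 flip: norm_power) (simp add: dist_norm norm_minus_commute)
  hence "norm w < sqrt d" by (rule real_less_rsqrt)
  ultimately show ?thesis by (simp add: in_sector w_def)
qed

lemma uniformizes_inject:
  assumes "uniformizes d c y G" "uniformizes d c z K" "0 < d" "d \<le> e"
    and hol: "y holomorphic_on strip e" "z holomorphic_on strip e"
    and GK: "\<And>w. w \<in> quarter1 (sqrt d) \<Longrightarrow> G w = K w" and t: "t \<in> strip e"
  shows "y t = z t"
proof (rule convex_overlap_unique[OF hol open_ball open_strip convex_strip _ _ t])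
  show "ball (of_real c) d \<inter> strip e \<noteq> {}"
    using half_disc_overlap(1)[OF assms(3,4), of c] half_disc_subset(1)[of d c] by blast
  fix s assume s: "s \<in> ball (of_real c) d \<inter> strip e"
  hence "csqrt (s - of_real c) \<in> quarter1 (sqrt d)"
    by (intro csqrt_in_quarter1) (auto simp: strip_def)
  from GK[OF this] show "y s = z s" using assms(1,2) \<open>csqrt _ \<in> _\<close> by (simp add: uniformizes_def)
qed

lemma lsol_cmult:
  assumes "lsol p a f D" "open D"
  shows "lsol p a (\<lambda>z. k * f z) D"
  unfolding lsol_def
proof (intro conjI ballI)
  show "(\<lambda>z. k * f z) holomorphic_on D" using assms by (auto simp: lsol_def intro!: holomorphic_intros)
  fix z assume z: "z \<in> D"
  have "(deriv ^^ j) (\<lambda>z. k * f z) z = k * (deriv ^^ j) f z" for j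
    using assms z by (intro higher_deriv_cmult[of _ D]) (auto simp: lsol_def)
  thus "(deriv ^^ p) (\<lambda>z. k * f z) z = (\<Sum>j<p. a j z * (deriv ^^ j) (\<lambda>z. k * f z) z)"
    using assms z by (simp add: lsol_def sum_distrib_left mult.left_commute)
qed

lemma apery_uniformizes_lsol:
  assumes c: "apery_point c" and d: "0 < d" "d \<le> 1" "d \<le> e" and y: "apery_sol y (strip e)"
    and G: "uniformizes d c y G"
  shows "lsol 3 (apery_local_coeff (of_real c)) G (ball 0 (sqrt d))"
proof -
  obtain K where K: "uniformizes d c y K" "lsol 3 (apery_local_coeff (of_real c)) K (ball 0 (sqrt d))"
    using apery_uniformizes_exists[OF c d y] by blast
  show ?thesis
    by (rule lsol_cong[OF K(2) open_ball uniformizes_unique[OF K(1) G d(1,3)]]) auto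
qed

lemma half_disc_subset_mid_strip:
  assumes "d \<le> 1"
  shows "right_disc d (- apery_L) \<subseteq> mid_strip" "left_disc d apery_L \<subseteq> mid_strip"
proof -
  have *: "\<bar>Re t - c\<bar> < 1" if "t \<in> ball (of_real c) d" for t c
    using that assms abs_Re_le_cmod[of "t - of_real c"] by (simp add: dist_norm norm_minus_commute)
  show "right_disc d (- apery_L) \<subseteq> mid_strip"
  proof
    fix t assume "t \<in> right_disc d (- apery_L)"
    hence t: "Re t > - apery_L" "t \<in> ball (of_real (- apery_L)) d"
      unfolding right_disc_def by blast+
    with *[OF t(2)] show "t \<in> mid_strip" using apery_L_gt_1 unfolding mid_strip_def by auto
  qed
  show "left_disc d apery_L \<subseteq> mid_strip"
  proof
    fix t assume "t \<in> left_disc d apery_L"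
    hence t: "Re t < apery_L" "t \<in> ball (of_real apery_L) d"
      unfolding left_disc_def by blast+
    with *[OF t(2)] show "t \<in> mid_strip" using apery_L_gt_1 unfolding mid_strip_def by auto
  qed
qed

lemma holomorphic_tendsto_0:
  assumes "G holomorphic_on ball 0 r" "r > 0"
  shows "((\<lambda>s. (deriv ^^ n) G (\<i> * of_real s)) \<longlongrightarrow> (deriv ^^ n) G 0) (at_right 0)"
proof -
  have "((deriv ^^ n) G has_field_derivative (deriv ^^ Suc n) G 0) (at 0)"
    using has_field_derivative_higher_deriv[OF assms(1), of 0 n] assms(2) by simp
  hence "isCont ((deriv ^^ n) G) 0" by (rule DERIV_isCont)
  moreover have "((\<lambda>s. \<i> * complex_of_real s) \<longlongrightarrow> 0) (at_right 0)"
    by (auto intro!: tendsto_eq_intros)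
  ultimately show ?thesis by (rule isCont_tendsto_compose)
qed

text \<open>If \<open>deriv G 0 = 0\<close>, oddness makes all three initial values vanish.
  Otherwise a rescaling reaches the normalised situation and the growth estimate holds up to
  \<open>L\<close>. Oddness at \<open>L\<close> would force the value 0 there, but
  \<open>r0 * exp t\<close> is positive and increasing; evenness would force
  \<open>sqrt N * r1\<close> to tend to 0, contrary to \<open>M > 1\<close>.\<close>

lemma apery_odd_eq_0:
  assumes d: "0 < d" "d \<le> 1" "d \<le> e" and e: "e \<le> 3" and y: "apery_sol y (strip e)"
    and G: "uniformizes d (- apery_L) y G" "\<And>w. w \<in> ball 0 (sqrt d) \<Longrightarrow> G (- w) = - G w"
    and K: "uniformizes d apery_L y K" "(\<forall>w\<in>ball 0 (sqrt d). K (- w) = - K w) \<or> (\<forall>w\<in>ball 0 (sqrt d). K (- w) = K w)"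
    and t: "t \<in> strip e"
  shows "y t = 0"
proof (cases "deriv G 0 = 0")
  define \<rho> where "\<rho> = sqrt d"
  have \<rho>: "0 < \<rho>" "\<rho> \<le> 1" using d by (auto simp: \<rho>_def)
  have pts: "apery_point (- apery_L)" "apery_point apery_L" by (auto simp: apery_point_def)
  have Gh: "G holomorphic_on ball 0 \<rho>" and Kh: "K holomorphic_on ball 0 \<rho>"
    using G(1) K(1) by (auto simp: uniformizes_def \<rho>_def)
  have G0: "(deriv ^^ n) G 0 = 0" if "even n" for n
    using odd_function_deriv[OF Gh \<rho>(1)] G(2) that by (simp add: \<rho>_def)
  {
    case True
    have "G w = 0" if "w \<in> quarter1 \<rho>" for w
    proof (rule lsol_eq_0[OF apery_uniformizes_lsol[OF pts(1) d y G(1)]])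
      show "(deriv ^^ j) G 0 = 0" if "j < 3" for j
      proof -
        have "j = 0 \<or> j = 1 \<or> j = 2" using that by auto
        thus ?thesis using G0[of j] True by auto
      qed
      show "apery_local_coeff (of_real (- apery_L)) j holomorphic_on ball 0 (sqrt d)" for j
      proof (rule holomorphic_apery_local_coeff[OF apery_P_apery_point[OF pts(1)]])
        fix w :: complex assume "w \<in> ball 0 (sqrt d)"
        thus "apery_P1 (of_real (- apery_L)) (of_real (- apery_L) + w^2) \<noteq> 0"
          by (intro apery_P1_nonzero_ball[OF pts(1) subsetD[OF subset_ball[OF d(2)] square_in_ball(1)]]) simp
      qed
    qed (use d that in \<open>auto simp: \<rho>_def in_sector\<close>)
    thus "y t = 0"
      using uniformizes_inject[OF G(1), of "\<lambda>_. 0" "\<lambda>_. 0"] d t lsol_holomorphic[OF y]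
      by (auto simp: uniformizes_def \<rho>_def)
  next
    case False
    have "Complex 0 (e/2) \<in> strip e \<inter> mid_strip"
      using d apery_L_gt_1 by (auto simp: strip_def mid_strip_def)
    hence "strip e \<inter> mid_strip \<noteq> {}" by blast
    from lsol_continue[OF y open_strip convex_strip open_mid_strip convex_mid_strip this
        holomorphic_apery_coeff[OF apery_P_nonzero_mid_strip]]
    obtain Y where Y: "apery_sol Y mid_strip" "\<And>z. z \<in> strip e \<inter> mid_strip \<Longrightarrow> y z = Y z" by blast
    have Yh: "Y holomorphic_on mid_strip" using Y(1) by (rule lsol_holomorphic)
    have inr: "of_real (- apery_L) + w^2 \<in> mid_strip" if "w \<in> cone_right \<rho>" for w
      using square_cone_left_right[of w d "- apery_L"] that half_disc_subset_mid_strip(1)[OF d(2)]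
      unfolding \<rho>_def by blast
    have inu: "of_real apery_L + w^2 \<in> mid_strip" if "w \<in> cone_up \<rho>" for w
      using square_cone_up[of w d apery_L] that half_disc_subset_mid_strip(2)[OF d(2)]
      unfolding \<rho>_def by blast
    have ins: "of_real c + w^2 \<in> strip e" if "w \<in> quarter1 \<rho>" for w c
      using square_quarter13[of w d e c] that d unfolding \<rho>_def by blast
    have sec: "f holomorphic_on sector u v \<rho>" if "f holomorphic_on ball 0 \<rho>" for f u v
      by (rule holomorphic_on_subset[OF that]) (auto simp: sector_def)
    \<comment> \<open>Between the two points, \<open>t\<close> lies to the right of
      \<open>-L\<close> and to the left of \<open>L\<close>; the corresponding coordinates are in
      \<open>cone_right\<close> at the former and in \<open>cone_up\<close> at the latter.\<close>
    have GY: "G w = Y (of_real (- apery_L) + w^2)" if "w \<in> cone_right \<rho>" for w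
    proof (rule convex_overlap_unique[OF sec[OF Gh] holomorphic_square_shift[OF Yh inr] open_sector
          open_sector convex_sector sector_overlap(5)[OF \<rho>(1)] _ that])
      fix w assume "w \<in> quarter1 \<rho> \<inter> cone_right \<rho>"
      thus "G w = Y (of_real (- apery_L) + w^2)"
        using G(1) Y(2)[of "of_real (- apery_L) + w^2"] inr[of w] ins[of w "- apery_L"]
        by (auto simp: uniformizes_def \<rho>_def)
    qed auto
    have KY: "K w = Y (of_real apery_L + w^2)" if "w \<in> cone_up \<rho>" for w
    proof (rule convex_overlap_unique[OF sec[OF Kh] holomorphic_square_shift[OF Yh inu] open_sector
          open_sector convex_sector sector_overlap(1)[OF \<rho>(1)] _ that])
      fix w assume "w \<in> quarter1 \<rho> \<inter> cone_up \<rho>"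
      thus "K w = Y (of_real apery_L + w^2)"
        using K(1) Y(2)[of "of_real apery_L + w^2"] inu[of w] ins[of w "apery_L"]
        by (auto simp: uniformizes_def \<rho>_def)
    qed auto
    define g where "g = 2 / sqrt (- apery_p (- apery_L) (- apery_L))"
    \<comment> \<open>A complex scaling factor, so that the coordinate of \<open>Z\<close> at
      \<open>-L\<close> has exactly the prescribed real derivative \<open>g\<close> at 0.\<close>
    define \<kappa> where "\<kappa> = of_real g / deriv G 0"
    define Z where "Z = (\<lambda>z. \<kappa> * Y z)"
    have Z: "apery_sol Z mid_strip" unfolding Z_def by (rule lsol_cmult[OF Y(1) open_mid_strip])
    have Zh: "Z holomorphic_on mid_strip" using Z by (rule lsol_holomorphic)
    define H where "H = (\<lambda>w. \<kappa> * K w)"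
    have Hh: "H holomorphic_on ball 0 \<rho>" unfolding H_def by (intro holomorphic_intros Kh)
    have dG: "(deriv ^^ n) (\<lambda>w. \<kappa> * G w) 0 = \<kappa> * (deriv ^^ n) G 0" for n
      using Gh \<rho> by (intro higher_deriv_cmult[of _ "ball 0 \<rho>"]) auto
    have grow: "Re (Z (of_real t)) > 0 \<and>
      apery_M (\<lambda>t. Re (Z (of_real t))) (\<lambda>t. Re (deriv Z (of_real t))) t > 1"
      if "- apery_L < t" "t < apery_L" for t
    proof (rule apery_odd_solution_grows[OF Z, of "\<lambda>w. \<kappa> * G w" \<rho>])
      show "deriv (\<lambda>w. \<kappa> * G w) 0 = of_real (2 / sqrt (- apery_p (- apery_L) (- apery_L)))"
        using dG[of 1] False by (simp add: \<kappa>_def g_def)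
    qed (use that \<rho> G0[of 0] G0[of 2] dG[of 2] GY Gh in \<open>auto simp: Z_def intro!: holomorphic_intros\<close>)
    define r0 where "r0 = (\<lambda>t. Re (Z (of_real t)))"
    define r1 where "r1 = (\<lambda>t. Re (deriv Z (of_real t)))"
    define h where "h = (\<lambda>t::real. (5 * exp t + 3) / (8 * (exp t + 1)))"
    have h: "0 \<le> h t" "h t \<le> 1" for t
    proof -
      have *: "8 * (exp t + 1) > 0" by (intro mult_pos_pos add_pos_pos) auto
      show "0 \<le> h t" unfolding h_def using * by (intro divide_nonneg_pos add_nonneg_nonneg) auto
      show "h t \<le> 1" unfolding h_def divide_le_eq_1_pos[OF *] by simp
    qed
    have grow': "r0 t > 0" "sqrt (apery_N t) * (r1 t + h t * r0 t) > 1"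
      if "- apery_L < t" "t < apery_L" for t
      using grow[OF that] by (simp_all add: r0_def r1_def apery_M_def h_def)
    have inu': "\<i> * of_real s \<in> cone_up \<rho>" if "0 < s" "s < \<rho>" for s
      using that by (simp add: in_sector norm_mult)
    have HZ: "H w = Z (of_real apery_L + w^2)" if "w \<in> cone_up \<rho>" for w
      using KY[OF that] by (simp add: H_def Z_def)
    have r0s: "r0 (apery_L - s^2) = Re (H (\<i> * of_real s))" if "0 < s" "s < \<rho>" for s
      using HZ[OF inu'[OF that]] by (simp add: r0_def power_mult_distrib)
    have rng: "- apery_L < apery_L - s^2" "apery_L - s^2 < apery_L" if "0 < s" "s < \<rho>" for s
    proof -
      have "s^2 \<le> 1" using that \<rho> by (intro power_le_one) auto
      thus "- apery_L < apery_L - s^2" "apery_L - s^2 < apery_L" using that apery_L_gt_1 by auto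
    qed
    have evs: "eventually (\<lambda>s. 0 < s \<and> s < \<rho>) (at_right 0)"
      using \<rho> by (auto simp: eventually_at_right_field)
    from K(2) have False
    proof
      assume "\<forall>w\<in>ball 0 (sqrt d). K (- w) = - K w"
      hence "K 0 = 0" using d by (auto dest: bspec[of _ _ 0])
      hence H0: "H 0 = 0" by (simp add: H_def)
      \<comment> \<open>From \<open>M > 1\<close> and \<open>h \<le> 1\<close> one gets only
        \<open>r1 + r0 > 0\<close>; multiplying by \<open>exp t\<close> turns this into
        monotonicity.\<close>
      define f where "f = (\<lambda>t. r0 t * exp t)"
      have df: "(f has_real_derivative (r1 t + r0 t) * exp t) (at t)" "(r1 t + r0 t) * exp t > 0"
        if t: "- apery_L < t" "t < apery_L" for t
      proof -
        have "of_real t \<in> mid_strip" using t by (simp add: mid_strip_def)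
        from has_real_derivative_Re[OF has_field_derivative_derivs(1)[OF Zh open_mid_strip this]]
        have "(r0 has_real_derivative r1 t) (at t)" by (simp add: r0_def r1_def)
        from DERIV_mult[OF this DERIV_exp] show "(f has_real_derivative (r1 t + r0 t) * exp t) (at t)"
          unfolding f_def by (simp add: algebra_simps)
        have "sqrt (apery_N t) * (r1 t + h t * r0 t) > 0" using grow'(2)[OF t] by linarith
        hence "r1 t + h t * r0 t > 0" using apery_N_pos[OF t] by (simp add: zero_less_mult_iff)
        moreover have "h t * r0 t \<le> 1 * r0 t" using h grow'(1)[OF t] by (intro mult_right_mono) auto
        ultimately show "(r1 t + r0 t) * exp t > 0" by (intro mult_pos_pos) auto
      qed
      have "f 0 \<le> f t" if t: "0 \<le> t" "t < apery_L" for t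
      proof (rule DERIV_nonneg_imp_nondecreasing[OF t(1)])
        fix x assume "0 \<le> x" "x \<le> t"
        hence "- apery_L < x" "x < apery_L" using t apery_L_gt_1 by auto
        from df[OF this] show "\<exists>y. (f has_real_derivative y) (at x) \<and> 0 \<le> y" by (blast intro: less_imp_le)
      qed
      moreover have "0 \<le> apery_L - s^2" if "0 < s" "s < \<rho>" for s
      proof -
        have "s^2 \<le> 1" using that \<rho> by (intro power_le_one) auto
        thus ?thesis using apery_L_gt_1 by auto
      qed
      ultimately have "f 0 \<le> f (apery_L - s^2)" if "0 < s" "s < \<rho>" for s
        using rng(2) that by blast
      hence "f 0 \<le> Re (H (\<i> * of_real s)) * exp (apery_L - s^2)" if "0 < s" "s < \<rho>" for s
        using that r0s unfolding f_def by metis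
      hence "eventually (\<lambda>s. f 0 \<le> Re (H (\<i> * of_real s)) * exp (apery_L - s^2)) (at_right 0)"
        using evs by (auto elim: eventually_mono)
      moreover have "((\<lambda>s. Re (H (\<i> * of_real s)) * exp (apery_L - s^2)) \<longlongrightarrow> Re (H 0) * exp (apery_L - 0^2)) (at_right 0)"
        using holomorphic_tendsto_0[OF Hh \<rho>(1), of 0] by (intro tendsto_intros) auto
      ultimately have "f 0 \<le> 0"
        using tendsto_lowerbound[of "\<lambda>s. Re (H (\<i> * of_real s)) * exp (apery_L - s^2)" _ "at_right 0" "f 0"]
        by (simp add: H0)
      moreover have "f 0 > 0" using grow'(1)[of 0] apery_L_gt_1 by (simp add: f_def)
      ultimately show False by simp
    next
      assume ev: "\<forall>w\<in>ball 0 (sqrt d). K (- w) = K w"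
      have H1: "deriv H 0 = 0"
        using even_function_deriv[OF Hh \<rho>(1), of 1] ev by (auto simp: \<rho>_def H_def)
      define p where "p = apery_p apery_L"
      note pp = apery_p_props[OF pts(2), folded p_def]
      \<comment> \<open>An upper bound for \<open>M\<close> at \<open>t = L - s^2\<close>, that is
        at \<open>w = \<i> * s\<close>, in terms of \<open>H\<close> and its derivative. Since
        \<open>deriv H 0 = 0\<close>, it tends to 0 with \<open>s\<close>.\<close>
      define B where "B = (\<lambda>s. sqrt (p (apery_L + - (s^2))) * (norm (deriv H (\<i> * of_real s)) / 2 + s * norm (H (\<i> * of_real s))))"
      have "1 < B s" if s: "0 < s" "s < \<rho>" for s
      proof -
        define t where "t = apery_L - s^2"
        have t: "of_real apery_L + (\<i> * of_real s)^2 = complex_of_real t" by (simp add: t_def power_mult_distrib)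
        have "apery_N t = s^2 * p t" using pp(1)[of "- (s^2)"] by (simp add: t_def)
        hence N: "sqrt (apery_N t) = s * sqrt (p t)"
          using s by (simp add: real_sqrt_mult)
        have "deriv H (\<i> * of_real s) = 2 * (\<i> * of_real s) * deriv Z (of_real t)"
          using derivs_square_substitution(1)[OF Zh open_mid_strip open_sector inu HZ inu'[OF s]] t by simp
        hence "norm (deriv H (\<i> * of_real s)) = 2 * s * norm (deriv Z (of_real t))"
          using s by (simp add: norm_mult)
        moreover have "r1 t \<le> norm (deriv Z (of_real t))" unfolding r1_def by (rule complex_Re_le_cmod)
        ultimately have 1: "s * r1 t \<le> norm (deriv H (\<i> * of_real s)) / 2" using s by simp
        have "r0 t \<le> norm (H (\<i> * of_real s))" using r0s[OF s] complex_Re_le_cmod by (simp add: t_def)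
        hence "h t * r0 t \<le> 1 * norm (H (\<i> * of_real s))"
          using h[of t] grow'(1)[OF rng[OF s]] by (intro mult_mono) (auto simp: t_def)
        hence 2: "s * (h t * r0 t) \<le> s * norm (H (\<i> * of_real s))" using s by simp
        have "1 < sqrt (p t) * (s * r1 t + s * (h t * r0 t))"
          using grow'(2)[OF rng[OF s]] N by (simp add: t_def[symmetric] algebra_simps)
        also have "\<dots> \<le> B s"
        proof -
          have "s^2 * p t > 0" using apery_N_pos[OF rng[OF s]] \<open>apery_N t = s^2 * p t\<close> by (simp only: t_def)
          hence "p t > 0" using s by (simp add: zero_less_mult_iff)
          moreover have "B s = sqrt (p t) * (norm (deriv H (\<i> * of_real s)) / 2 + s * norm (H (\<i> * of_real s)))"
            by (simp add: B_def t_def)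
          ultimately show ?thesis using add_mono[OF 1 2] by (simp only:) (rule mult_left_mono, auto)
        qed
        finally show ?thesis .
      qed
      hence "eventually (\<lambda>s. 1 \<le> B s) (at_right 0)"
        using evs by (auto elim!: eventually_mono intro: less_imp_le)
      moreover have "(B \<longlongrightarrow> sqrt (p (apery_L + - (0^2))) * (norm (deriv H 0) / 2 + 0 * norm (H 0))) (at_right 0)"
      proof -
        have "((\<lambda>s. p (apery_L + - (s^2))) \<longlongrightarrow> p (apery_L + - (0^2))) (at_right 0)"
          by (rule isCont_tendsto_compose[OF DERIV_isCont[OF pp(3)]]) (auto intro!: tendsto_eq_intros)
        thus ?thesis
          unfolding B_def using holomorphic_tendsto_0[OF Hh \<rho>(1), of 0] holomorphic_tendsto_0[OF Hh \<rho>(1), of 1]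
          by (intro tendsto_intros) auto
      qed
      ultimately show False
        using tendsto_lowerbound[of B 0 "at_right 0" 1] by (simp add: H1)
    qed
    thus "y t = 0" ..
  }
qed

section \<open>The half plane of convergence, and the approach to \<open>-L\<close> from the
  left\<close>

definition left_half :: "complex set"
  where "left_half = {t. Re t < - apery_L}"

text \<open>With \<open>deriv G 0 = 0\<close> and \<open>x = exp (- L) < 1\<close>, the first
  integral at \<open>w = 0\<close> is
  \<open>x * (x - 17) / 2 * G * G'' + (x^2 - 10 * x) / 2 * G^2\<close>. Approaching
  \<open>-L\<close> from the left gives \<open>G 0 \<ge> 1\<close> and \<open>G'' \<ge> 0\<close>,
  so the first term is at most 0 and the second is negative.\<close>

lemma apery_even_contradiction:
  assumes d: "0 < d" "d \<le> 1" "d \<le> e"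
    and G: "uniformizes d (- apery_L) y G" "\<And>w. w \<in> ball 0 (sqrt d) \<Longrightarrow> G (- w) = G w"
    and A: "A holomorphic_on left_half" "\<And>t. t \<in> strip e \<inter> left_half \<Longrightarrow> y t = A t"
    and pos: "\<And>t. t < - apery_L \<Longrightarrow> \<exists>a b. A (of_real t) = of_real a \<and> deriv A (of_real t) = of_real b \<and> a \<ge> 1 \<and> b \<ge> 0"
    and J: "\<And>t. t \<in> left_half \<Longrightarrow> apery_J A t = 0"
  shows False
proof -
  define \<rho> where "\<rho> = sqrt d"
  have \<rho>: "0 < \<rho>" "\<rho> \<le> 1" using d by (auto simp: \<rho>_def)
  define c where "c = - apery_L"
  have c: "apery_point c" by (simp add: c_def apery_point_def)
  note c0 = apery_P_apery_point[OF c]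
  have op: "open left_half" unfolding left_half_def by (rule open_halfspace_Re_lt)
  have Gh: "G holomorphic_on ball 0 \<rho>" using G(1) by (auto simp: uniformizes_def \<rho>_def)
  have inu: "of_real c + w^2 \<in> left_half" if "w \<in> cone_up \<rho>" for w
    using square_cone_up[of w d c] that by (auto simp: \<rho>_def left_disc_def left_half_def c_def)
  have sec: "G holomorphic_on sector u v \<rho>" for u v
    by (rule holomorphic_on_subset[OF Gh]) (auto simp: sector_def)
  have GA: "G w = A (of_real c + w^2)" if "w \<in> cone_up \<rho>" for w
  proof (rule convex_overlap_unique[OF sec holomorphic_square_shift[OF A(1) inu] open_sector
        open_sector convex_sector sector_overlap(1)[OF \<rho>(1)] _ that])
    fix w assume "w \<in> quarter1 \<rho> \<inter> cone_up \<rho>"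
    thus "G w = A (of_real c + w^2)"
      using G(1) A(2)[of "of_real c + w^2"] inu[of w] square_quarter13[of w d e c] d
      by (auto simp: uniformizes_def \<rho>_def c_def)
  qed auto
  have inu': "\<i> * of_real s \<in> cone_up \<rho>" if "0 < s" "s < \<rho>" for s
    using that by (simp add: in_sector norm_mult)
  have evs: "eventually (\<lambda>s. 0 < s \<and> s < \<rho>) (at_right 0)"
    using \<rho> by (auto simp: eventually_at_right_field)
  have G1: "deriv G 0 = 0"
    using even_function_deriv[OF Gh \<rho>(1), of 1] G(2) by (auto simp: \<rho>_def)
  have tc: "of_real c + (\<i> * of_real s)^2 = complex_of_real (c - s^2)" for s
    by (simp add: power_mult_distrib)
  \<comment> \<open>The point \<open>w = \<i> * s\<close> lies over the real point
    \<open>c - s^2\<close> to the left of \<open>c\<close>. The quotient is the derivative of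
    \<open>A\<close> there and tends to half the second derivative of \<open>G\<close> at 0.\<close>
  have ab: "\<exists>a b. G (\<i> * of_real s) = of_real a \<and> deriv G (\<i> * of_real s) / (2 * (\<i> * of_real s)) = of_real b \<and> a \<ge> 1 \<and> b \<ge> 0"
    if s: "0 < s" "s < \<rho>" for s
  proof -
    obtain a b where *: "A (of_real (c - s^2)) = of_real a" "deriv A (of_real (c - s^2)) = of_real b" "a \<ge> 1" "b \<ge> 0"
      using pos[of "c - s^2"] s by (auto simp: c_def)
    have "deriv G (\<i> * of_real s) = 2 * (\<i> * of_real s) * of_real b"
      using derivs_square_substitution(1)[OF A(1) op open_sector inu GA inu'[OF s]] *(2) tc[of s] by simp
    thus ?thesis using *(1,3,4) GA[OF inu'[OF s]] tc[of s] s by (intro exI[of _ a] exI[of _ b]) auto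
  qed
  have lim0: "((\<lambda>s. G (\<i> * of_real s)) \<longlongrightarrow> G 0) (at_right 0)"
    using holomorphic_tendsto_0[OF Gh \<rho>(1), of 0] by simp
  have lim1: "((\<lambda>s. deriv G (\<i> * of_real s) / (2 * (\<i> * of_real s))) \<longlongrightarrow> (deriv ^^ 2) G 0 / 2) (at_right 0)"
  proof -
    have "(deriv G has_field_derivative (deriv ^^ 2) G 0) (at 0)"
      using has_field_derivative_derivs(2)[OF Gh open_ball, of 0] \<rho> by simp
    hence *: "((\<lambda>h. deriv G h / h) \<longlongrightarrow> (deriv ^^ 2) G 0) (at 0)"
      unfolding DERIV_def by (simp add: G1)
    have "filterlim (\<lambda>s. \<i> * complex_of_real s) (at 0) (at_right 0)"
      unfolding filterlim_at by (auto intro!: tendsto_eq_intros simp: eventually_at_filter)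
    from tendsto_divide[OF filterlim_compose[OF * this] tendsto_const[of 2]]
    show ?thesis by (simp add: mult.commute)
  qed
  have "eventually (\<lambda>s. Im (G (\<i> * of_real s)) = 0 \<and> Re (G (\<i> * of_real s)) \<ge> 1) (at_right 0)"
    using evs by eventually_elim (use ab in force)
  hence e: "eventually (\<lambda>s. Im (G (\<i> * of_real s)) = 0) (at_right 0)"
    "eventually (\<lambda>s. 1 \<le> Re (G (\<i> * of_real s))) (at_right 0)"
    by (simp_all only: eventually_conj_iff)
  have a: "Im (G 0) = 0" "Re (G 0) \<ge> 1"
    using tendsto_unique[OF _ tendsto_Im[OF lim0] tendsto_eventually[OF e(1)]]
      tendsto_lowerbound[OF tendsto_Re[OF lim0] e(2)] by simp_all
  have "eventually (\<lambda>s. Im (deriv G (\<i> * of_real s) / (2 * (\<i> * of_real s))) = 0 \<and>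
      Re (deriv G (\<i> * of_real s) / (2 * (\<i> * of_real s))) \<ge> 0) (at_right 0)"
    using evs
  proof eventually_elim
    case (elim s)
    then obtain b where "deriv G (\<i> * of_real s) / (2 * (\<i> * of_real s)) = of_real b" "b \<ge> 0" using ab by blast
    thus ?case by (simp only: Im_complex_of_real Re_complex_of_real)
  qed
  hence e': "eventually (\<lambda>s. Im (deriv G (\<i> * of_real s) / (2 * (\<i> * of_real s))) = 0) (at_right 0)"
    "eventually (\<lambda>s. 0 \<le> Re (deriv G (\<i> * of_real s) / (2 * (\<i> * of_real s)))) (at_right 0)"
    by (simp_all only: eventually_conj_iff)
  have b: "Im ((deriv ^^ 2) G 0 / 2) = 0" "Re ((deriv ^^ 2) G 0 / 2) \<ge> 0"
    using tendsto_unique[OF _ tendsto_Im[OF lim1] tendsto_eventually[OF e'(1)]]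
      tendsto_lowerbound[OF tendsto_Re[OF lim1] e'(2)] by simp_all
  define x where "x = exp c"
  have x: "0 < x" "x < 1" using apery_L_gt_1 by (auto simp: x_def c_def)
  define F where "F = (\<lambda>w. apery_P1 (of_real c) (of_real c + w^2) * (G w * (deriv ^^ 2) G w / 4 - (deriv G w)^2 / 8)
     + w / 4 * apery_P1' (of_real c) (of_real c + w^2) * G w * deriv G w
     + (exp (of_real c + w^2) ^ 2 - 10 * exp (of_real c + w^2)) / 2 * (G w)^2)"
  have F0: "F (\<i> * of_real s) = 0" if s: "0 < s" "s < \<rho>" for s
    using apery_J_local[OF c0 A(1) op open_sector inu GA inu'[OF s]] J[OF inu[OF inu'[OF s]]] s
    by (simp add: F_def)
  have Fh: "F holomorphic_on ball 0 \<rho>"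
  proof -
    have 1: "(\<lambda>w. apery_P1 (of_real c) (of_real c + w^2)) holomorphic_on ball 0 \<rho>"
      "(\<lambda>w. apery_P1' (of_real c) (of_real c + w^2)) holomorphic_on ball 0 \<rho>"
      by (rule holomorphic_square_shift[OF holomorphic_apery_P1[OF c0, of UNIV]], simp,
          rule holomorphic_square_shift[OF holomorphic_apery_P1'[OF c0, of UNIV]], simp)
    have 2: "(deriv ^^ 2) G holomorphic_on ball 0 \<rho>" "deriv G holomorphic_on ball 0 \<rho>"
      by (intro holomorphic_higher_deriv holomorphic_deriv Gh open_ball)+
    show ?thesis unfolding F_def by (intro 1 2 Gh holomorphic_intros) auto
  qed
  have "((\<lambda>s. F (\<i> * of_real s)) \<longlongrightarrow> F 0) (at_right 0)"
    using holomorphic_tendsto_0[OF Fh \<rho>(1), of 0] by simp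
  moreover have "eventually (\<lambda>s. F (\<i> * of_real s) = 0) (at_right 0)"
    using evs by eventually_elim (use F0 in auto)
  ultimately have "F 0 = 0"
    using tendsto_unique[OF _ _ tendsto_eventually, of "at_right 0" "\<lambda>s. F (\<i> * of_real s)"] by auto
  moreover have "F 0 = of_real (2 * x * (x - 17)) * (G 0 * (deriv ^^ 2) G 0 / 4) + of_real (x^2 - 10 * x) / 2 * (G 0)^2"
    by (simp add: F_def G1 apery_P1_apery_point x_def exp_of_real)
  moreover obtain a where a': "G 0 = of_real a" "a \<ge> 1" using a by (metis complex_is_Real_iff Re_complex_of_real of_real_Re)
  moreover obtain b where b': "(deriv ^^ 2) G 0 = of_real (2 * b)" "b \<ge> 0"
  proof -
    have "(deriv ^^ 2) G 0 / 2 = of_real (Re ((deriv ^^ 2) G 0 / 2))" using b(1) by (simp add: complex_eq_iff)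
    hence "(deriv ^^ 2) G 0 = of_real (2 * Re ((deriv ^^ 2) G 0 / 2))" by simp
    thus ?thesis using b(2) that by blast
  qed
  ultimately have "complex_of_real (2 * x * (x - 17) * (a * (2 * b) / 4) + (x^2 - 10 * x) / 2 * a^2) = 0"
    by simp
  hence "2 * x * (x - 17) * (a * (2 * b) / 4) + (x^2 - 10 * x) / 2 * a^2 = 0"
    by (simp only: of_real_eq_0_iff)
  moreover have "2 * x * (x - 17) * (a * (2 * b) / 4) \<le> 0"
    using x a' b' by (intro mult_nonpos_nonneg mult_nonneg_nonpos) auto
  moreover have "(x^2 - 10 * x) / 2 * a^2 < 0"
  proof -
    have "x^2 - 10 * x = x * (x - 10)" by (simp add: power2_eq_square algebra_simps)
    also have "\<dots> < 0" using x by (intro mult_pos_neg) auto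
    finally show ?thesis using a' by (intro mult_neg_pos) auto
  qed
  ultimately show False by linarith
qed

lemma apery_sol_turn:
  assumes c: "apery_point c" and d: "0 < d" "d \<le> 1" "d \<le> e" and e: "e \<le> 3"
    and y: "apery_sol y (strip e)" and turn: "turn e d c y z"
  shows "apery_sol z (strip e)"
proof -
  have "apery_coeff j holomorphic_on (strip e \<union> (ball (of_real c) d - {of_real c}))" for j
    using d e apery_P_nonzero_strip apery_P_nonzero_ball[OF c] by (intro holomorphic_apery_coeff) auto
  then obtain g where g: "turn e d c y g" "apery_sol g (strip e)"
    using turn_exists[OF y d(1,3)] by blast
  have "g t = z t" if "t \<in> strip e" for t
    using turn_unique[OF g(1) turn d(1,3) _ that] by blast
  thus ?thesis using lsol_cong[OF g(2) open_strip] by blast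
qed

lemma apery_turns_do_not_commute:
  assumes d: "0 < d" "d \<le> 1" "d \<le> e" and e: "e \<le> 3" and y: "apery_sol y (strip e)"
    and turns: "turn e d (- apery_L) y y1" "turn e d apery_L y y2" "turn e d apery_L y1 y12"
      "turn e d (- apery_L) y2 y12"
    and A: "A holomorphic_on left_half" "\<And>t. t \<in> strip e \<inter> left_half \<Longrightarrow> y t = A t"
    and pos: "\<And>t. t < - apery_L \<Longrightarrow> \<exists>a b. A (of_real t) = of_real a \<and> deriv A (of_real t) = of_real b \<and> a \<ge> 1 \<and> b \<ge> 0"
    and J: "\<And>t. t \<in> left_half \<Longrightarrow> apery_J A t = 0"
  shows False
proof -
  have pts: "apery_point (- apery_L)" "apery_point apery_L" by (auto simp: apery_point_def)
  have sols: "apery_sol y1 (strip e)" "apery_sol y2 (strip e)" "apery_sol y12 (strip e)"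
    using apery_sol_turn[OF pts(1) d e y turns(1)] apery_sol_turn[OF pts(2) d e y turns(2)]
      apery_sol_turn[OF pts(2) d e _ turns(3)] by blast+
  define \<rho> where "\<rho> = sqrt d"
  have \<rho>: "\<rho> > 0" using d by (simp add: \<rho>_def)
  obtain G where G: "uniformizes d (- apery_L) y G" using apery_uniformizes_exists[OF pts(1) d y] by blast
  obtain G2 where G2: "uniformizes d (- apery_L) y2 G2" using apery_uniformizes_exists[OF pts(1) d sols(2)] by blast
  obtain K where K: "uniformizes d apery_L y K" using apery_uniformizes_exists[OF pts(2) d y] by blast
  obtain K1 where K1: "uniformizes d apery_L y1 K1" using apery_uniformizes_exists[OF pts(2) d sols(1)] by blast
  note G' = uniformizes_turn[OF G d(1,3) turns(1)] and G2' = uniformizes_turn[OF G2 d(1,3) turns(4)]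
  note K' = uniformizes_turn[OF K d(1,3) turns(2)] and K1' = uniformizes_turn[OF K1 d(1,3) turns(3)]
  define f where "f = (\<lambda>t. y t - y1 t)"
  define f2 where "f2 = (\<lambda>t. y2 t - y12 t)"
  \<comment> \<open>This is \<open>(1 - m1) (1 - m2) y\<close>. Its coordinate at \<open>-L\<close>
    is \<open>G w - G (- w)\<close> minus the same expression in \<open>G2\<close>; at
    \<open>L\<close> it is \<open>K w - K1 w\<close> minus its reflection. Both are visibly odd, and
    both describe \<open>u\<close> only because the two orders of turning end in the same
    \<open>y12\<close>.\<close>
  define u where "u = (\<lambda>t. f t - f2 t)"
  have fs: "apery_sol f (strip e)" "apery_sol f2 (strip e)" "apery_sol u (strip e)"
    unfolding f_def f2_def u_def by (intro lsol_diff y sols open_strip)+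
  note fG = uniformizes_diff[OF G G', folded f_def] and f2G = uniformizes_diff[OF G2 G2', folded f2_def]
  note uG = uniformizes_diff[OF fG f2G, folded u_def]
  note fK = uniformizes_diff[OF K K1, folded f_def] and f2K = uniformizes_diff[OF K' K1', folded f2_def]
  note uK = uniformizes_diff[OF fK f2K, folded u_def]
  have u0: "u t = 0" if "t \<in> strip e" for t
    by (rule apery_odd_eq_0[OF d e fs(3) uG _ uK _ that]) auto
  have f0: "f t = 0" if "t \<in> strip e" for t
  proof (rule apery_odd_eq_0[OF d e fs(1) fG _ fK _ that])
    \<comment> \<open>\<open>f2\<close> is the continuation of \<open>f\<close> around
      \<open>L\<close>, so \<open>u = 0\<close> says that \<open>f\<close> is invariant there, and
      its coordinate is even.\<close>
    have KK: "K w - K1 w = K (- w) - K1 (- w)" if "w \<in> ball 0 (sqrt d)" for w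
      using uniformizes_unique[OF fK f2K d(1,3) _ that] u0 by (simp add: u_def)
    show "(\<forall>w\<in>ball 0 (sqrt d). K (- w) - K1 (- w) = - (K w - K1 w)) \<or>
       (\<forall>w\<in>ball 0 (sqrt d). K (- w) - K1 (- w) = K w - K1 w)"
      by (intro disjI2 ballI KK[symmetric])
  qed auto
  have "G (- w) = G w" if "w \<in> ball 0 (sqrt d)" for w
    using uniformizes_unique[OF G G' d(1,3) _ that] f0 unfolding f_def by (metis right_minus_eq)
  thus False using apery_even_contradiction[OF d G _ A pos J] by blast
qed

section \<open>The Apery numbers\<close>

definition apery_summand :: "nat \<Rightarrow> nat \<Rightarrow> real"
  where "apery_summand n k = of_nat ((n choose k) * ((n + k) choose n))"

definition apery_number :: "nat \<Rightarrow> real"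
  where "apery_number n = (\<Sum>k\<le>n. (apery_summand n k)\<^sup>2)"

lemma apery_fps_nth: "fps_nth apery_fps n = of_real (apery_number n)"
  by (simp add: apery_fps_def apery_number_def apery_summand_def power_mult_distrib)

lemma apery_summand_eq_0: "k > n \<Longrightarrow> apery_summand n k = 0"
  by (simp add: apery_summand_def binomial_eq_0)

lemma apery_summand_fact:
  assumes "k \<le> n"
  shows "apery_summand n k = fact (n + k) / ((fact k)\<^sup>2 * fact (n - k))"
proof -
  have 1: "of_nat (n choose k) = (fact n / (fact k * fact (n - k)) :: real)"
    using assms by (rule binomial_fact)
  have 2: "of_nat ((n + k) choose n) = (fact (n + k) / (fact n * fact k) :: real)"
    by (subst binomial_fact) auto
  show ?thesis by (simp add: apery_summand_def 1 2 power2_eq_square)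
qed

text \<open>All terms of Zeilberger's recurrence are polynomial multiples of the following one, even
  at the boundary of the range of summation.\<close>

definition apery_common :: "nat \<Rightarrow> nat \<Rightarrow> real"
  where "apery_common n k = fact (n + k) / ((fact k)\<^sup>2 * fact (n + 2 - k))"

lemma apery_summand_common:
  assumes "k \<le> n + 2"
  defines "t \<equiv> apery_common n k" and "m \<equiv> real n + 1" and "j \<equiv> real k"
  shows "apery_summand (n + 2) k = t * ((m + j) * (m + j + 1))"
    "apery_summand (n + 1) k = t * ((m + j) * (m + 1 - j))"
    "apery_summand n k = t * ((m + 1 - j) * (m - j))"
    "k > 0 \<Longrightarrow> apery_summand (n + 1) (k - 1) = t * j\<^sup>2"
proof -
  show "apery_summand (n + 2) k = t * ((m + j) * (m + j + 1))"
    using assms(1) by (simp add: apery_summand_fact t_def apery_common_def m_def j_def algebra_simps add_divide_distrib)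
  show "apery_summand (n + 1) k = t * ((m + j) * (m + 1 - j))"
  proof (cases "k = n + 2")
    case True
    thus ?thesis by (simp add: apery_summand_eq_0 m_def j_def)
  next
    case False
    then obtain l where l: "n + 1 = k + l" using assms(1) by (metis add.commute le_Suc_eq less_eqE Suc_eq_plus1 add_2_eq_Suc')
    have "n + 2 - k = Suc l" "n + 1 - k = l" using l by auto
    hence e: "apery_summand (n + 1) k = fact (n + 1 + k) / ((fact k)\<^sup>2 * fact l)"
      "t = fact (n + k) / ((fact k)\<^sup>2 * fact (Suc l))"
      using l by (simp_all add: apery_summand_fact t_def apery_common_def)
    have f: "fact (n + 1 + k) = (m + j) * fact (n + k)" by (simp add: m_def j_def algebra_simps)
    have "m + 1 - j = real (Suc l)" using l by (simp add: m_def j_def)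
    thus ?thesis unfolding e f by (simp del: of_nat_Suc) (simp add: field_simps)?
  qed
  show "apery_summand n k = t * ((m + 1 - j) * (m - j))"
  proof (cases "k \<le> n")
    case False
    hence "k = n + 1 \<or> k = n + 2" using assms(1) by auto
    thus ?thesis by (auto simp: apery_summand_eq_0 m_def j_def)
  next
    case True
    then obtain l where l: "n = k + l" by (metis le_Suc_ex)
    have "n + 2 - k = Suc (Suc l)" "n - k = l" using l by auto
    hence e: "apery_summand n k = fact (n + k) / ((fact k)\<^sup>2 * fact l)"
      "t = fact (n + k) / ((fact k)\<^sup>2 * (real (Suc (Suc l)) * (real (Suc l) * fact l)))"
      using True by (simp_all add: apery_summand_fact t_def apery_common_def)
    have mj: "m + 1 - j = real (Suc (Suc l))" "m - j = real (Suc l)" using l by (auto simp: m_def j_def)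
    show ?thesis unfolding e mj by (simp del: of_nat_Suc)
  qed
  show "apery_summand (n + 1) (k - 1) = t * j\<^sup>2" if "k > 0"
  proof -
    obtain i where i: "k = Suc i" using \<open>k > 0\<close> gr0_implies_Suc by blast
    hence eqs: "n + 1 - i = n + 2 - k" "n + 1 + i = n + k" "k - 1 = i" by auto
    have "i \<le> n + 1" using i assms(1) by simp
    hence e: "apery_summand (n + 1) (k - 1) = fact (n + k) / ((fact i)\<^sup>2 * fact (n + 2 - k))"
      unfolding eqs(3) by (simp only: apery_summand_fact eqs)
    have "fact k = j * fact i" by (simp add: i j_def)
    hence t: "t = fact (n + k) / ((j * fact i)\<^sup>2 * fact (n + 2 - k))"
      by (simp only: t_def apery_common_def)
    have "j \<noteq> 0" using \<open>k > 0\<close> by (simp add: j_def)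
    thus ?thesis unfolding e t by (simp add: power_mult_distrib)
  qed
qed

text \<open>The classical creative telescoping certificate for the Apery numbers: a polynomial
  multiple of the squared summand whose difference in \<open>k\<close> is the recurrence operator
  applied to that square.\<close>

definition apery_certificate :: "nat \<Rightarrow> nat \<Rightarrow> real"
  where "apery_certificate n k = 4 * (2 * real n + 1) * (real k * (2 * real k + 1) - (2 * real n + 1)\<^sup>2) * (apery_summand n k)\<^sup>2"

lemma apery_polynomial_identity:
  fixes m j :: real
  shows "(m + 1) ^ 3 * ((m + j) * (m + j + 1))\<^sup>2
     - (34 * m ^ 3 + 51 * m\<^sup>2 + 27 * m + 5) * ((m + j) * (m + 1 - j))\<^sup>2
     + m ^ 3 * ((m + 1 - j) * (m - j))\<^sup>2
     = 4 * (2 * m + 1) * (j * (2 * j + 1) - (2 * m + 1)\<^sup>2) * ((m + j) * (m + 1 - j))\<^sup>2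
       - 4 * (2 * m + 1) * ((j - 1) * (2 * (j - 1) + 1) - (2 * m + 1)\<^sup>2) * (j\<^sup>2)\<^sup>2"
  by (simp add: power2_eq_square power3_eq_cube) (simp add: algebra_simps)

text \<open>After division by the square of \<open>apery_common n k\<close> a polynomial identity in
  \<open>m = n + 1\<close> and \<open>j = k\<close> remains. The case \<open>k = 0\<close> fits in
  because the subtracted certificate then carries the factor \<open>j^4 = 0\<close>.\<close>

lemma apery_zeilberger:
  assumes "k \<le> n + 2"
  shows "real (n + 2) ^ 3 * (apery_summand (n + 2) k)\<^sup>2
     - (34 * real (n + 1) ^ 3 + 51 * (real (n + 1))\<^sup>2 + 27 * real (n + 1) + 5) * (apery_summand (n + 1) k)\<^sup>2
     + real (n + 1) ^ 3 * (apery_summand n k)\<^sup>2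
     = apery_certificate (n + 1) k - (if k = 0 then 0 else apery_certificate (n + 1) (k - 1))"
proof -
  define t where "t = apery_common n k"
  define m where "m = real n + 1"
  define j where "j = real k"
  have m: "real (n + 2) = m + 1" "real (n + 1) = m" by (simp_all add: m_def)
  note s = apery_summand_common[OF assms, folded t_def m_def j_def]
  have last: "(if k = 0 then 0 else apery_certificate (n + 1) (k - 1))
     = t\<^sup>2 * (4 * (2 * m + 1) * ((j - 1) * (2 * (j - 1) + 1) - (2 * m + 1)\<^sup>2) * (j\<^sup>2)\<^sup>2)"
  proof (cases "k = 0")
    case False
    hence "real (k - 1) = j - 1" by (simp add: j_def of_nat_diff)
    hence "apery_certificate (n + 1) (k - 1)
      = 4 * (2 * m + 1) * ((j - 1) * (2 * (j - 1) + 1) - (2 * m + 1)\<^sup>2) * (t * j\<^sup>2)\<^sup>2"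
      using s(4) False unfolding apery_certificate_def m by simp
    thus ?thesis using False by (simp add: power_mult_distrib)
  qed (simp add: j_def)
  have cert: "apery_certificate (n + 1) k
     = t\<^sup>2 * (4 * (2 * m + 1) * (j * (2 * j + 1) - (2 * m + 1)\<^sup>2) * ((m + j) * (m + 1 - j))\<^sup>2)"
    unfolding apery_certificate_def m s(2) j_def[symmetric] by (simp add: power_mult_distrib)
  have "(m + 1) ^ 3 * (t * ((m + j) * (m + j + 1)))\<^sup>2
     - (34 * m ^ 3 + 51 * m\<^sup>2 + 27 * m + 5) * (t * ((m + j) * (m + 1 - j)))\<^sup>2
     + m ^ 3 * (t * ((m + 1 - j) * (m - j)))\<^sup>2
    = t\<^sup>2 * ((m + 1) ^ 3 * ((m + j) * (m + j + 1))\<^sup>2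
     - (34 * m ^ 3 + 51 * m\<^sup>2 + 27 * m + 5) * ((m + j) * (m + 1 - j))\<^sup>2
     + m ^ 3 * ((m + 1 - j) * (m - j))\<^sup>2)"
    by (simp only: power_mult_distrib) (simp only: algebra_simps)
  also have "\<dots> = apery_certificate (n + 1) k - (if k = 0 then 0 else apery_certificate (n + 1) (k - 1))"
    unfolding apery_polynomial_identity last cert by (simp only: right_diff_distrib)
  finally show ?thesis unfolding m s(1-3) .
qed

lemma apery_number_eq: "N \<ge> n \<Longrightarrow> apery_number n = (\<Sum>k\<le>N. (apery_summand n k)\<^sup>2)"
  unfolding apery_number_def by (intro sum.mono_neutral_left) (auto simp: apery_summand_eq_0)

lemma apery_recurrence:
  "real (n + 2) ^ 3 * apery_number (n + 2)
     - (34 * real (n + 1) ^ 3 + 51 * (real (n + 1))\<^sup>2 + 27 * real (n + 1) + 5) * apery_number (n + 1)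
     + real (n + 1) ^ 3 * apery_number n = 0"
proof -
  have tele: "(\<Sum>k\<le>N. apery_certificate (n + 1) k - (if k = 0 then 0 else apery_certificate (n + 1) (k - 1)))
     = apery_certificate (n + 1) N" for N
    by (induction N) auto
  have "real (n + 2) ^ 3 * apery_number (n + 2)
     - (34 * real (n + 1) ^ 3 + 51 * (real (n + 1))\<^sup>2 + 27 * real (n + 1) + 5) * apery_number (n + 1)
     + real (n + 1) ^ 3 * apery_number n
    = (\<Sum>k\<le>n+2. real (n + 2) ^ 3 * (apery_summand (n + 2) k)\<^sup>2
     - (34 * real (n + 1) ^ 3 + 51 * (real (n + 1))\<^sup>2 + 27 * real (n + 1) + 5) * (apery_summand (n + 1) k)\<^sup>2
     + real (n + 1) ^ 3 * (apery_summand n k)\<^sup>2)"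
    by (simp only: sum.distrib sum_subtractf apery_number_eq[of "n + 2" "n + 2"]
      apery_number_eq[of "n + 1" "n + 2"] apery_number_eq[of n "n + 2"] sum_distrib_left)
  also have "\<dots> = (\<Sum>k\<le>n+2. apery_certificate (n + 1) k - (if k = 0 then 0 else apery_certificate (n + 1) (k - 1)))"
    by (intro sum.cong HOL.refl apery_zeilberger) auto
  also have "\<dots> = 0"
    unfolding tele by (simp add: apery_certificate_def apery_summand_eq_0)
  finally show ?thesis .
qed

lemma apery_number_0_1: "apery_number 0 = 1" "apery_number 1 = 5"
  by (simp_all add: apery_number_def apery_summand_def)

lemma apery_number_nonneg: "apery_number n \<ge> 0"
  by (simp add: apery_number_def sum_nonneg)

text \<open>The summand equals \<open>((n + k) choose (2 * k)) * ((2 * k) choose k)\<close>, with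
  second factor at most \<open>4 ^ k\<close>. For \<open>l = 1 + sqrt 2\<close> one has
  \<open>2 / l + 1 / l^2 = 1\<close>, so each term of the binomial expansion of
  \<open>(2 / l + 1 / l^2) ^ (n + k)\<close> is at most 1; the term of index \<open>2 * k\<close>
  gives the bound.\<close>

lemma apery_summand_le: "apery_summand n k \<le> (1 + sqrt 2) ^ (2 * n)"
proof (cases "k \<le> n")
  case False
  thus ?thesis by (simp add: apery_summand_eq_0)
next
  case True
  define l :: real where "l = 1 + sqrt 2"
  have l: "l > 0" by (simp add: l_def add_pos_pos)
  have l2: "l\<^sup>2 = 2 * l + 1" by (simp add: l_def power2_eq_square algebra_simps)
  have one: "2 / l + 1 / l\<^sup>2 = 1"
  proof -
    have "2 / l + 1 / l\<^sup>2 = (2 * l + 1) / l\<^sup>2" using l by (simp add: field_simps power2_eq_square)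
    thus ?thesis using l by (simp add: l2[symmetric])
  qed
  have "real ((n + k) choose (2 * k)) * (2 / l) ^ (2 * k) * (1 / l\<^sup>2) ^ (n - k)
    \<le> (\<Sum>i\<le>n+k. real ((n + k) choose i) * (2 / l) ^ i * (1 / l\<^sup>2) ^ (n + k - i))"
  proof -
    have "n - k = n + k - 2 * k" using True by simp
    thus ?thesis
      using member_le_sum[of "2 * k" "{..n+k}" "\<lambda>i. real ((n + k) choose i) * (2 / l) ^ i * (1 / l\<^sup>2) ^ (n + k - i)"]
        True l by simp
  qed
  also have "\<dots> = (2 / l + 1 / l\<^sup>2) ^ (n + k)" by (rule binomial_ring[symmetric])
  also have "\<dots> = 1" by (simp only: one power_one)
  finally have 1: "real ((n + k) choose (2 * k)) * 2 ^ (2 * k) \<le> l ^ (2 * n)"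
  proof -
    assume *: "real ((n + k) choose (2 * k)) * (2 / l) ^ (2 * k) * (1 / l\<^sup>2) ^ (n - k) \<le> 1"
    have "l ^ (2 * n) = l ^ (2 * k) * (l\<^sup>2) ^ (n - k)"
    proof -
      have "2 * n = 2 * k + 2 * (n - k)" using True by simp
      thus ?thesis by (metis power_add power_mult)
    qed
    hence "real ((n + k) choose (2 * k)) * 2 ^ (2 * k)
      = l ^ (2 * n) * (real ((n + k) choose (2 * k)) * (2 / l) ^ (2 * k) * (1 / l\<^sup>2) ^ (n - k))"
      using l by (simp add: power_divide)
    also have "\<dots> \<le> l ^ (2 * n) * 1" using * l by (intro mult_left_mono) auto
    finally show ?thesis by simp
  qed
  have "apery_summand n k = real ((n + k) choose (2 * k)) * real ((2 * k) choose k)"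
    unfolding apery_summand_fact[OF True]
    using True by (simp add: binomial_fact power2_eq_square)
  also have "\<dots> \<le> real ((n + k) choose (2 * k)) * 2 ^ (2 * k)"
    using of_nat_mono[OF binomial_le_pow2[of "2 * k" k], where 'a = real] by (intro mult_left_mono) auto
  also have "\<dots> \<le> l ^ (2 * n)" by (rule 1)
  finally show ?thesis by (simp add: l_def)
qed

lemma apery_number_le: "apery_number n \<le> (real n + 1) * (17 + 12 * sqrt 2) ^ n"
proof -
  have "(1 + sqrt 2) ^ 4 = 17 + 12 * sqrt (2 :: real)"
    by (simp add: eval_nat_numeral algebra_simps)
  hence pow: "((1 + sqrt 2) ^ (2 * n))\<^sup>2 = (17 + 12 * sqrt 2 :: real) ^ n"
  proof -
    have "((1 + sqrt 2) ^ (2 * n))\<^sup>2 = ((1 + sqrt 2) ^ 4) ^ n" by (simp flip: power_mult)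
    thus ?thesis by (simp only: \<open>(1 + sqrt 2) ^ 4 = _\<close>)
  qed
  have "apery_number n \<le> (\<Sum>k\<le>n. ((1 + sqrt 2) ^ (2 * n))\<^sup>2)"
    unfolding apery_number_def
    by (intro sum_mono power_mono apery_summand_le) (simp add: apery_summand_def)
  also have "\<dots> = (real n + 1) * (17 + 12 * sqrt 2) ^ n" unfolding pow by simp
  finally show ?thesis .
qed

section \<open>Euler operators on power series\<close>

definition fps_theta :: "complex fps \<Rightarrow> complex fps"
  where "fps_theta F = fps_X * fps_deriv F"

lemma fps_theta_nth [simp]: "fps_nth (fps_theta F) n = of_nat n * fps_nth F n"
  by (cases n) (auto simp: fps_theta_def)

lemma fps_theta_power_nth: "fps_nth ((fps_theta ^^ j) F) n = of_nat n ^ j * fps_nth F n"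
  by (induction j) (auto simp: mult.assoc)

lemma fps_conv_radius_theta: "fps_conv_radius ((fps_theta ^^ j) F) \<ge> fps_conv_radius F"
proof (induction j)
  case (Suc j)
  have "fps_conv_radius (fps_theta G) \<ge> fps_conv_radius G" for G
    unfolding fps_theta_def
    using fps_conv_radius_mult[of fps_X "fps_deriv G"] fps_conv_radius_deriv[of G] by (simp add: min_def)
  with Suc show ?case using order.trans by fastforce
qed simp

lemma eval_fps_theta:
  assumes "norm z < fps_conv_radius F"
  shows "eval_fps (fps_theta F) z = z * eval_fps (fps_deriv F) z"
proof -
  have "norm z < fps_conv_radius (fps_deriv F)"
    using assms fps_conv_radius_deriv[of F] by (rule order.strict_trans2)
  thus ?thesis
    unfolding fps_theta_def by (simp add: eval_fps_mult)
qed

text \<open>Comparison of coefficients: from index 2 on it is the recurrence, at index 1 it needs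
  the initial values 1 and 5, and at index 0 nothing remains.\<close>

lemma apery_fps_ode:
  defines "\<theta> \<equiv> \<lambda>j. (fps_theta ^^ j) apery_fps"
  shows "\<theta> 3 - fps_X * (34 * \<theta> 3 + 51 * \<theta> 2 + 27 * \<theta> 1 + 5 * \<theta> 0)
     + fps_X ^ 2 * (\<theta> 3 + 3 * \<theta> 2 + 3 * \<theta> 1 + \<theta> 0) = 0"
proof (rule fps_ext)
  fix n
  have th: "fps_nth (\<theta> j) n = of_nat n ^ j * of_real (apery_number n)" for j n
    by (simp add: \<theta>_def fps_theta_power_nth apery_fps_nth)
  have num: "fps_nth (numeral k * F) n = numeral k * fps_nth F n" for k and F :: "complex fps" and n
    by (simp add: numeral_fps_const)
  have X2: "fps_X ^ 2 * F = fps_X * (fps_X * F)" for F :: "complex fps"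
    by (simp add: power2_eq_square mult.assoc)
  show "fps_nth (\<theta> 3 - fps_X * (34 * \<theta> 3 + 51 * \<theta> 2 + 27 * \<theta> 1 + 5 * \<theta> 0)
     + fps_X ^ 2 * (\<theta> 3 + 3 * \<theta> 2 + 3 * \<theta> 1 + \<theta> 0)) n = fps_nth 0 n"
  proof (cases n rule: nat.exhaust[case_names zero Suc])
    case zero
    thus ?thesis by (simp add: th X2)
  next
    case (Suc m)
    show ?thesis
    proof (cases m)
      case 0
      thus ?thesis using Suc apery_number_0_1 by (simp add: th num X2)
    next
      case m: (Suc k)
      have n: "n = k + 2" using Suc m by simp
      have "fps_nth (\<theta> 3 - fps_X * (34 * \<theta> 3 + 51 * \<theta> 2 + 27 * \<theta> 1 + 5 * \<theta> 0)
         + fps_X ^ 2 * (\<theta> 3 + 3 * \<theta> 2 + 3 * \<theta> 1 + \<theta> 0)) n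
        = of_nat (k + 2) ^ 3 * of_real (apery_number (k + 2))
          - (34 * of_nat (k + 1) ^ 3 + 51 * of_nat (k + 1) ^ 2 + 27 * of_nat (k + 1) + 5) * of_real (apery_number (k + 1))
          + (of_nat k ^ 3 + 3 * of_nat k ^ 2 + 3 * of_nat k + 1) * of_real (apery_number k)"
        unfolding n by (simp only: fps_add_nth fps_sub_nth X2 num th fps_X_mult_nth)
          (simp add: algebra_simps)
      also have "of_nat k ^ 3 + 3 * of_nat k ^ 2 + 3 * of_nat k + 1 = (of_nat (k + 1) ^ 3 :: complex)"
        by (simp add: power2_eq_square power3_eq_cube algebra_simps)
      also have "of_nat (k + 2) ^ 3 * of_real (apery_number (k + 2))
          - (34 * of_nat (k + 1) ^ 3 + 51 * of_nat (k + 1) ^ 2 + 27 * of_nat (k + 1) + 5) * of_real (apery_number (k + 1))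
          + of_nat (k + 1) ^ 3 * of_real (apery_number k)
        = complex_of_real (real (k + 2) ^ 3 * apery_number (k + 2)
          - (34 * real (k + 1) ^ 3 + 51 * (real (k + 1))\<^sup>2 + 27 * real (k + 1) + 5) * apery_number (k + 1)
          + real (k + 1) ^ 3 * apery_number k)"
        by simp
      also have "\<dots> = fps_nth 0 n" by (simp only: apery_recurrence of_real_0 fps_zero_nth)
      finally show ?thesis .
    qed
  qed
qed

subsection \<open>The generating function of the Apery numbers\<close>

text \<open>Comparison with the series of \<open>(n + 1) * q ^ n\<close>. The value
  \<open>exp (- L)\<close> matters, not just positivity: \<open>\<alpha>\<close> has to be followed
  from the origin right up to the singular point \<open>-L\<close>.\<close>

lemma fps_conv_radius_apery: "fps_conv_radius apery_fps \<ge> exp (- apery_L)"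
  unfolding fps_conv_radius_def
proof (rule conv_radius_geI_ex)
  fix r :: real assume r: "0 < r" "ereal r < ereal (exp (- apery_L))"
  define q where "q = r * exp apery_L"
  have q: "0 < q" "q < 1"
  proof -
    have "r < exp (- apery_L)" using r by simp
    hence "r * exp apery_L < exp (- apery_L) * exp apery_L" by (intro mult_strict_right_mono) auto
    thus "q < 1" by (simp add: q_def flip: exp_add)
    show "0 < q" using r by (simp add: q_def)
  qed
  have "summable (\<lambda>n. (real n + 1) * q ^ n)"
    using geometric_deriv_sums[of q] q by (simp add: sums_iff add.commute)
  hence "summable (\<lambda>n. fps_nth apery_fps n * complex_of_real r ^ n)"
  proof (rule summable_comparison_test')
    fix n :: nat
    have "norm (fps_nth apery_fps n * complex_of_real r ^ n) = apery_number n * r ^ n"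
      using r apery_number_nonneg[of n] by (simp add: apery_fps_nth norm_mult norm_power)
    also have "\<dots> \<le> ((real n + 1) * exp apery_L ^ n) * r ^ n"
      using apery_number_le[of n] r by (intro mult_right_mono) (auto simp: exp_apery_L)
    also have "\<dots> = (real n + 1) * q ^ n" by (simp add: q_def power_mult_distrib)
    finally show "norm (fps_nth apery_fps n * complex_of_real r ^ n) \<le> (real n + 1) * q ^ n" .
  qed
  thus "\<exists>z. norm z = r \<and> summable (\<lambda>n. fps_nth apery_fps n * z ^ n)"
    using r by (intro exI[of _ "complex_of_real r"]) auto
qed

text \<open>In the variable \<open>u = \<gamma> * exp (\<mu> * t)\<close> the derivation
  \<open>d/dt\<close> acts as \<open>\<mu>\<close> times the Euler operator.\<close>

lemma eval_fps_exp_derivs: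
  fixes \<gamma> \<mu> :: complex
  assumes "norm (\<gamma> * exp (\<mu> * t)) < fps_conv_radius F"
  shows "(deriv ^^ j) (\<lambda>t. eval_fps F (\<gamma> * exp (\<mu> * t))) t = \<mu> ^ j * eval_fps ((fps_theta ^^ j) F) (\<gamma> * exp (\<mu> * t))"
  using assms
proof (induction j arbitrary: t)
  case (Suc j)
  define D where "D = (\<lambda>t. \<gamma> * exp (\<mu> * t)) -` eball 0 (fps_conv_radius F)"
  have D: "open D" unfolding D_def
    by (intro continuous_open_vimage continuous_intros open_eball)
  have t: "t \<in> D" using Suc.prems by (simp add: D_def eball_def)
  define G where "G = (fps_theta ^^ j) F"
  have rG: "norm (\<gamma> * exp (\<mu> * t)) < fps_conv_radius G"
    using Suc.prems fps_conv_radius_theta[of F j] unfolding G_def by (rule order.strict_trans2)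
  have "((\<lambda>t. \<gamma> * exp (\<mu> * t)) has_field_derivative \<mu> * (\<gamma> * exp (\<mu> * t))) (at t)"
    by (auto intro!: derivative_eq_intros)
  from DERIV_cmult[OF DERIV_chain2[OF has_field_derivative_eval_fps[OF rG] this], of "\<mu> ^ j"]
  have "((\<lambda>t. \<mu> ^ j * eval_fps G (\<gamma> * exp (\<mu> * t))) has_field_derivative
      \<mu> ^ Suc j * eval_fps (fps_theta G) (\<gamma> * exp (\<mu> * t))) (at t)"
    by (simp add: eval_fps_theta[OF rG] algebra_simps)
  hence "((deriv ^^ j) (\<lambda>t. eval_fps F (\<gamma> * exp (\<mu> * t))) has_field_derivative
      \<mu> ^ Suc j * eval_fps (fps_theta G) (\<gamma> * exp (\<mu> * t))) (at t)"
    by (rule has_field_derivative_transform_within_open[OF _ D t])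
      (simp add: D_def eball_def Suc.IH G_def)
  thus ?case by (simp add: DERIV_imp_deriv G_def)
qed simp

definition apery_fun :: "complex \<Rightarrow> complex"
  where "apery_fun t = eval_fps apery_fps (exp t)"

lemma left_half_radius: "t \<in> left_half \<Longrightarrow> norm (exp t) < fps_conv_radius apery_fps"
  by (rule order.strict_trans2[OF _ fps_conv_radius_apery]) (simp add: left_half_def)

lemma open_left_half: "open left_half" and convex_left_half: "convex left_half"
  unfolding left_half_def by (rule open_halfspace_Re_lt, rule convex_halfspace_Re_lt)

lemma apery_fun_derivs:
  assumes "t \<in> left_half"
  shows "(deriv ^^ j) apery_fun t = eval_fps ((fps_theta ^^ j) apery_fps) (exp t)"
  using eval_fps_exp_derivs[of 1 1 t apery_fps j] left_half_radius[OF assms]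
  by (simp add: apery_fun_def[abs_def])

lemma holomorphic_apery_fun: "apery_fun holomorphic_on left_half"
  unfolding apery_fun_def[abs_def]
  by (rule holomorphic_on_compose_gen[unfolded o_def, OF _ holomorphic_on_eval_fps[OF order.refl]])
    (auto intro!: holomorphic_intros left_half_radius simp: eball_def)

lemma fps_conv_radius_closure:
  fixes z :: complex
  assumes "norm z < fps_conv_radius F" "norm z < fps_conv_radius G"
  shows "norm z < fps_conv_radius (F + G)" "norm z < fps_conv_radius (F - G)" "norm z < fps_conv_radius (F * G)"
  using assms fps_conv_radius_add[of F G] fps_conv_radius_diff[of F G] fps_conv_radius_mult[of F G]
  by (meson less_le_trans min_less_iff_conj)+

lemma apery_sol_apery_fun: "apery_sol apery_fun left_half"
proof (subst apery_sol_iff)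
  fix t assume "t \<in> left_half"
  thus "apery_P t \<noteq> 0" using apery_L_gt_1 by (intro apery_P_nonzero_Re) (auto simp: left_half_def)
next
  show "apery_fun holomorphic_on left_half \<and>
    (\<forall>t\<in>left_half. apery_P t * (deriv ^^ 3) apery_fun t + 3 / 2 * apery_P' t * (deriv ^^ 2) apery_fun t
      + (3 * exp t ^ 2 - 27 * exp t) * deriv apery_fun t + (exp t ^ 2 - 5 * exp t) * apery_fun t = 0)"
  proof (intro conjI ballI holomorphic_apery_fun)
    fix t assume t: "t \<in> left_half"
    define x where "x = exp t"
    define \<theta> where "\<theta> = (\<lambda>j. (fps_theta ^^ j) apery_fps)"
    have r: "norm x < fps_conv_radius (\<theta> j)" for j
      using left_half_radius[OF t] fps_conv_radius_theta[of apery_fps j] unfolding \<theta>_def x_def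
      by (rule order.strict_trans2)
    have num: "norm x < fps_conv_radius (numeral k :: complex fps)" "norm x < fps_conv_radius (fps_X :: complex fps)"
      "norm x < fps_conv_radius (fps_X ^ 2 :: complex fps)" for k
      by simp_all
    note cl = fps_conv_radius_closure[of x] and ev = eval_fps_add[of x] eval_fps_diff[of x] eval_fps_mult[of x]
    have "eval_fps (\<theta> 3 - fps_X * (34 * \<theta> 3 + 51 * \<theta> 2 + 27 * \<theta> 1 + 5 * \<theta> 0)
     + fps_X ^ 2 * (\<theta> 3 + 3 * \<theta> 2 + 3 * \<theta> 1 + \<theta> 0)) x = 0"
      using apery_fps_ode unfolding \<theta>_def by simp
    hence "eval_fps (\<theta> 3) x - x * (34 * eval_fps (\<theta> 3) x + 51 * eval_fps (\<theta> 2) x + 27 * eval_fps (\<theta> 1) x + 5 * eval_fps (\<theta> 0) x)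
     + x ^ 2 * (eval_fps (\<theta> 3) x + 3 * eval_fps (\<theta> 2) x + 3 * eval_fps (\<theta> 1) x + eval_fps (\<theta> 0) x) = 0"
      by (simp add: ev cl r num del: eval_fps_X_power) (simp add: num)?
    moreover have "eval_fps (\<theta> j) x = (deriv ^^ j) apery_fun t" for j
      using apery_fun_derivs[OF t] by (simp add: \<theta>_def x_def)
    moreover have "apery_P t * y3 + 3 / 2 * apery_P' t * y2 + (3 * exp t ^ 2 - 27 * exp t) * y1 + (exp t ^ 2 - 5 * exp t) * y0
      = y3 - x * (34 * y3 + 51 * y2 + 27 * y1 + 5 * y0) + x ^ 2 * (y3 + 3 * y2 + 3 * y1 + y0)" for y0 y1 y2 y3
      by (simp add: apery_P_def apery_P'_def x_def[symmetric] field_simps)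
    ultimately show "apery_P t * (deriv ^^ 3) apery_fun t + 3 / 2 * apery_P' t * (deriv ^^ 2) apery_fun t
      + (3 * exp t ^ 2 - 27 * exp t) * deriv apery_fun t + (exp t ^ 2 - 5 * exp t) * apery_fun t = 0"
      by simp
  qed
qed

lemma eval_fps_nonneg_real:
  fixes F :: "complex fps"
  assumes F: "\<And>n. fps_nth F n = of_real (c n)" "\<And>n. c n \<ge> 0" and x: "x \<ge> 0" "norm (of_real x :: complex) < fps_conv_radius F"
  shows "\<exists>a. eval_fps F (of_real x) = of_real a \<and> a \<ge> c 0"
proof -
  have "(\<lambda>n. fps_nth F n * of_real x ^ n) sums eval_fps F (of_real x)"
    using x by (intro sums_eval_fps) auto
  hence s: "(\<lambda>n. complex_of_real (c n * x ^ n)) sums eval_fps F (of_real x)"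
    by (simp add: F(1))
  hence "summable (\<lambda>n. complex_of_real (c n * x ^ n))" by (simp add: sums_iff)
  hence sm: "summable (\<lambda>n. c n * x ^ n)" by (simp only: summable_complex_of_real)
  hence "eval_fps F (of_real x) = of_real (suminf (\<lambda>n. c n * x ^ n))"
    using s sums_of_real[OF summable_sums[OF sm], where 'a = complex] by (blast intro: sums_unique2)
  moreover have "suminf (\<lambda>n. c n * x ^ n) \<ge> c 0"
    using sum_le_suminf[OF sm, of "{0}"] F(2) x by auto
  ultimately show ?thesis by blast
qed

lemma apery_fun_real:
  assumes "t < - apery_L"
  shows "\<exists>a b. apery_fun (of_real t) = of_real a \<and> deriv apery_fun (of_real t) = of_real b \<and> a \<ge> 1 \<and> b \<ge> 0"
proof -
  have t: "of_real t \<in> left_half" using assms by (simp add: left_half_def)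
  have r: "norm (complex_of_real (exp t)) < fps_conv_radius apery_fps"
    using left_half_radius[OF t] by (simp add: exp_of_real)
  have "\<exists>a. eval_fps apery_fps (of_real (exp t)) = of_real a \<and> a \<ge> apery_number 0"
    using r by (intro eval_fps_nonneg_real apery_fps_nth apery_number_nonneg) auto
  moreover have "\<exists>b. eval_fps (fps_theta apery_fps) (of_real (exp t)) = of_real b \<and> b \<ge> real 0 * apery_number 0"
    using order.strict_trans2[OF r fps_conv_radius_theta[of apery_fps 1]] apery_number_nonneg
    by (intro eval_fps_nonneg_real) (auto simp: apery_fps_nth)
  ultimately show ?thesis
    using apery_fun_derivs[OF t, of 0] apery_fun_derivs[OF t, of 1] by (auto simp: apery_number_0_1 exp_of_real)
qed

lemma apery_J_apery_fun:
  assumes "t \<in> left_half"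
  shows "apery_J apery_fun t = 0"
proof -
  have P: "apery_P t \<noteq> 0" if "t \<in> left_half" for t
    using that apery_L_gt_1 by (intro apery_P_nonzero_Re) (auto simp: left_half_def)
  have J: "apery_J apery_fun (of_real s) = apery_J apery_fun t" if "s < - apery_L" for s
    using that assms by (intro apery_J_constant[OF apery_sol_apery_fun open_left_half convex_connected[OF convex_left_half] P])
      (auto simp: left_half_def)
  have ev: "eventually (\<lambda>s. s < - apery_L) at_bot" by (rule eventually_gt_at_bot)
  have ex: "((\<lambda>s. exp (complex_of_real s)) \<longlongrightarrow> 0) at_bot"
    using tendsto_of_real[OF exp_at_bot, where 'a = complex] by (simp add: exp_of_real)
  have der: "((\<lambda>s. (deriv ^^ j) apery_fun (of_real s)) \<longlongrightarrow> fps_nth ((fps_theta ^^ j) apery_fps) 0) at_bot" for j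
  proof -
    have "norm (0 :: complex) < fps_conv_radius ((fps_theta ^^ j) apery_fps)"
      by (rule order.strict_trans2[OF _ order.trans[OF fps_conv_radius_apery fps_conv_radius_theta]]) simp
    hence "isCont (eval_fps ((fps_theta ^^ j) apery_fps)) 0"
      by (rule continuous_eval_fps)
    from isCont_tendsto_compose[OF this ex]
    have "((\<lambda>s. eval_fps ((fps_theta ^^ j) apery_fps) (exp (of_real s))) \<longlongrightarrow> fps_nth ((fps_theta ^^ j) apery_fps) 0) at_bot"
      by (simp add: eval_fps_at_0)
    thus ?thesis
      by (rule Lim_transform_eventually)
        (use ev in eventually_elim, auto simp: apery_fun_derivs left_half_def)
  qed
  have d: "((\<lambda>s. apery_fun (of_real s)) \<longlongrightarrow> 1) at_bot" "((\<lambda>s. deriv apery_fun (of_real s)) \<longlongrightarrow> 0) at_bot"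
    "((\<lambda>s. (deriv ^^ 2) apery_fun (of_real s)) \<longlongrightarrow> 0) at_bot"
    using der[of 0] der[of 1] der[of 2] by (simp_all add: fps_theta_power_nth apery_fps_nth apery_number_0_1)
  have "((\<lambda>s. apery_J apery_fun (of_real s)) \<longlongrightarrow>
     (0^2 - 34 * 0 + 1) * (1 * 0 - 0^2 / 2) + (2 * 0^2 - 34 * 0) / 2 * 1 * 0 + (0^2 - 10 * 0) / 2 * 1^2) at_bot"
    unfolding apery_J_def apery_P_def apery_P'_def by (intro tendsto_intros d ex) auto
  hence "((\<lambda>s. apery_J apery_fun (of_real s)) \<longlongrightarrow> 0) at_bot" by simp
  moreover have "eventually (\<lambda>s. apery_J apery_fun (of_real s) = apery_J apery_fun t) at_bot"
    using ev by eventually_elim (rule J)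
  hence "((\<lambda>s. apery_J apery_fun (of_real s)) \<longlongrightarrow> apery_J apery_fun t) at_bot" by (rule tendsto_eventually)
  ultimately show ?thesis using tendsto_unique[of "at_bot :: real filter"] by auto
qed

section \<open>The hypergeometric differential equation\<close>

text \<open>The hypergeometric equation in \<open>u\<close> takes the form
  \<open>hyp_denom bs\<close> at \<open>\<theta>\<close> applied to \<open>F\<close> equals
  \<open>u\<close> times \<open>hyp_numer as\<close> at \<open>\<theta>\<close> applied to
  \<open>F\<close>.\<close>

definition hyp_numer :: "complex list \<Rightarrow> complex poly"
  where "hyp_numer as = (\<Prod>a\<leftarrow>as. [:a, 1:])"

text \<open>The shifts \<open>b - 1\<close> and the root 0, which comes from \<open>(1)_n\<close>,
  arise because the recurrence is read at the index \<open>n + 1\<close>. The root 0 also kills the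
  constant term, so no inhomogeneity appears.\<close>

definition hyp_denom :: "complex list \<Rightarrow> complex poly"
  where "hyp_denom bs = [:0, 1:] * (\<Prod>b\<leftarrow>bs. [:b - 1, 1:])"

lemma prod_list_linear:
  "degree (\<Prod>a\<leftarrow>as. [:f a, 1:]) = length as \<and> coeff (\<Prod>a\<leftarrow>as. [:f a, 1:]) (length as) = (1 :: complex)"
proof (induction as)
  case (Cons a as)
  define P where "P = (\<Prod>a\<leftarrow>as. [:f a, 1:])"
  have P: "degree P = length as" "lead_coeff P = 1" using Cons by (auto simp: P_def)
  hence "P \<noteq> 0" by auto
  hence deg: "degree ([:f a, 1:] * P) = Suc (length as)" using P by (subst degree_mult_eq) auto
  have "lead_coeff ([:f a, 1:] * P) = 1" unfolding lead_coeff_mult using P by simp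
  thus ?case unfolding deg using deg by (simp only: list.map prod_list.Cons P_def list.size) simp
qed simp

lemma hyp_numer_props: "degree (hyp_numer as) = length as" "coeff (hyp_numer as) (length as) = 1"
  using prod_list_linear[of "\<lambda>a. a" as] by (simp_all add: hyp_numer_def)

lemma hyp_denom_props: "degree (hyp_denom bs) = Suc (length bs)" "coeff (hyp_denom bs) (Suc (length bs)) = 1"
proof -
  define P where "P = (\<Prod>b\<leftarrow>bs. [:b - 1, 1:])"
  have P: "degree P = length bs" "lead_coeff P = 1"
    using prod_list_linear[of "\<lambda>b. b - 1" bs] by (auto simp: P_def)
  hence "P \<noteq> 0" by auto
  thus 1: "degree (hyp_denom bs) = Suc (length bs)"
    unfolding hyp_denom_def P_def[symmetric] using P by (subst degree_mult_eq) auto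
  have "lead_coeff (hyp_denom bs) = 1"
    unfolding hyp_denom_def P_def[symmetric] lead_coeff_mult using P by simp
  thus "coeff (hyp_denom bs) (Suc (length bs)) = 1" by (simp add: 1)
qed

lemma poly_hyp_numer: "foldl (\<lambda>r a. r * (a + x)) c as = c * poly (hyp_numer as) x"
  by (induction as arbitrary: c) (auto simp: hyp_numer_def algebra_simps)

lemma poly_hyp_denom: "foldl (\<lambda>r b. r * (b + x)) c bs * (x + 1) = c * poly (hyp_denom bs) (x + 1)"
  by (induction bs arbitrary: c) (auto simp: hyp_denom_def algebra_simps)

lemma foldl_mult_eq_0: "foldl (\<lambda>r b. r * (b + x)) c bs = (0 :: complex) \<longleftrightarrow> c = 0 \<or> (\<exists>b\<in>set bs. b + x = 0)"
  by (induction bs arbitrary: c) auto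

lemma hyp_recurrence:
  fixes as bs :: "complex list"
  assumes "set bs \<inter> \<int>\<^sub>\<le>\<^sub>0 = {}"
  defines "F \<equiv> fps_hypergeo as bs (1 :: complex)"
  shows "poly (hyp_denom bs) (of_nat (Suc n)) * fps_nth F (Suc n) = poly (hyp_numer as) (of_nat n) * fps_nth F n"
proof -
  let ?d = "foldl (\<lambda>r b. r * (b + of_nat n)) (of_nat (Suc n)) bs :: complex"
  have "?d \<noteq> 0"
  proof
    assume "?d = 0"
    then obtain b where b: "b \<in> set bs" "b + of_nat n = 0"
      unfolding foldl_mult_eq_0 by (auto simp del: of_nat_Suc)
    hence "b = - of_nat n" by (simp add: eq_neg_iff_add_eq_0)
    hence "b \<in> \<int>\<^sub>\<le>\<^sub>0" by simp
    thus False using b assms by blast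
  qed
  moreover have "fps_nth F (Suc n) = foldl (\<lambda>r a. r * (a + of_nat n)) 1 as / ?d * fps_nth F n"
    unfolding F_def by (rule fps_hypergeo_rec)
  ultimately have "?d * fps_nth F (Suc n) = poly (hyp_numer as) (of_nat n) * fps_nth F n"
    by (simp add: poly_hyp_numer)
  moreover have "?d = poly (hyp_denom bs) (of_nat (Suc n))"
  proof -
    have "?d * (of_nat n + 1) = of_nat (Suc n) * poly (hyp_denom bs) (of_nat n + 1)" by (rule poly_hyp_denom)
    moreover have "of_nat n + 1 = (of_nat (Suc n) :: complex)" by simp
    ultimately show ?thesis by (simp del: of_nat_Suc)
  qed
  ultimately show ?thesis by simp
qed

lemma eval_theta_polynomial:
  assumes "norm u < fps_conv_radius F" "degree q \<le> p"
  shows "(\<lambda>n. poly q (of_nat n) * fps_nth F n * u ^ n) sums (\<Sum>j\<le>p. coeff q j * eval_fps ((fps_theta ^^ j) F) u)"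
proof -
  have "norm u < fps_conv_radius ((fps_theta ^^ j) F)" for j
    using assms(1) fps_conv_radius_theta by (rule order.strict_trans2)
  hence "(\<lambda>n. \<Sum>j\<le>p. coeff q j * (fps_nth ((fps_theta ^^ j) F) n * u ^ n)) sums
     (\<Sum>j\<le>p. coeff q j * eval_fps ((fps_theta ^^ j) F) u)"
    by (intro sums_sum sums_mult sums_eval_fps)
  also have "(\<lambda>n. \<Sum>j\<le>p. coeff q j * (fps_nth ((fps_theta ^^ j) F) n * u ^ n)) =
     (\<lambda>n. poly q (of_nat n) * fps_nth F n * u ^ n)"
  proof
    fix n
    have "poly q (of_nat n) = (\<Sum>j\<le>p. coeff q j * of_nat n ^ j)"
      unfolding poly_altdef using assms(2) by (intro sum.mono_neutral_left) (auto simp: coeff_eq_0)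
    thus "(\<Sum>j\<le>p. coeff q j * (fps_nth ((fps_theta ^^ j) F) n * u ^ n)) = poly q (of_nat n) * fps_nth F n * u ^ n"
      by (simp add: fps_theta_power_nth sum_distrib_right mult.assoc)
  qed
  finally show ?thesis .
qed

lemma hyp_eval_ode:
  fixes u :: complex and as bs :: "complex list"
  assumes bs: "set bs \<inter> \<int>\<^sub>\<le>\<^sub>0 = {}" and len: "length as = p" "length bs = p - 1" "p \<ge> 1"
  defines "F \<equiv> fps_hypergeo as bs 1"
  assumes u: "norm u < fps_conv_radius F"
  shows "(\<Sum>j\<le>p. (coeff (hyp_denom bs) j - u * coeff (hyp_numer as) j) * eval_fps ((fps_theta ^^ j) F) u) = 0"
proof -
  have deg: "degree (hyp_denom bs) \<le> p" "degree (hyp_numer as) \<le> p"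
    using len by (simp_all add: hyp_numer_props hyp_denom_props)
  note 1 = eval_theta_polynomial[OF u deg(1)]
  note 2 = sums_mult[OF eval_theta_polynomial[OF u deg(2)], of u]
  have "(\<lambda>n. poly (hyp_denom bs) (of_nat (Suc n)) * fps_nth F (Suc n) * u ^ Suc n) sums
     (\<Sum>j\<le>p. coeff (hyp_denom bs) j * eval_fps ((fps_theta ^^ j) F) u)"
    using 1 by (subst sums_Suc_iff) (simp add: hyp_denom_def)
  moreover have "(\<lambda>n. poly (hyp_denom bs) (of_nat (Suc n)) * fps_nth F (Suc n) * u ^ Suc n)
    = (\<lambda>n. u * (poly (hyp_numer as) (of_nat n) * fps_nth F n * u ^ n))"
    unfolding F_def hyp_recurrence[OF bs] by (simp add: mult_ac)
  ultimately have "(\<Sum>j\<le>p. coeff (hyp_denom bs) j * eval_fps ((fps_theta ^^ j) F) u)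
     = u * (\<Sum>j\<le>p. coeff (hyp_numer as) j * eval_fps ((fps_theta ^^ j) F) u)"
    using sums_unique2[OF _ 2] by (simp only:)
  thus ?thesis by (simp add: left_diff_distrib sum_subtractf sum_distrib_left mult.assoc)
qed

section \<open>The equation in the variable \<open>x\<close>, its persistence under continuation,
  and its form in \<open>t\<close>\<close>

definition theta :: "(complex \<Rightarrow> complex) \<Rightarrow> complex \<Rightarrow> complex"
  where "theta f x = x * deriv f x"

lemma holomorphic_theta:
  assumes "f holomorphic_on V" "open V"
  shows "(theta ^^ j) f holomorphic_on V"
proof (induction j)
  case (Suc j)
  have "theta ((theta ^^ j) f) = (\<lambda>x. x * deriv ((theta ^^ j) f) x)" by (simp add: theta_def fun_eq_iff)
  thus ?case using holomorphic_deriv[OF Suc assms(2)] by (auto intro!: holomorphic_intros)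
qed (use assms in auto)

lemma theta_cong:
  assumes "f holomorphic_on D" "open D" "\<And>x. x \<in> D \<Longrightarrow> f x = g x" "x \<in> D"
  shows "(theta ^^ j) f x = (theta ^^ j) g x"
  using assms(4)
proof (induction j arbitrary: x)
  case (Suc j)
  have "((theta ^^ j) f has_field_derivative deriv ((theta ^^ j) f) x) (at x)"
    using holomorphic_derivI[OF holomorphic_theta[OF assms(1,2)] assms(2) Suc.prems] by simp
  hence "((theta ^^ j) g has_field_derivative deriv ((theta ^^ j) f) x) (at x)"
    by (rule has_field_derivative_transform_within_open[OF _ assms(2) Suc.prems]) (rule Suc.IH)
  thus ?case
    by (simp add: theta_def[of "(theta ^^ j) f"] theta_def[of "(theta ^^ j) g"] DERIV_imp_deriv)
qed (use assms in auto)

lemma derivs_comp_exp: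
  assumes f: "f holomorphic_on V" "open V" and t: "exp t \<in> V"
  shows "(deriv ^^ j) (\<lambda>t. f (exp t)) t = (theta ^^ j) f (exp t)"
  using t
proof (induction j arbitrary: t)
  case (Suc j)
  have D: "open (exp -` V)" by (intro continuous_open_vimage continuous_intros f(2))
  have "((theta ^^ j) f has_field_derivative deriv ((theta ^^ j) f) (exp t)) (at (exp t))"
    by (rule holomorphic_derivI[OF holomorphic_theta[OF f] f(2) Suc.prems])
  from DERIV_chain2[OF this DERIV_exp]
  have "((\<lambda>t. (theta ^^ j) f (exp t)) has_field_derivative theta ((theta ^^ j) f) (exp t)) (at t)"
    by (simp add: theta_def[of "(theta ^^ j) f"] mult.commute)
  hence "((deriv ^^ j) (\<lambda>t. f (exp t)) has_field_derivative theta ((theta ^^ j) f) (exp t)) (at t)"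
    by (rule has_field_derivative_transform_within_open[OF _ D]) (use Suc in auto)
  thus ?case by (simp add: DERIV_imp_deriv)
qed simp

text \<open>For \<open>u = \<gamma> * x powi m\<close> the Euler operator in \<open>u\<close> is
  \<open>1 / m\<close> times the one in \<open>x\<close>. Multiplying the equation by
  \<open>m ^ p\<close> gives the factors \<open>m ^ (p - j)\<close> and treats both signs of
  \<open>m\<close> alike.\<close>

definition hyp_operator where
  "hyp_operator p as bs \<gamma> m f x = (\<Sum>j\<le>p. (coeff (hyp_denom bs) j - \<gamma> * x powi m * coeff (hyp_numer as) j)
     * of_int m ^ (p - j) * (theta ^^ j) f x)"

lemma holomorphic_hyp_operator:
  assumes "f holomorphic_on V" "open V" "0 \<notin> V"
  shows "hyp_operator p as bs \<gamma> m f holomorphic_on V"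
proof -
  have "(theta ^^ j) f holomorphic_on V" for j by (rule holomorphic_theta[OF assms(1,2)])
  moreover have "(\<lambda>x. x powi m) holomorphic_on V" using assms(3) by (intro holomorphic_intros) auto
  ultimately show ?thesis unfolding hyp_operator_def[abs_def] by (auto intro!: holomorphic_intros)
qed

text \<open>Off the origin the operator produces a holomorphic function, and it vanishes on the open
  set where consecutive elements agree. Deleting one point leaves an open connected domain
  connected, so the identity theorem applies.\<close>

lemma hyp_operator_continuation:
  assumes "analytic_continuation_of f U g V" "\<And>x. x \<in> U - {0} \<Longrightarrow> hyp_operator p as bs \<gamma> m f x = 0"
    and "x \<in> V - {0}"
  shows "hyp_operator p as bs \<gamma> m g x = 0"
  using assms(1,3)
proof (induction arbitrary: x rule: analytic_continuation_of.induct)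
  case refl
  thus ?case using assms(2) by blast
next
  case (step g V h W D)
  have W: "open W" "connected W" "h holomorphic_on W" and V: "open V" "g holomorphic_on V"
    using step.hyps(2) analytic_continuation_of_function_element[OF step.hyps(1)]
    by (auto simp: function_element_def)
  have hW: "h holomorphic_on W - {0}" by (rule holomorphic_on_subset[OF W(3)]) auto
  have gh: "hyp_operator p as bs \<gamma> m h y = 0" if "y \<in> D - {0}" for y
  proof -
    have "(theta ^^ j) g y = (theta ^^ j) h y" for j
      using step.hyps that V by (intro theta_cong[of g D]) (auto intro: holomorphic_on_subset)
    hence "hyp_operator p as bs \<gamma> m h y = hyp_operator p as bs \<gamma> m g y" by (simp add: hyp_operator_def)
    thus ?thesis using step.IH[of y] step.hyps that by auto
  qed
  have "D - {0} \<noteq> {}"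
    using step.hyps(3,4) not_open_singleton[of "0 :: complex"] by (metis Diff_eq_empty_iff subset_singletonD)
  moreover have "connected (W - {0})" using W by (intro connected_open_delete) auto
  moreover have "D - {0} \<subseteq> W - {0}" using step.hyps(5) by blast
  moreover have "hyp_operator p as bs \<gamma> m h holomorphic_on W - {0}"
    using W by (intro holomorphic_hyp_operator hW) (auto simp: open_delete)
  ultimately show ?case
    using gh step.hyps(3) step.prems W(1)
    by (intro analytic_continuation_open[of "D - {0}" "W - {0}" "hyp_operator p as bs \<gamma> m h" "\<lambda>_. 0" x])
      (auto simp: open_delete)
qed

text \<open>With \<open>p\<close> upper and \<open>p - 1\<close> lower parameters both polynomials
  are monic of degree \<open>p\<close>, so the leading coefficient is
  \<open>1 - \<gamma> * exp (m * t)\<close> and its zeros are the only singular points.\<close>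

definition hyp_coeff where
  "hyp_coeff p as bs \<gamma> m j t = - ((coeff (hyp_denom bs) j - \<gamma> * exp (of_int m * t) * coeff (hyp_numer as) j)
     * of_int m ^ (p - j)) / (1 - \<gamma> * exp (of_int m * t))"

lemma holomorphic_hyp_coeff:
  assumes "\<And>t. t \<in> A \<Longrightarrow> \<gamma> * exp (of_int m * t) \<noteq> 1"
  shows "hyp_coeff p as bs \<gamma> m j holomorphic_on A"
  unfolding hyp_coeff_def[abs_def] using assms by (intro holomorphic_intros) auto

lemma exp_of_int_period: "exp (of_int m * (t + 2 * of_int k * of_real pi * \<i>)) = exp (of_int m * t)"
proof -
  show ?thesis unfolding exp_eq by (intro exI[of _ "m * k"]) (simp add: algebra_simps)
qed

lemma hyp_coeff_periodic: "hyp_coeff p as bs \<gamma> m j (t + 2 * of_int k * of_real pi * \<i>) = hyp_coeff p as bs \<gamma> m j t"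
  unfolding hyp_coeff_def exp_of_int_period ..

lemma hyp_operator_lsol:
  assumes g: "g holomorphic_on V" "open V" and len: "length as = p" "length bs = p - 1" "p \<ge> 1"
    and 0: "\<And>x. x \<in> V - {0} \<Longrightarrow> hyp_operator p as bs \<gamma> m g x = 0"
  shows "lsol p (hyp_coeff p as bs \<gamma> m) (\<lambda>t. g (exp t)) {t. exp t \<in> V \<and> \<gamma> * exp (of_int m * t) \<noteq> 1}"
  unfolding lsol_def
proof (intro conjI ballI)
  show "(\<lambda>t. g (exp t)) holomorphic_on {t. exp t \<in> V \<and> \<gamma> * exp (of_int m * t) \<noteq> 1}"
    by (rule holomorphic_on_compose_gen[unfolded o_def, OF _ g(1)]) (auto intro!: holomorphic_intros)
  fix t assume "t \<in> {t. exp t \<in> V \<and> \<gamma> * exp (of_int m * t) \<noteq> 1}"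
  hence t: "exp t \<in> V" "\<gamma> * exp (of_int m * t) \<noteq> 1" by auto
  define y where "y = (\<lambda>j. (deriv ^^ j) (\<lambda>t. g (exp t)) t)"
  define u where "u = \<gamma> * exp (of_int m * t)"
  define c where "c = (\<lambda>j. (coeff (hyp_denom bs) j - u * coeff (hyp_numer as) j) * of_int m ^ (p - j))"
  have "(\<Sum>j\<le>p. c j * y j) = hyp_operator p as bs \<gamma> m g (exp t)"
    unfolding hyp_operator_def y_def derivs_comp_exp[OF g t(1)] c_def u_def by (simp add: exp_power_int)
  also have "\<dots> = 0" using 0[of "exp t"] t by simp
  finally have "(\<Sum>j<p. c j * y j) + c p * y p = 0" by (simp flip: lessThan_Suc_atMost)
  moreover have "c p = 1 - u"
    using hyp_numer_props(2)[of as] hyp_denom_props(2)[of bs] len by (simp add: c_def)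
  ultimately have "(1 - u) * y p = - (\<Sum>j<p. c j * y j)" by (simp add: eq_neg_iff_add_eq_0 add.commute)
  hence "y p = - (\<Sum>j<p. c j * y j) / (1 - u)" using t(2) by (simp add: u_def field_simps)
  also have "\<dots> = (\<Sum>j<p. - c j / (1 - u) * y j)"
    by (simp add: sum_divide_distrib flip: sum_negf)
  finally show "(deriv ^^ p) (\<lambda>t. g (exp t)) t = (\<Sum>j<p. hyp_coeff p as bs \<gamma> m j t * (deriv ^^ j) (\<lambda>t. g (exp t)) t)"
    by (simp only: y_def c_def hyp_coeff_def u_def)
qed

lemma admissible_branch_lsol:
  assumes "admissible_branch g U"
  obtains p as bs \<gamma> m where "\<gamma> \<noteq> 0" "m \<noteq> 0"
    "lsol p (hyp_coeff p as bs \<gamma> m) (\<lambda>t. g (exp t)) {t. exp t \<in> U \<and> \<gamma> * exp (of_int m * t) \<noteq> 1}"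
proof -
  obtain p as bs \<gamma> m where *: "p \<ge> 1" "length as = p" "length bs = p - 1" "set bs \<subseteq> \<rat> - \<int>\<^sub>\<le>\<^sub>0"
    "\<gamma> \<noteq> 0" "m \<noteq> 0" "hypergeo_branch as bs \<gamma> m g U"
    using assms unfolding admissible_branch_def by blast
  define F where "F = fps_hypergeo as bs (1 :: complex)"
  define f where "f = (\<lambda>x. eval_fps F (\<gamma> * x powi m))"
  define V where "V = {x. (m < 0 \<longrightarrow> x \<noteq> 0) \<and> \<gamma> * x powi m \<in> eball 0 (fps_conv_radius F)}"
  have cont: "analytic_continuation_of f V g U"
    using *(7) unfolding hypergeo_branch_def Let_def F_def f_def V_def .
  hence "function_element f V" by (induction rule: analytic_continuation_of.induct) auto
  hence fV: "f holomorphic_on V" "open V" by (auto simp: function_element_def)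
  have "hyp_operator p as bs \<gamma> m f x = 0" if x: "x \<in> V - {0}" for x
  proof -
    define t where "t = Ln x"
    have t: "exp t = x" using x by (simp add: t_def)
    define u where "u = \<gamma> * exp (of_int m * t)"
    have u: "u = \<gamma> * x powi m" by (simp add: u_def exp_power_int flip: t)
    have nu: "norm u < fps_conv_radius F" using x by (simp add: V_def u eball_def)
    have fe: "(\<lambda>t. f (exp t)) = (\<lambda>t. eval_fps F (\<gamma> * exp (of_int m * t)))"
      by (simp add: f_def exp_power_int)
    have th: "(theta ^^ j) f x = of_int m ^ j * eval_fps ((fps_theta ^^ j) F) u" for j
      using derivs_comp_exp[OF fV, of t j] eval_fps_exp_derivs[OF nu[unfolded u_def]] x
      by (simp add: fe t u_def)
    have "hyp_operator p as bs \<gamma> m f x = (\<Sum>j\<le>p. of_int m ^ p *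
      ((coeff (hyp_denom bs) j - u * coeff (hyp_numer as) j) * eval_fps ((fps_theta ^^ j) F) u))"
      unfolding hyp_operator_def th u[symmetric]
    proof (intro sum.cong HOL.refl)
      fix j assume "j \<in> {..p}"
      hence "of_int m ^ p = (of_int m ^ (p - j) * of_int m ^ j :: complex)" by (simp flip: power_add)
      thus "(coeff (hyp_denom bs) j - u * coeff (hyp_numer as) j) * of_int m ^ (p - j) *
          (of_int m ^ j * eval_fps ((fps_theta ^^ j) F) u)
         = of_int m ^ p * ((coeff (hyp_denom bs) j - u * coeff (hyp_numer as) j) * eval_fps ((fps_theta ^^ j) F) u)"
        by simp
    qed
    also have "\<dots> = 0"
      using hyp_eval_ode[of bs as p u] * nu by (auto simp: F_def simp flip: sum_distrib_left)
    finally show ?thesis .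
  qed
  from hyp_operator_continuation[OF cont this]
  have "hyp_operator p as bs \<gamma> m g x = 0" if "x \<in> U - {0}" for x using that by blast
  moreover have "g holomorphic_on U" "open U"
    using analytic_continuation_of_function_element[OF cont] by (auto simp: function_element_def)
  ultimately show ?thesis
    using that[OF *(5,6)] hyp_operator_lsol[of g U as p bs \<gamma> m] *(1-3) by blast
qed

section \<open>Transporting an identity along an analytic continuation\<close>

text \<open>Serves to choose a target that is not opposite to \<open>\<alpha>\<close> as seen from
  \<open>t\<close>, so that both fit into one open half plane through \<open>t\<close>. A small step
  perpendicular to \<open>\<alpha>\<close> changes the imaginary part of the quotient, hence one of
  the two points is good.\<close>

lemma nonreal_point:
  assumes "open W" "W \<noteq> {}" "\<alpha> \<noteq> (0 :: complex)"
  shows "\<exists>z\<in>W. (z - t) / \<alpha> \<notin> \<real>\<^sub>\<le>\<^sub>0"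
proof -
  obtain w e where w: "e > 0" "ball w e \<subseteq> W" using assms open_contains_ball by blast
  define z where "z = w + of_real (e / 2) * \<i> * sgn \<alpha>"
  have "dist w z < e" using w(1) assms(3) by (simp add: z_def dist_norm norm_mult norm_sgn)
  hence zW: "z \<in> W" and wW: "w \<in> W" using w by auto
  have "sgn \<alpha> / \<alpha> = of_real (1 / norm \<alpha>)" using assms(3) by (simp add: sgn_eq field_simps)
  moreover have "(z - t) / \<alpha> = (w - t) / \<alpha> + of_real (e / 2) * \<i> * (sgn \<alpha> / \<alpha>)"
    by (simp add: z_def add_divide_distrib diff_divide_distrib)
  ultimately have "(z - t) / \<alpha> = (w - t) / \<alpha> + of_real (e / 2 / norm \<alpha>) * \<i>"
    by (simp only:) simp
  hence "Im ((z - t) / \<alpha>) = Im ((w - t) / \<alpha>) + e / 2 / norm \<alpha>" by simp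
  moreover have "e / 2 / norm \<alpha> > 0" using w(1) assms(3) by simp
  ultimately have "Im ((z - t) / \<alpha>) \<noteq> 0 \<or> Im ((w - t) / \<alpha>) \<noteq> 0" by linarith
  thus ?thesis using zW wW complex_nonpos_Reals_iff by blast
qed

text \<open>\<open>\<kappa>\<close> points along the bisector of \<open>\<alpha>\<close> and
  \<open>\<beta>\<close>: with \<open>s\<close> the principal root of
  \<open>\<beta> / \<alpha>\<close>, its inner products with them are \<open>Re s\<close> and
  \<open>(norm s)^2 * Re s\<close>, and \<open>Re s > 0\<close> off the branch cut.\<close>

lemma common_half_disc:
  assumes "\<alpha> \<noteq> 0" "\<beta> / \<alpha> \<notin> \<real>\<^sub>\<le>\<^sub>0"
  shows "\<exists>\<kappa>::complex. \<kappa> \<bullet> \<alpha> > 0 \<and> \<kappa> \<bullet> \<beta> > 0"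
proof -
  define s where "s = csqrt (\<beta> / \<alpha>)"
  have s: "s * s = \<beta> / \<alpha>" by (simp add: s_def flip: power2_eq_square)
  have "Re s > 0"
  proof (rule ccontr)
    assume "\<not> Re s > 0"
    hence "Re s = 0" using csqrt_principal[of "\<beta> / \<alpha>"] by (auto simp: s_def)
    hence "s * s = of_real (- ((Im s)\<^sup>2))" by (simp add: complex_eq_iff power2_eq_square)
    hence "\<beta> / \<alpha> \<in> \<real>\<^sub>\<le>\<^sub>0" unfolding s[symmetric] by (simp only: nonpos_Reals_of_real_iff) simp
    thus False using assms by simp
  qed
  have inner: "cnj (cnj s / \<alpha>) \<bullet> w = Re (cnj s * (w / \<alpha>))" for w
  proof -
    have *: "cnj c \<bullet> w = Re (c * w)" for c by (simp add: inner_complex_def)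
    show ?thesis unfolding * by simp
  qed
  have "cnj (cnj s / \<alpha>) \<bullet> \<alpha> > 0" unfolding inner using \<open>Re s > 0\<close> assms(1) by simp
  moreover have "cnj s * (\<beta> / \<alpha>) = of_real ((norm s)\<^sup>2) * s"
  proof -
    have "cnj s * (s * s) = (s * cnj s) * s" by simp
    also have "s * cnj s = of_real ((norm s)\<^sup>2)" by (rule complex_norm_square[symmetric])
    finally show ?thesis by (simp only: s)
  qed
  hence "cnj (cnj s / \<alpha>) \<bullet> \<beta> > 0" unfolding inner using \<open>Re s > 0\<close> by (auto simp: zero_less_mult_iff)
  ultimately show ?thesis by blast
qed

lemma exp_shift_into:
  assumes "exp u = exp (u0 :: complex)"
  shows "\<exists>k::int. u0 + 2 * of_int k * of_real pi * \<i> = u"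
  using assms unfolding exp_eq by auto

lemma open_exp_image: "open B \<Longrightarrow> open (exp ` B :: complex set)"
proof (rule open_mapping_thm[of exp UNIV])
  show "\<not> exp constant_on (UNIV :: complex set)"
    unfolding constant_on_def by (metis UNIV_I exp_ln exp_not_eq_zero exp_zero zero_neq_numeral exp_Ln
        one_neq_zero zero_neq_one add_cancel_right_right one_add_one)
qed (auto intro!: holomorphic_intros)

lemma open_exp_vimage: "open W \<Longrightarrow> open (exp -` W :: complex set)"
  by (intro continuous_open_vimage continuous_intros)

text \<open>Abstracts the finitely many hypergeometric equations in \<open>t\<close>, with
  \<open>S\<close> containing all their singular points and \<open>\<Phi>\<close> the polynomial.
  Periodicity holds because everything comes from functions of \<open>x = exp t\<close>.\<close>

locale periodic_family =
  fixes N :: nat and p :: "nat \<Rightarrow> nat" and a :: "nat \<Rightarrow> nat \<Rightarrow> complex \<Rightarrow> complex"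
    and S :: "complex set" and \<Phi> :: "(nat \<Rightarrow> complex) \<Rightarrow> complex"
  assumes coeff_holomorphic: "\<And>i j A. i < N \<Longrightarrow> A \<inter> S = {} \<Longrightarrow> a i j holomorphic_on A"
    and isolated: "\<And>t. \<exists>r>0. (ball t r - {t}) \<inter> S = {}"
    and S_periodic: "\<And>t k. t + 2 * of_int k * of_real pi * \<i> \<in> S \<longleftrightarrow> t \<in> S"
    and coeff_periodic: "\<And>i j t k. i < N \<Longrightarrow> a i j (t + 2 * of_int k * of_real pi * \<i>) = a i j t"
    and \<Phi>: "holomorphic_combination N (\<lambda>_. \<Phi>)"
begin

text \<open>\<open>g\<close> is a single-valued function of \<open>x\<close>, whereas the
  \<open>f i\<close> are arbitrary solutions on a set in the \<open>t\<close>-plane. Nothing ties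
  them to the original hypergeometric branches, and this is what makes the relation
  transportable.\<close>

definition rel :: "(complex \<Rightarrow> complex) \<Rightarrow> complex set \<Rightarrow> bool"
  where "rel g D \<longleftrightarrow> open D \<and> D \<noteq> {} \<and> D \<inter> S = {} \<and>
    (\<exists>f. (\<forall>i<N. lsol (p i) (a i) (f i) D) \<and> (\<forall>t\<in>D. g (exp t) = \<Phi> (\<lambda>i. f i t)))"

lemma relI:
  assumes "open D" "D \<noteq> {}" "D \<inter> S = {}" "\<And>i. i < N \<Longrightarrow> lsol (p i) (a i) (f i) D"
    and "\<And>t. t \<in> D \<Longrightarrow> g (exp t) = \<Phi> (\<lambda>i. f i t)"
  shows "rel g D"
  unfolding rel_def using assms(1-3) by (intro conjI exI[of _ f] allI impI ballI assms(4,5)) auto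

lemma rel_subset: "rel g D \<Longrightarrow> open D' \<Longrightarrow> D' \<noteq> {} \<Longrightarrow> D' \<subseteq> D \<Longrightarrow> rel g D'"
  unfolding rel_def by (meson disjoint_iff lsol_subset subsetD)

lemma rel_cong: "rel g D \<Longrightarrow> (\<And>t. t \<in> D \<Longrightarrow> g (exp t) = h (exp t)) \<Longrightarrow> rel h D"
  unfolding rel_def by metis

text \<open>Two logarithms of the same \<open>x\<close> differ by a period, and translates of
  solutions by a period are solutions; \<open>g (exp t)\<close> does not notice.\<close>

lemma rel_shift:
  assumes "rel g D"
  defines "z \<equiv> \<lambda>k::int. 2 * of_int k * of_real pi * \<i>"
  shows "rel g ((\<lambda>t. t + z k) -` D)"
proof -
  obtain f where D: "open D" "D \<noteq> {}" "D \<inter> S = {}" and f: "\<And>i. i < N \<Longrightarrow> lsol (p i) (a i) (f i) D"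
    "\<And>t. t \<in> D \<Longrightarrow> g (exp t) = \<Phi> (\<lambda>i. f i t)"
    using assms(1) unfolding rel_def by blast
  define D' where "D' = (\<lambda>t. t + z k) -` D"
  have D': "open D'" unfolding D'_def by (intro continuous_open_vimage continuous_intros D)
  obtain t0 where "t0 \<in> D" using D(2) by blast
  hence "t0 - z k \<in> D'" by (simp add: D'_def)
  hence "D' \<noteq> {}" by blast
  moreover have "D' \<inter> S = {}" using D(3) S_periodic by (auto simp: D'_def z_def)
  moreover have "lsol (p i) (a i) (\<lambda>t. f i (t + z k)) D'" if i: "i < N" for i
    unfolding lsol_def
  proof (intro conjI ballI)
    have fh: "f i holomorphic_on D" using f(1)[OF i] by (rule lsol_holomorphic)
    show "(\<lambda>t. f i (t + z k)) holomorphic_on D'"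
      by (rule holomorphic_on_compose_gen[unfolded o_def, OF _ fh]) (auto intro!: holomorphic_intros simp: D'_def)
    fix t assume t: "t \<in> D'"
    have "(deriv ^^ j) (\<lambda>t. f i (t + z k)) t = (deriv ^^ j) (f i) (t + z k)" for j
      using higher_deriv_compose_linear'[OF fh D' D(1) t, of 1 "z k" j] by (simp add: D'_def)
    thus "(deriv ^^ p i) (\<lambda>t. f i (t + z k)) t = (\<Sum>j<p i. a i j t * (deriv ^^ j) (\<lambda>t. f i (t + z k)) t)"
      using f(1)[OF i] t coeff_periodic[OF i, of _ t k] by (simp add: lsol_def D'_def z_def)
  qed
  moreover have "g (exp t) = \<Phi> (\<lambda>i. f i (t + z k))" if "t \<in> D'" for t
  proof -
    have "exp (t + z k) = exp t" unfolding z_def exp_eq by (intro exI[of _ k]) simp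
    thus ?thesis using f(2)[of "t + z k"] that by (simp add: D'_def)
  qed
  ultimately show ?thesis
    unfolding D'_def[symmetric] using D' by (intro relI[where f = "\<lambda>i t. f i (t + z k)"])
qed

lemma rel_extend:
  assumes "rel g D" "D \<subseteq> C" "open C" "convex C" "C \<inter> S = {}" and g: "(\<lambda>t. g (exp t)) holomorphic_on C"
  shows "rel g C"
proof -
  obtain f where D: "open D" "D \<noteq> {}" "D \<inter> S = {}" and f: "\<And>i. i < N \<Longrightarrow> lsol (p i) (a i) (f i) D"
    "\<And>t. t \<in> D \<Longrightarrow> g (exp t) = \<Phi> (\<lambda>i. f i t)"
    using assms(1) unfolding rel_def by blast
  obtain t0 r where r: "r > 0" "ball t0 r \<subseteq> D" using D(1,2) open_contains_ball by blast
  \<comment> \<open>A ball inside \<open>D\<close> is used because \<open>D\<close> may be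
    disconnected, in which case the solutions need not extend compatibly from all of it.\<close>
  define B where "B = ball t0 r"
  have B: "open B" "B \<noteq> {}" "connected B" "B \<subseteq> C" "B \<subseteq> D" using r assms(2) by (auto simp: B_def)
  have "\<exists>h. lsol (p i) (a i) h C \<and> (\<forall>t\<in>B. h t = f i t)" if "i < N" for i
    using that B assms(3-5) by (intro lsol_extend lsol_subset[OF f(1)] coeff_holomorphic) auto
  then obtain h where h: "\<And>i. i < N \<Longrightarrow> lsol (p i) (a i) (h i) C" "\<And>i t. i < N \<Longrightarrow> t \<in> B \<Longrightarrow> h i t = f i t"
    by metis
  have "g (exp t) = \<Phi> (\<lambda>i. h i t)" if "t \<in> C" for t
  proof (rule analytic_continuation_open[of B C "\<lambda>t. g (exp t)" "\<lambda>t. \<Phi> (\<lambda>i. h i t)"])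
    show "(\<lambda>t. \<Phi> (\<lambda>i. h i t)) holomorphic_on C"
      using h(1) by (intro holomorphic_combinationD(1)[OF \<Phi>] lsol_holomorphic) blast
    fix s assume s: "s \<in> B"
    have "\<Phi> (\<lambda>i. f i s) = \<Phi> (\<lambda>i. h i s)"
      using h(2) s by (intro holomorphic_combinationD(2)[OF \<Phi>]) auto
    thus "g (exp s) = \<Phi> (\<lambda>i. h i s)" using f(2)[of s] s B by auto
  qed (use B assms that convex_connected[OF assms(4)] in auto)
  thus ?thesis using h(1) assms(2-5) B by (intro relI[where f = h]) auto
qed

text \<open>Only sets arbitrarily close to \<open>x\<close> are required, not sets over
  \<open>x\<close> itself, so that the notion makes sense when \<open>x\<close> lies under a point
  of \<open>S\<close>.\<close>

definition near :: "(complex \<Rightarrow> complex) \<Rightarrow> complex \<Rightarrow> bool"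
  where "near g x \<longleftrightarrow> (\<forall>W. open W \<and> x \<in> W \<longrightarrow> (\<exists>D. rel g D \<and> exp ` D \<subseteq> W))"

text \<open>In a small disc around a logarithm \<open>t\<close> of \<open>x0\<close> at most
  \<open>t\<close> itself is singular. A given and a target point of the punctured disc are joined
  inside a half disc with \<open>t\<close> on its border, which is convex and misses
  \<open>S\<close>, so the relation extends over it.\<close>

lemma rel_local:
  assumes V: "open V" "g holomorphic_on V" and x0: "x0 \<in> V" "x0 \<noteq> 0"
  shows "\<exists>T. open T \<and> x0 \<in> T \<and> (\<forall>x\<in>T. \<forall>y\<in>T. near g x \<longrightarrow> near g y)"
proof -
  define t where "t = Ln x0"
  have t: "exp t = x0" using x0 by (simp add: t_def)
  have "open (exp -` V :: complex set)" by (intro continuous_open_vimage continuous_intros V)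
  then obtain r1 where r1: "r1 > 0" "ball t r1 \<subseteq> exp -` V"
    using x0 t open_contains_ball by (metis vimageI)
  obtain r2 where r2: "r2 > 0" "(ball t r2 - {t}) \<inter> S = {}" using isolated by blast
  define r where "r = min r1 r2"
  have r: "r > 0" "ball t r \<subseteq> exp -` V" "(ball t r - {t}) \<inter> S = {}"
    using r1 r2 by (auto simp: r_def)
  define T where "T = (exp ` ball t r :: complex set)"
  have T: "open T" unfolding T_def by (intro open_exp_image open_ball)
  have ghol: "(\<lambda>t. g (exp t)) holomorphic_on ball t r"
    by (rule holomorphic_on_compose_gen[unfolded o_def, OF _ V(2)]) (use r in \<open>auto intro!: holomorphic_intros\<close>)
  have "\<exists>D. rel g D \<and> exp ` D \<subseteq> O'"
    if x: "x \<in> T" "near g x" and y: "y \<in> T" "open O'" "y \<in> O'" for x y O'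
  proof -
    obtain D where D: "rel g D" "exp ` D \<subseteq> T" using x T unfolding near_def by blast
    obtain u where u: "u \<in> D" using D(1) by (auto simp: rel_def)
    hence "exp u \<in> exp ` ball t r" using D(2) unfolding T_def by blast
    then obtain u0 where u0: "u0 \<in> ball t r" "exp u = exp u0" by blast
    obtain k :: int where k: "u0 + 2 * of_int k * of_real pi * \<i> = u" using exp_shift_into[OF u0(2)] by blast
    define D1 where "D1 = (\<lambda>t. t + 2 * of_int k * of_real pi * \<i>) -` D"
    have D1: "rel g D1" "u0 \<in> D1" unfolding D1_def using rel_shift[OF D(1)] k u by auto
    define D2 where "D2 = D1 \<inter> ball t r - {t}"
    have "open (D1 \<inter> ball t r)" using D1(1) by (auto simp: rel_def)
    moreover from this have "D2 \<noteq> {}"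
      unfolding D2_def using D1(2) u0(1) not_open_singleton[of t]
      by (metis Diff_eq_empty_iff IntI empty_iff subset_singletonD)
    ultimately have D2: "rel g D2" unfolding D2_def by (intro rel_subset[OF D1(1)]) (auto simp: open_delete)
    obtain u1 where u1: "u1 \<in> D2" using \<open>D2 \<noteq> {}\<close> by blast
    have "open (exp -` O' \<inter> ball t r)" by (intro open_Int continuous_open_vimage continuous_intros y(2) open_ball)
    moreover have "exp -` O' \<inter> ball t r \<noteq> {}" using y by (auto simp: T_def)
    moreover have nz: "u1 - t \<noteq> 0" using u1 by (auto simp: D2_def)
    ultimately have "\<exists>t2\<in>exp -` O' \<inter> ball t r. (t2 - t) / (u1 - t) \<notin> \<real>\<^sub>\<le>\<^sub>0"
      by (rule nonreal_point)
    then obtain t2 where t2: "t2 \<in> exp -` O' \<inter> ball t r" "(t2 - t) / (u1 - t) \<notin> \<real>\<^sub>\<le>\<^sub>0" by blast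
    from common_half_disc[OF nz t2(2)] obtain \<kappa> where \<kappa>: "\<kappa> \<bullet> (u1 - t) > 0" "\<kappa> \<bullet> (t2 - t) > 0" by blast
    define C where "C = ball t r \<inter> {z. \<kappa> \<bullet> z > \<kappa> \<bullet> t}"
    have C: "open C" "convex C" "u1 \<in> C" "t2 \<in> C" "C \<inter> S = {}"
      unfolding C_def using \<kappa> u1 t2 r(3)
      by (auto intro!: open_Int convex_Int simp: open_halfspace_gt convex_halfspace_gt inner_diff_right D2_def)
    have "rel g (D2 \<inter> C)"
      using D2 C u1 by (intro rel_subset[OF D2]) (auto simp: rel_def)
    hence "rel g C"
      by (rule rel_extend) (use C in \<open>auto intro!: holomorphic_on_subset[OF ghol] simp: C_def\<close>)
    moreover have "t2 \<in> C \<inter> exp -` O'" using C t2 by blast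
    ultimately have "rel g (C \<inter> exp -` O')"
      using open_Int[OF C(1) open_exp_vimage[OF y(2)]] by (rule_tac rel_subset[of g C]) blast+
    thus ?thesis by blast
  qed
  hence "near g y" if "x \<in> T" "near g x" "y \<in> T" for x y using that unfolding near_def[of g y] by blast
  moreover have "x0 \<in> T" unfolding T_def using r(1) t by (intro image_eqI[of _ _ t]) auto
  ultimately show ?thesis using T by blast
qed

lemma rel_move:
  assumes V: "open V" "connected V" "g holomorphic_on V" and D: "rel g D" "exp ` D \<subseteq> V"
    and O': "open O'" "O' \<noteq> {}" "O' \<subseteq> V"
  shows "\<exists>D'. rel g D' \<and> exp ` D' \<subseteq> O'"
proof -
  obtain t0 where t0: "t0 \<in> D" using D by (auto simp: rel_def)
  have Q: "near g (exp t0)"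
    unfolding near_def
  proof (intro allI impI)
    fix W :: "complex set" assume W: "open W \<and> exp t0 \<in> W"
    have "open (D \<inter> exp -` W)" using W D(1) by (intro open_Int open_exp_vimage) (auto simp: rel_def)
    moreover have "t0 \<in> D \<inter> exp -` W" using t0 W by simp
    ultimately have "rel g (D \<inter> exp -` W)" by (rule_tac rel_subset[OF D(1)]) blast+
    thus "\<exists>D. rel g D \<and> exp ` D \<subseteq> W" by blast
  qed
  have "O' \<noteq> {0}" using O'(1) not_open_singleton by blast
  then obtain b where b: "b \<in> O'" "b \<noteq> 0" using O'(2) by blast
  have "near g b"
  proof (rule connected_induction_simple[of "V - {0}" "exp t0" b "near g"])
    show "connected (V - {0})" using V by (intro connected_open_delete) auto
    fix x assume x: "x \<in> V - {0}"
    then obtain T where T: "open T" "x \<in> T" "\<forall>y\<in>T. \<forall>z\<in>T. near g y \<longrightarrow> near g z"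
      using rel_local[OF V(1,3), of x] by blast
    have "openin (top_of_set (V - {0})) ((V - {0}) \<inter> T)" using T(1) by (rule openin_open_Int)
    thus "\<exists>T. openin (top_of_set (V - {0})) T \<and> x \<in> T \<and> (\<forall>x\<in>T. \<forall>y\<in>T. near g x \<longrightarrow> near g y)"
      using T(2,3) x by blast
  qed (use Q t0 D b O' in auto)
  thus ?thesis using O' b unfolding near_def by blast
qed

text \<open>Runs backwards along the chain: the relation for the last function element is moved into
  the overlap, where it becomes a relation for the previous one.\<close>

lemma rel_continuation:
  assumes "analytic_continuation_of f U g V" "rel g D" "exp ` D \<subseteq> V"
    and O': "open O'" "O' \<noteq> {}" "O' \<subseteq> U"
  shows "\<exists>D'. rel f D' \<and> exp ` D' \<subseteq> O'"
  using assms(1-3)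
proof (induction arbitrary: D rule: analytic_continuation_of.induct)
  case refl
  thus ?case using O' by (intro rel_move[of U f D O']) (auto simp: function_element_def)
next
  case (step g V h W E D)
  have "\<exists>D'. rel h D' \<and> exp ` D' \<subseteq> E"
    using step by (intro rel_move[of W h D E]) (auto simp: function_element_def)
  then obtain D' where D': "rel h D'" "exp ` D' \<subseteq> E" by blast
  have "rel g D'" using D' step.hyps(6) by (intro rel_cong[OF D'(1)]) auto
  thus ?case using step.IH[of D'] D'(2) step.hyps(5) by blast
qed

lemma rel_shift_into:
  assumes "rel g D" "exp ` D \<subseteq> exp ` G" "open G"
  shows "\<exists>D'. rel g D' \<and> D' \<subseteq> G"
proof -
  obtain u where u: "u \<in> D" using assms by (auto simp: rel_def)
  then obtain u0 where u0: "u0 \<in> G" "exp u = exp u0" using assms(2) by (metis image_iff imageI subsetD)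
  obtain k :: int where k: "u0 + 2 * of_int k * of_real pi * \<i> = u" using exp_shift_into[OF u0(2)] by blast
  define D1 where "D1 = (\<lambda>t. t + 2 * of_int k * of_real pi * \<i>) -` D"
  have D1: "rel g D1" "u0 \<in> D1" unfolding D1_def using rel_shift[OF assms(1)] k u by auto
  have "rel g (D1 \<inter> G)"
    using D1 u0 assms(3) by (intro rel_subset[OF D1(1)]) (auto simp: rel_def)
  thus ?thesis by blast
qed

end

section \<open>Functional independence of the Apery function from hypergeometric functions\<close>

text \<open>The solutions of \<open>\<gamma> * exp (m * t) = 1\<close> differ by multiples of
  \<open>2 * pi * \<i> / m\<close>. In particular two of them on the same horizontal line
  coincide.\<close>

lemma hyp_singularities_separated:
  assumes "\<gamma> * exp (of_int m * s) = 1" "\<gamma> * exp (of_int m * t) = 1" "m \<noteq> 0"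
    and "\<bar>Im s - Im t\<bar> < 2 * pi / real_of_int \<bar>m\<bar>"
  shows "s = t"
proof -
  have "\<gamma> \<noteq> 0" using assms(1) by auto
  moreover have "\<gamma> * exp (of_int m * s) = \<gamma> * exp (of_int m * t)" using assms by simp
  ultimately have "exp (of_int m * s) = exp (of_int m * t)" by simp
  then obtain k :: int where k: "of_int m * s = of_int m * t + of_int (2 * k) * pi * \<i>"
    unfolding exp_eq by auto
  have "Im (of_int m * s) = Im (of_int m * t + of_int (2 * k) * pi * \<i>)" using k by (rule arg_cong)
  hence "of_int m * (Im s - Im t) = 2 * pi * of_int k" by (simp add: algebra_simps)
  hence "\<bar>of_int m\<bar> * \<bar>Im s - Im t\<bar> = 2 * pi * \<bar>of_int k\<bar>"
    by (metis abs_mult abs_of_pos mult_pos_pos pi_gt_zero zero_less_numeral)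
  moreover have "\<bar>of_int m\<bar> * \<bar>Im s - Im t\<bar> < 2 * pi"
    using assms(3,4) by (simp add: field_simps)
  ultimately have "2 * pi * \<bar>real_of_int k\<bar> < 2 * pi * 1" by simp
  hence "\<bar>real_of_int k\<bar> < 1" by (subst (asm) mult_less_cancel_left_pos) auto
  hence "k = 0" by linarith
  thus ?thesis using k assms(3) by simp
qed

text \<open>A disc of radius \<open>pi / \<bar>m\<bar>\<close> contains at most one singular point;
  if that point is not the centre, the radius is shrunk to its distance.\<close>

lemma hyp_singularities_isolated:
  fixes t :: complex
  assumes "m \<noteq> 0"
  shows "\<exists>r>0. (ball t r - {t}) \<inter> {t. \<gamma> * exp (of_int m * t) = 1} = {}"
proof (cases "\<exists>s. s \<in> ball t (pi / real_of_int \<bar>m\<bar>) - {t} \<and> \<gamma> * exp (of_int m * s) = 1")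
  case False
  thus ?thesis using assms by (intro exI[of _ "pi / real_of_int \<bar>m\<bar>"]) auto
next
  case True
  then obtain s where s: "dist t s < pi / real_of_int \<bar>m\<bar>" "s \<noteq> t" "\<gamma> * exp (of_int m * s) = 1" by auto
  have nos: "False" if u: "dist t u < dist t s" "\<gamma> * exp (of_int m * u) = 1" for u
  proof -
    have "\<bar>Im s - Im u\<bar> \<le> dist s u" using abs_Im_le_cmod[of "s - u"] by (simp add: dist_norm)
    also have "\<dots> \<le> dist t s + dist t u" by (metis dist_commute dist_triangle)
    also have "\<dots> < pi / real_of_int \<bar>m\<bar> + pi / real_of_int \<bar>m\<bar>" using s(1) u(1) by linarith
    also have "\<dots> = 2 * pi / real_of_int \<bar>m\<bar>" by simp
    finally have "s = u" by (rule hyp_singularities_separated[OF s(3) u(2) assms])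
    thus False using u by simp
  qed
  have "(ball t (dist t s) - {t}) \<inter> {t. \<gamma> * exp (of_int m * t) = 1} = {}"
  proof (rule equals0I)
    fix u assume "u \<in> (ball t (dist t s) - {t}) \<inter> {t. \<gamma> * exp (of_int m * t) = 1}"
    thus False using nos[of u] by simp
  qed
  thus ?thesis using s(2) by (intro exI[of _ "dist t s"]) simp
qed

lemma hyp_singularities_strip:
  assumes "m \<noteq> 0"
  shows "\<exists>r>0. strip r \<inter> {t. \<gamma> * exp (of_int m * t) = 1} = {}"
proof (cases "\<exists>s. s \<in> strip (2 * pi / real_of_int \<bar>m\<bar>) \<and> \<gamma> * exp (of_int m * s) = 1")
  case False
  thus ?thesis using assms by (intro exI[of _ "2 * pi / real_of_int \<bar>m\<bar>"]) auto
next
  case True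
  then obtain s where s: "0 < Im s" "Im s < 2 * pi / real_of_int \<bar>m\<bar>" "\<gamma> * exp (of_int m * s) = 1"
    by (auto simp: strip_def)
  have "False" if u: "0 < Im u" "Im u < Im s" "\<gamma> * exp (of_int m * u) = 1" for u
    using hyp_singularities_separated[OF s(3) u(3) assms] s u by auto
  thus ?thesis using s(1) by (intro exI[of _ "Im s"]) (auto simp: strip_def)
qed

lemma finite_common_radius:
  assumes "\<And>i. i < N \<Longrightarrow> \<exists>r>0::real. Q i r" "\<And>i r r'. Q i r \<Longrightarrow> r' \<le> r \<Longrightarrow> Q i r'"
  shows "\<exists>r>0. \<forall>i<(N::nat). Q i r"
  using assms(1)
proof (induction N)
  case (Suc N)
  then obtain r where r: "r > 0" "\<forall>i<N. Q i r" by auto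
  obtain r' where r': "r' > 0" "Q N r'" using Suc.prems by blast
  show ?case using r r' assms(2) by (intro exI[of _ "min r r'"]) (auto simp: less_Suc_eq)
qed (auto intro: exI[of _ 1])

lemma hyp_family_isolated:
  fixes \<gamma> :: "nat \<Rightarrow> complex" and m :: "nat \<Rightarrow> int"
  assumes "\<And>i. i < N \<Longrightarrow> m i \<noteq> 0"
  shows "\<exists>r>0. (ball t r - {t}) \<inter> {t. \<exists>i<N. \<gamma> i * exp (of_int (m i) * t) = 1} = {}"
proof -
  have "\<exists>r>0. \<forall>i<N. (ball t r - {t}) \<inter> {t. \<gamma> i * exp (of_int (m i) * t) = 1} = {}"
  proof (rule finite_common_radius)
    fix i assume "i < N"
    from hyp_singularities_isolated[OF assms[OF this]]
    show "\<exists>r>0. (ball t r - {t}) \<inter> {t. \<gamma> i * exp (of_int (m i) * t) = 1} = {}" .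
  next
    fix i :: nat and r r' :: real
    assume "(ball t r - {t}) \<inter> {t. \<gamma> i * exp (of_int (m i) * t) = 1} = {}" "r' \<le> r"
    thus "(ball t r' - {t}) \<inter> {t. \<gamma> i * exp (of_int (m i) * t) = 1} = {}"
      using subset_ball[of r' r t] by blast
  qed
  then obtain r where r: "r > 0" "\<forall>i<N. (ball t r - {t}) \<inter> {t. \<gamma> i * exp (of_int (m i) * t) = 1} = {}" by blast
  have "(ball t r - {t}) \<inter> {t. \<exists>i<N. \<gamma> i * exp (of_int (m i) * t) = 1} = {}"
  proof (rule equals0I)
    fix u assume "u \<in> (ball t r - {t}) \<inter> {t. \<exists>i<N. \<gamma> i * exp (of_int (m i) * t) = 1}"
    thus False using r(2) by blast
  qed
  thus ?thesis using r(1) by blast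
qed

lemma hyp_family_strip:
  fixes \<gamma> :: "nat \<Rightarrow> complex" and m :: "nat \<Rightarrow> int"
  assumes "\<And>i. i < N \<Longrightarrow> m i \<noteq> 0"
  shows "\<exists>r>0. strip r \<inter> {t. \<exists>i<N. \<gamma> i * exp (of_int (m i) * t) = 1} = {}"
proof -
  have "\<exists>r>0. \<forall>i<N. strip r \<inter> {t. \<gamma> i * exp (of_int (m i) * t) = 1} = {}"
  proof (rule finite_common_radius)
    fix i assume "i < N"
    from hyp_singularities_strip[OF assms[OF this]]
    show "\<exists>r>0. strip r \<inter> {t. \<gamma> i * exp (of_int (m i) * t) = 1} = {}" .
  next
    fix i :: nat and r r' :: real
    assume "strip r \<inter> {t. \<gamma> i * exp (of_int (m i) * t) = 1} = {}" "r' \<le> r"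
    moreover from this(2) have "strip r' \<subseteq> strip r" by (auto simp: strip_def)
    ultimately show "strip r' \<inter> {t. \<gamma> i * exp (of_int (m i) * t) = 1} = {}" by blast
  qed
  then obtain r where r: "r > 0" "\<forall>i<N. strip r \<inter> {t. \<gamma> i * exp (of_int (m i) * t) = 1} = {}" by blast
  have "strip r \<inter> {t. \<exists>i<N. \<gamma> i * exp (of_int (m i) * t) = 1} = {}"
  proof (rule equals0I)
    fix u assume "u \<in> strip r \<inter> {t. \<exists>i<N. \<gamma> i * exp (of_int (m i) * t) = 1}"
    thus False using r(2) by blast
  qed
  thus ?thesis using r(1) by blast
qed

text \<open>Logarithmic derivative of \<open>(1 - exp (t - c))^(-1/2)\<close>. Taken for
  \<open>c = L\<close> and \<open>c = -L\<close> separately, these factors of the inverse square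
  root of \<open>apery_P\<close> satisfy first-order equations, each regular at the other
  point.\<close>

definition inv_sqrt_coeff :: "real \<Rightarrow> complex \<Rightarrow> complex"
  where "inv_sqrt_coeff c t = exp (t - of_real c) / (2 * (1 - exp (t - of_real c)))"

lemma inv_sqrt_lsol:
  assumes "e \<le> 3"
  shows "lsol 1 (\<lambda>j. inv_sqrt_coeff c) (\<lambda>t. 1 / csqrt (1 - exp (t - of_real c))) (strip e)"
proof -
  have nr: "1 - exp (t - of_real c) \<notin> \<real>\<^sub>\<le>\<^sub>0" if "t \<in> strip e" for t
  proof -
    have "0 < Im t" "Im t < pi" using that assms pi_gt3 by (auto simp: strip_def)
    hence "sin (Im t) > 0" by (rule sin_gt_zero)
    hence "Im (1 - exp (t - of_real c)) \<noteq> 0" by (simp add: Im_exp)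
    thus ?thesis using complex_nonpos_Reals_iff by blast
  qed
  have der: "((\<lambda>t. 1 / csqrt (1 - exp (t - of_real c))) has_field_derivative
      inv_sqrt_coeff c t * (1 / csqrt (1 - exp (t - of_real c)))) (at t)" if t: "t \<in> strip e" for t
  proof -
    define z where "z = 1 - exp (t - of_real c)"
    have z: "z \<notin> \<real>\<^sub>\<le>\<^sub>0" "z \<noteq> 0" "csqrt z \<noteq> 0" using nr[OF t] by (auto simp: z_def)
    have "((\<lambda>t. 1 - exp (t - of_real c)) has_field_derivative - exp (t - of_real c)) (at t)"
      by (auto intro!: derivative_eq_intros)
    from DERIV_chain2[OF has_field_derivative_csqrt[OF nr[OF t]] this]
    have "((\<lambda>t. csqrt (1 - exp (t - of_real c))) has_field_derivative inverse (2 * csqrt z) * - exp (t - of_real c)) (at t)"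
      by (simp add: z_def)
    from DERIV_inverse_fun[OF this] z(3)
    have "((\<lambda>t. inverse (csqrt (1 - exp (t - of_real c)))) has_field_derivative
        - (inverse (2 * csqrt z) * - exp (t - of_real c) * inverse ((csqrt z)^2))) (at t)"
      by (simp add: z_def numeral_2_eq_2)
    moreover have "- (inverse (2 * csqrt z) * - exp (t - of_real c) * inverse ((csqrt z)^2))
      = inv_sqrt_coeff c t * (1 / csqrt (1 - exp (t - of_real c)))"
      using z by (simp add: inv_sqrt_coeff_def z_def[symmetric] field_simps)
    ultimately show ?thesis by (simp only: inverse_eq_divide)
  qed
  have "(\<lambda>t. 1 / csqrt (1 - exp (t - of_real c))) holomorphic_on strip e"
    unfolding holomorphic_on_open[OF open_strip] by (intro ballI exI) (rule der)
  thus ?thesis using DERIV_imp_deriv[OF der] by (simp add: lsol_def)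
qed

lemma apery_P_factors: "(1 - exp (t - of_real apery_L)) * (1 - exp (t - of_real (- apery_L))) = apery_P t"
proof -
  have "exp (complex_of_real apery_L) * exp (of_real (- apery_L)) = 1" by (simp flip: exp_add)
  hence "apery_P t = (exp t * exp (of_real (- apery_L)) - 1) * (exp t * exp (of_real apery_L) - 1)"
    unfolding apery_P_roots by (simp add: algebra_simps)
  moreover have "exp (t - of_real apery_L) = exp t * exp (of_real (- apery_L))"
    "exp (t - of_real (- apery_L)) = exp t * exp (of_real apery_L)"
    by (simp_all flip: exp_add)
  moreover have "(1 - X) * (1 - Y) = (X - 1) * (Y - 1)" for X Y :: complex
    by (simp add: algebra_simps)
  ultimately show ?thesis by (simp only:)
qed

lemma holomorphic_inv_sqrt_coeff:
  assumes "\<And>t. t \<in> A \<Longrightarrow> exp t \<noteq> exp (of_real c)"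
  shows "inv_sqrt_coeff c holomorphic_on A"
proof -
  have "exp (t - of_real c) \<noteq> 1" if "t \<in> A" for t using assms[OF that] by (simp add: exp_diff)
  thus ?thesis unfolding inv_sqrt_coeff_def[abs_def] by (intro holomorphic_intros) auto
qed

lemma xi_fps_square: "xi_fps ^ 2 = fps_X ^ 2 * (fps_X ^ 2 - 34 * fps_X + 1) * apery_fps ^ 2"
proof -
  have "apery_sqrt_fps ^ 2 = fps_X ^ 2 - 34 * fps_X + 1" using apery_sqrt_fps_unique by blast
  thus ?thesis by (simp add: xi_fps_def power_mult_distrib mult_ac)
qed

lemma eval_xi_square:
  assumes "norm (exp t) < fps_conv_radius xi_fps" "t \<in> left_half"
  shows "eval_fps xi_fps (exp t) ^ 2 = exp t ^ 2 * apery_P t * apery_fun t ^ 2"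
proof -
  define x where "x = exp t"
  have r: "norm x < fps_conv_radius xi_fps" "norm x < fps_conv_radius apery_fps"
    using assms left_half_radius by (simp_all add: x_def)
  have num: "norm x < fps_conv_radius (numeral k :: complex fps)" "norm x < fps_conv_radius (fps_X :: complex fps)"
    "norm x < fps_conv_radius (1 :: complex fps)" for k by simp_all
  note cl = fps_conv_radius_closure[of x] and ev = eval_fps_add[of x] eval_fps_diff[of x] eval_fps_mult[of x]
  have "eval_fps (xi_fps * xi_fps) x = eval_fps (fps_X * fps_X * (fps_X * fps_X - 34 * fps_X + 1) * (apery_fps * apery_fps)) x"
    using xi_fps_square by (simp add: power2_eq_square)
  hence "eval_fps xi_fps x * eval_fps xi_fps x = x * x * (x * x - 34 * x + 1) * (eval_fps apery_fps x * eval_fps apery_fps x)"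
    by (simp add: ev cl r num)
  thus ?thesis by (simp add: apery_P_def apery_fun_def x_def power2_eq_square)
qed

text \<open>Makes it unnecessary to follow the sign of the square root: some constant, 1 or -1, on
  some smaller open set is enough.\<close>

lemma holomorphic_square_eq:
  fixes u v :: "complex \<Rightarrow> complex"
  assumes "u holomorphic_on D" "v holomorphic_on D" "open D" "D \<noteq> {}" "\<And>t. t \<in> D \<Longrightarrow> u t ^ 2 = v t ^ 2"
  shows "\<exists>\<sigma> B. open B \<and> B \<noteq> {} \<and> B \<subseteq> D \<and> (\<forall>t\<in>B. v t = \<sigma> * u t)"
proof (cases "\<forall>t\<in>D. u t = v t")
  case True
  thus ?thesis using assms(3,4) by (intro exI[of _ 1] exI[of _ D]) auto
next
  case False
  define B where "B = {t \<in> D. u t - v t \<noteq> 0}"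
  have "continuous_on D (\<lambda>t. u t - v t)"
    by (intro holomorphic_on_imp_continuous_on holomorphic_intros assms)
  hence "open B" unfolding B_def
    using continuous_open_preimage[of D "\<lambda>t. u t - v t" "- {0}"] assms(3)
    by (auto simp: vimage_def Int_def conj_commute)
  moreover have "v t = - 1 * u t" if "t \<in> B" for t
    using that assms(5)[of t] by (auto simp: B_def power2_eq_iff)
  moreover have "B \<noteq> {}" "B \<subseteq> D" using False by (auto simp: B_def)
  ultimately show ?thesis by (intro exI[of _ "-1"] exI[of _ B] conjI ballI)
qed

text \<open>The identity for \<open>\<xi>\<close> is solved for \<open>\<alpha>\<close>: up to sign,
  \<open>\<alpha>\<close> is a holomorphic combination of the given solutions and the two inverse
  square roots. Each of these is regular at \<open>-L\<close> or at \<open>L\<close>, so the turns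
  commute on \<open>\<alpha>\<close>, which has been excluded.\<close>

lemma apery_not_hypergeometric_local:
  fixes N :: nat and p :: "nat \<Rightarrow> nat" and as bs :: "nat \<Rightarrow> complex list" and \<gamma> :: "nat \<Rightarrow> complex" and m :: "nat \<Rightarrow> int"
  defines "S \<equiv> {t. \<exists>i<N. \<gamma> i * exp (of_int (m i) * t) = 1}"
  assumes e: "0 < e" "e \<le> 3" "strip e \<inter> S = {}"
    and m: "\<And>i. i < N \<Longrightarrow> m i \<noteq> 0"
    and D: "open D" "D \<noteq> {}" "D \<subseteq> strip e \<inter> left_half"
    and \<Phi>: "holomorphic_combination N (\<lambda>_. \<Phi>)"
    and f: "\<And>i. i < N \<Longrightarrow> lsol (p i) (hyp_coeff (p i) (as i) (bs i) (\<gamma> i) (m i)) (f i) D"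
    and r: "\<And>t. t \<in> D \<Longrightarrow> norm (exp t) < fps_conv_radius xi_fps"
    and eq: "\<And>t. t \<in> D \<Longrightarrow> eval_fps xi_fps (exp t) = \<Phi> (\<lambda>i. f i t)"
  shows False
proof -
  define a where "a = (\<lambda>i. hyp_coeff (p i) (as i) (bs i) (\<gamma> i) (m i))"
  have a_hol: "a i j holomorphic_on A" if "i < N" "\<And>t. t \<in> A \<Longrightarrow> \<gamma> i * exp (of_int (m i) * t) \<noteq> 1" for i j A
    unfolding a_def by (rule holomorphic_hyp_coeff) (rule that(2))
  have strip_reg: "\<gamma> i * exp (of_int (m i) * t) \<noteq> 1" if "i < N" "t \<in> strip e" for i t
    using that e(3) by (auto simp: S_def)
  have "\<exists>h. lsol (p i) (a i) h (strip e) \<and> (\<forall>t\<in>B. h t = f i t)" if "i < N" "B \<subseteq> D" "open B" "connected B" "B \<noteq> {}" for i B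
    using that D(3) a_hol[OF that(1) strip_reg[OF that(1)]] f[OF that(1)]
    by (intro lsol_extend open_strip convex_strip) (auto simp: a_def intro: lsol_subset)
  moreover obtain t0 r0 where r0: "r0 > 0" "ball t0 r0 \<subseteq> D" using D(1,2) open_contains_ball by blast
  ultimately have "\<exists>h. lsol (p i) (a i) h (strip e) \<and> (\<forall>t\<in>ball t0 r0. h t = f i t)" if "i < N" for i
    using that by simp
  then obtain h where h: "\<And>i. i < N \<Longrightarrow> lsol (p i) (a i) (h i) (strip e)"
    "\<And>i t. i < N \<Longrightarrow> t \<in> ball t0 r0 \<Longrightarrow> h i t = f i t" by metis
  define s1 where "s1 = (\<lambda>c t. 1 / csqrt (1 - exp (t - of_real c)))"
  have s1: "lsol 1 (\<lambda>j. inv_sqrt_coeff c) (s1 c) (strip e)" for c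
    using inv_sqrt_lsol[OF e(2)] unfolding s1_def .
  define B0 where "B0 = ball t0 r0"
  have B0: "open B0" "B0 \<noteq> {}" "B0 \<subseteq> D" using r0 by (auto simp: B0_def)
  have B0s: "B0 \<subseteq> strip e" "B0 \<subseteq> left_half" using B0 D by auto
  \<comment> \<open>The identity divided by \<open>x * sqrt P\<close>; it agrees with
    \<open>apery_fun\<close> near \<open>t0\<close> only up to sign, as the branches of the roots
    were chosen by \<open>csqrt\<close>.\<close>
  define u where "u = (\<lambda>t. exp (- t) * s1 (- apery_L) t * s1 apery_L t * \<Phi> (\<lambda>i. h i t))"
  have u_hol: "u holomorphic_on strip e"
    unfolding u_def by (intro holomorphic_intros holomorphic_combinationD(1)[OF \<Phi>] lsol_holomorphic[OF s1] lsol_holomorphic[OF h(1)])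
  have sq: "u t ^ 2 = apery_fun t ^ 2" if t: "t \<in> B0" for t
  proof -
    have P: "apery_P t \<noteq> 0" using t B0s e apery_P_nonzero_strip by blast
    have "\<Phi> (\<lambda>i. h i t) = \<Phi> (\<lambda>i. f i t)"
      using h(2) t by (intro holomorphic_combinationD(2)[OF \<Phi>]) (auto simp: B0_def)
    hence "\<Phi> (\<lambda>i. h i t) ^ 2 = exp t ^ 2 * apery_P t * apery_fun t ^ 2"
    proof -
      have tD: "t \<in> D" "t \<in> left_half" using t B0 B0s by auto
      show "\<Phi> (\<lambda>i. h i t) = \<Phi> (\<lambda>i. f i t) \<Longrightarrow> ?thesis"
        using eq[OF tD(1)] eval_xi_square[OF r[OF tD(1)] tD(2)] by simp
    qed
    moreover have "(s1 (- apery_L) t * s1 apery_L t) ^ 2 = 1 / apery_P t"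
    proof -
      have "(1 / csqrt x * (1 / csqrt y)) ^ 2 = 1 / (y * x)" for x y
        by (simp add: power_mult_distrib power_divide)
      thus ?thesis unfolding s1_def apery_P_factors[symmetric] by blast
    qed
    moreover have "u t ^ 2 = exp (- t) ^ 2 * (s1 (- apery_L) t * s1 apery_L t) ^ 2 * \<Phi> (\<lambda>i. h i t) ^ 2"
      by (simp add: u_def power_mult_distrib)
    ultimately show ?thesis using P by (simp add: exp_minus field_simps)
  qed
  have "u holomorphic_on B0" "apery_fun holomorphic_on B0"
    using B0s by (auto intro: holomorphic_on_subset[OF u_hol] holomorphic_on_subset[OF holomorphic_apery_fun])
  from holomorphic_square_eq[OF this B0(1,2) sq] obtain \<sigma> B where
    B: "open B" "B \<noteq> {}" "B \<subseteq> B0" "\<And>t. t \<in> B \<Longrightarrow> apery_fun t = \<sigma> * u t" by blast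
  \<comment> \<open>The two additional indices \<open>N\<close> and \<open>N + 1\<close> carry the
    inverse square roots for \<open>-L\<close> and \<open>L\<close>.\<close>
  define n where "n = N + 2"
  define p' where "p' = (\<lambda>i. if i < N then p i else 1)"
  define a' where "a' = (\<lambda>i. if i < N then a i else if i = N then (\<lambda>j. inv_sqrt_coeff (- apery_L)) else (\<lambda>j. inv_sqrt_coeff apery_L))"
  define f' where "f' = (\<lambda>i. if i < N then h i else if i = N then s1 (- apery_L) else s1 apery_L)"
  define \<Psi> where "\<Psi> = (\<lambda>t v. \<sigma> * (exp (- t) * v N * v (N + 1) * \<Phi> v))"
  have \<Psi>: "holomorphic_combination n \<Psi>"
    unfolding holomorphic_combination_def
  proof (intro conjI allI impI)
    fix A and g :: "nat \<Rightarrow> complex \<Rightarrow> complex" assume "\<forall>i<n. g i holomorphic_on A"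
    thus "(\<lambda>t. \<Psi> t (\<lambda>i. g i t)) holomorphic_on A"
      unfolding \<Psi>_def by (intro holomorphic_intros holomorphic_combinationD(1)[OF \<Phi>]) (auto simp: n_def)
  next
    fix t and v w :: "nat \<Rightarrow> complex" assume vw: "\<forall>i<n. v i = w i"
    hence "\<Phi> v = \<Phi> w" by (intro holomorphic_combinationD(2)[OF \<Phi>]) (auto simp: n_def)
    thus "\<Psi> t v = \<Psi> t w" using vw by (simp add: \<Psi>_def n_def)
  qed
  define y where "y = (\<lambda>t. \<Psi> t (\<lambda>i. f' i t))"
  have yu: "y t = \<sigma> * u t" for t
  proof -
    have "\<Phi> (\<lambda>i. f' i t) = \<Phi> (\<lambda>i. h i t)"
      by (intro holomorphic_combinationD(2)[OF \<Phi>]) (simp add: f'_def)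
    thus ?thesis by (simp add: y_def \<Psi>_def u_def f'_def)
  qed
  have y_hol: "y holomorphic_on strip e" unfolding yu[abs_def] by (intro holomorphic_intros u_hol)
  have "Complex (- apery_L - 1) (e / 2) \<in> left_half \<inter> strip e" using e by (simp add: left_half_def strip_def)
  hence "left_half \<inter> strip e \<noteq> {}" by blast
  from lsol_continue[OF apery_sol_apery_fun open_left_half convex_left_half open_strip convex_strip this
      holomorphic_apery_coeff[OF apery_P_nonzero_strip[OF _ e(2)]]]
  obtain z where z: "apery_sol z (strip e)" "\<And>t. t \<in> left_half \<inter> strip e \<Longrightarrow> apery_fun t = z t" by blast
  have yz: "z t = y t" if "t \<in> strip e" for t
  proof (rule analytic_continuation_open[of B "strip e" z y])
    fix t assume t: "t \<in> B"
    hence "t \<in> left_half \<inter> strip e" using B(3) B0s by blast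
    from z(2)[OF this] B(4)[OF t] show "z t = y t" by (simp add: yu)
  qed (use B B0s that open_strip convex_connected[OF convex_strip] lsol_holomorphic[OF z(1)] y_hol in auto)
  have y: "apery_sol y (strip e)" by (rule lsol_cong[OF z(1) open_strip yz])
  obtain d where d: "0 < d" "d \<le> 1" "d \<le> e"
    "(ball (of_real (- apery_L)) d - {of_real (- apery_L)}) \<inter> S = {}"
    "(ball (of_real apery_L) d - {of_real apery_L}) \<inter> S = {}"
  proof -
    have "\<exists>r>0. (ball t r - {t}) \<inter> S = {}" for t unfolding S_def by (rule hyp_family_isolated[OF m])
    then obtain r1 r2 where "r1 > 0" "(ball (of_real (- apery_L)) r1 - {of_real (- apery_L)}) \<inter> S = {}"
      "r2 > 0" "(ball (of_real apery_L) r2 - {of_real apery_L}) \<inter> S = {}" by metis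
    thus ?thesis using e(1) by (intro that[of "min (min 1 e) (min r1 r2)"]) auto
  qed
  have reg: "\<gamma> i * exp (of_int (m i) * t) \<noteq> 1"
    if "i < N" "t \<in> ball (of_real c) d" "t \<noteq> of_real c" "apery_point c" for i t c
    using that d(4,5) by (auto simp: S_def apery_point_def)
  have Pnz: "apery_P t \<noteq> 0" if "t \<in> strip e \<union> (ball (of_real c) d - {of_real c})" "apery_point c" for t c
    using that d(2) e apery_P_nonzero_strip apery_P_nonzero_ball[of c t] by auto
  have exp_ne: "exp t \<noteq> exp (of_real c')" if "apery_P t \<noteq> 0" "apery_point c'" for t c'
    using that by (auto simp: apery_point_def apery_P_roots)
  have pts: "apery_point (- apery_L)" "apery_point apery_L" by (auto simp: apery_point_def)
  have hol': "a' i j holomorphic_on (strip e \<union> (ball (of_real c) d - {of_real c}))"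
    if "i < n" "apery_point c" for i j c
  proof (cases "i < N")
    case True
    have "\<gamma> i * exp (of_int (m i) * t) \<noteq> 1" if "t \<in> strip e \<union> (ball (of_real c) d - {of_real c})" for t
      using that strip_reg[OF True] reg[OF True _ _ \<open>apery_point c\<close>] by blast
    hence "a i j holomorphic_on (strip e \<union> (ball (of_real c) d - {of_real c}))" by (rule a_hol[OF True])
    thus ?thesis using True by (simp add: a'_def)
  next
    case False
    have "inv_sqrt_coeff c' holomorphic_on (strip e \<union> (ball (of_real c) d - {of_real c}))" if "apery_point c'" for c'
      using Pnz exp_ne that \<open>apery_point c\<close> by (intro holomorphic_inv_sqrt_coeff) blast
    thus ?thesis using False pts by (simp add: a'_def)
  qed
  have far: "exp t \<noteq> exp (of_real (- c))" if "t \<in> ball (of_real c) d" "apery_point c" for t :: complex and c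
  proof
    assume "exp t = exp (of_real (- c))"
    from arg_cong[OF this, of norm] have "exp (Re t) = exp (- c)"
      by (simp only: norm_exp_eq_Re Re_complex_of_real)
    hence "Re t = - c" by simp
    moreover have "\<bar>Re t - c\<bar> < 1"
      using that(1) d(2) abs_Re_le_cmod[of "t - of_real c"] by (simp add: dist_norm norm_minus_commute)
    ultimately show False using that(2) apery_L_gt_1 by (auto simp: apery_point_def)
  qed
  have triv: "(\<forall>j<p' i. a' i j holomorphic_on (strip e \<union> ball (of_real (- apery_L)) d)) \<or>
     (\<forall>j<p' i. a' i j holomorphic_on (strip e \<union> ball (of_real apery_L) d))" if i: "i < n" for i
  proof (cases "i < N")
    case True
    have "\<gamma> i * exp (of_int (m i) * of_real (- apery_L)) \<noteq> 1 \<or> \<gamma> i * exp (of_int (m i) * of_real apery_L) \<noteq> 1"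
    proof (rule ccontr)
      assume "\<not> ?thesis"
      hence "\<gamma> i * exp (of_int (m i) * of_real (- apery_L)) = 1" "\<gamma> i * exp (of_int (m i) * of_real apery_L) = 1" by auto
      hence "complex_of_real (- apery_L) = of_real apery_L"
        by (rule hyp_singularities_separated[OF _ _ m[OF True]]) (use m[OF True] in simp)
      hence "- apery_L = apery_L" by (simp only: of_real_eq_iff)
      thus False using apery_L_gt_1 by simp
    qed
    moreover have "a' i j holomorphic_on (strip e \<union> ball (of_real c) d)"
      if "\<gamma> i * exp (of_int (m i) * of_real c) \<noteq> 1" "apery_point c" for j c
    proof -
      have "\<gamma> i * exp (of_int (m i) * t) \<noteq> 1" if "t \<in> strip e \<union> ball (of_real c) d" for t
      proof (cases "t = of_real c")
        case False
        thus ?thesis using that strip_reg[OF True] reg[OF True _ _ \<open>apery_point c\<close>] by blast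
      qed (use \<open>\<gamma> i * exp (of_int (m i) * of_real c) \<noteq> 1\<close> in simp)
      hence "a i j holomorphic_on (strip e \<union> ball (of_real c) d)" by (rule a_hol[OF True])
      thus ?thesis using True by (simp add: a'_def)
    qed
    ultimately show ?thesis using pts by blast
  next
    case False
    have "inv_sqrt_coeff (- c) holomorphic_on (strip e \<union> ball (of_real c) d)" if "apery_point c" for c
    proof (rule holomorphic_inv_sqrt_coeff)
      fix t assume "t \<in> strip e \<union> ball (of_real c) d"
      moreover have "apery_point (- c)" using that by (auto simp: apery_point_def)
      ultimately show "exp t \<noteq> exp (of_real (- c))"
        using far that exp_ne apery_P_nonzero_strip e by blast
    qed
    from this[OF pts(1)] this[OF pts(2)] show ?thesis using False by (simp add: a'_def)
  qed
  have "\<exists>y1 y2 y12. turn e d (- apery_L) y y1 \<and> turn e d apery_L y y2 \<and>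
     turn e d apery_L y1 y12 \<and> turn e d (- apery_L) y2 y12"
    unfolding y_def
  proof (rule turns_commute[OF \<Psi> d(1,3), where p = p' and a = a'])
    show "lsol (p' i) (a' i) (f' i) (strip e)" if "i < n" for i
      using h(1)[of i] s1 by (simp add: p'_def a'_def f'_def)
  qed (use hol' pts triv in blast)+
  then obtain y1 y2 y12 where "turn e d (- apery_L) y y1" "turn e d apery_L y y2"
    "turn e d apery_L y1 y12" "turn e d (- apery_L) y2 y12" by blast
  from apery_turns_do_not_commute[OF d(1-3) e(2) y this holomorphic_apery_fun _ apery_fun_real apery_J_apery_fun]
  show False using yz z(2) by auto
qed

section \<open>From an identity on an arbitrary branch to one on the strip near the origin\<close>

lemma eval_mpoly_combination:
  assumes "P \<in> Qbar_mpoly N"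
  shows "holomorphic_combination N (\<lambda>_. eval_mpoly P)"
  unfolding holomorphic_combination_def
proof (intro conjI allI impI)
  have keys: "i < N" if "e \<in> Poly_Mapping.keys P" "i \<in> Poly_Mapping.keys e" for e i
    using assms that unfolding Qbar_mpoly_def by blast
  {
    fix A and h :: "nat \<Rightarrow> complex \<Rightarrow> complex" assume "\<forall>i<N. h i holomorphic_on A"
    thus "(\<lambda>t. eval_mpoly P (\<lambda>i. h i t)) holomorphic_on A"
      unfolding eval_mpoly_def using keys by (intro holomorphic_intros) auto
  next
    fix v w :: "nat \<Rightarrow> complex" assume "\<forall>i<N. v i = w i"
    thus "eval_mpoly P v = eval_mpoly P w"
      unfolding eval_mpoly_def using keys by (intro sum.cong prod.cong arg_cong2[where f = "(*)"]) auto
  }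
qed

lemma xi_not_hypergeometric:
  assumes \<xi>: "fps_branch xi_fps \<xi> U" and f: "\<And>i. i < N \<Longrightarrow> admissible_branch (f i) U"
    and P: "P \<in> Qbar_mpoly N" and eq: "\<And>x. x \<in> U \<Longrightarrow> \<xi> x = eval_mpoly P (\<lambda>i. f i x)"
  shows False
proof -
  \<comment> \<open>Bundles the parameters of one function into a tuple, so that they can be chosen
    for all indices at once.\<close>
  define R :: "nat \<Rightarrow> nat \<times> complex list \<times> complex list \<times> complex \<times> int \<Rightarrow> bool" where
    "R = (\<lambda>i (p, as, bs, \<gamma>, m). m \<noteq> 0 \<and>
    lsol p (hyp_coeff p as bs \<gamma> m) (\<lambda>t. f i (exp t)) {t. exp t \<in> U \<and> \<gamma> * exp (of_int m * t) \<noteq> 1})"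
  have ex: "\<exists>q. R i q" if "i < N" for i
  proof (rule admissible_branch_lsol[OF f[OF that]])
    fix p as bs \<gamma> m
    assume "m \<noteq> (0::int)" "lsol p (hyp_coeff p as bs \<gamma> m) (\<lambda>t. f i (exp t)) {t. exp t \<in> U \<and> \<gamma> * exp (of_int m * t) \<noteq> 1}"
    thus "\<exists>q. R i q" by (intro exI[of _ "(p, as, bs, \<gamma>, m)"]) (simp add: R_def)
  qed
  define q where "q = (\<lambda>i. SOME q. R i q)"
  have q: "R i (q i)" if "i < N" for i
    unfolding q_def by (rule someI_ex[OF ex[OF that]])
  define p where "p = (\<lambda>i. fst (q i))"
  define as where "as = (\<lambda>i. fst (snd (q i)))"
  define bs where "bs = (\<lambda>i. fst (snd (snd (q i))))"
  define \<gamma> where "\<gamma> = (\<lambda>i. fst (snd (snd (snd (q i)))))"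
  define m where "m = (\<lambda>i. snd (snd (snd (snd (q i)))))"
  have m: "m i \<noteq> 0" and fl: "lsol (p i) (hyp_coeff (p i) (as i) (bs i) (\<gamma> i) (m i)) (\<lambda>t. f i (exp t))
      {t. exp t \<in> U \<and> \<gamma> i * exp (of_int (m i) * t) \<noteq> 1}" if "i < N" for i
    using q[OF that] by (simp_all add: R_def p_def as_def bs_def \<gamma>_def m_def case_prod_beta)
  define a where "a = (\<lambda>i. hyp_coeff (p i) (as i) (bs i) (\<gamma> i) (m i))"
  define S where "S = {t. \<exists>i<N. \<gamma> i * exp (of_int (m i) * t) = 1}"
  interpret periodic_family N p a S "eval_mpoly P"
  proof
    show "a i j holomorphic_on A" if "i < N" "A \<inter> S = {}" for i j A
      unfolding a_def using that by (intro holomorphic_hyp_coeff) (auto simp: S_def)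
    show "\<exists>r>0. (ball t r - {t}) \<inter> S = {}" for t unfolding S_def by (rule hyp_family_isolated[OF m])
    show "t + 2 * of_int k * of_real pi * \<i> \<in> S \<longleftrightarrow> t \<in> S" for t k
      by (simp add: S_def exp_of_int_period)
    show "a i j (t + 2 * of_int k * of_real pi * \<i>) = a i j t" for i j t k
      by (simp add: a_def hyp_coeff_periodic)
    show "holomorphic_combination N (\<lambda>_. eval_mpoly P)" by (rule eval_mpoly_combination[OF P])
  qed
  have cont: "analytic_continuation_of (eval_fps xi_fps) (eball 0 (fps_conv_radius xi_fps)) \<xi> U"
    using \<xi> by (simp add: fps_branch_def)
  have U: "open U" "U \<noteq> {}" using analytic_continuation_of_function_element[OF cont]
    by (auto simp: function_element_def)
  \<comment> \<open>Here the given branches, composed with \<open>exp\<close>, are themselves the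
    required solutions; this starts the transport.\<close>
  define D where "D = {t. exp t \<in> U} - S"
  have "open D"
  proof -
    have "D = (exp -` U) \<inter> (\<Inter>i\<in>{..<N}. {t. \<gamma> i * exp (of_int (m i) * t) \<noteq> 1})"
      by (auto simp: D_def S_def)
    moreover have "open {t. \<gamma> i * exp (of_int (m i) * t) \<noteq> 1}" for i
      by (intro open_Collect_neq continuous_intros)
    ultimately show ?thesis by (auto intro!: open_Int open_INT open_exp_vimage U)
  qed
  have "D \<noteq> {}"
  proof -
    have "U \<noteq> {0}" using U(1) not_open_singleton by blast
    then obtain x where x: "x \<in> U" "x \<noteq> 0" using U(2) by blast
    define t where "t = Ln x"
    have t: "t \<in> exp -` U" using x by (simp add: t_def)
    obtain r1 where r1: "r1 > 0" "ball t r1 \<subseteq> exp -` U"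
      using t open_exp_vimage[OF U(1)] open_contains_ball by blast
    obtain r2 where r2: "r2 > 0" "(ball t r2 - {t}) \<inter> S = {}" using isolated by blast
    define s where "s = t + of_real (min r1 r2 / 2)"
    have "s \<in> ball t r1" "s \<in> ball t r2 - {t}" using r1 r2 by (auto simp: s_def dist_norm)
    hence "s \<in> D" using r1 r2 by (auto simp: D_def)
    thus ?thesis by blast
  qed
  have "rel \<xi> D"
  proof (rule relI[where f = "\<lambda>i t. f i (exp t)"])
    show "lsol (p i) (a i) (\<lambda>t. f i (exp t)) D" if "i < N" for i
      unfolding a_def using that by (intro lsol_subset[OF fl]) (auto simp: D_def S_def)
  qed (use \<open>open D\<close> \<open>D \<noteq> {}\<close> eq in \<open>auto simp: D_def\<close>)
  obtain e where e: "0 < e" "e \<le> 3" "strip e \<inter> S = {}"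
  proof -
    have "\<exists>r>0. strip r \<inter> S = {}" unfolding S_def by (rule hyp_family_strip[OF m])
    then obtain r where "r > 0" "strip r \<inter> S = {}" by blast
    thus ?thesis by (intro that[of "min r 3"]) (auto simp: strip_def)
  qed
  \<comment> \<open>Far enough to the left that \<open>exp t\<close> lies within the disc of
    convergence of \<open>\<xi>\<close>, whose radius is only known to be positive, and that
    \<open>t\<close> lies in \<open>left_half\<close>.\<close>
  obtain \<kappa> where \<kappa>: "\<kappa> \<le> - apery_L" "ereal (exp \<kappa>) < fps_conv_radius xi_fps"
  proof -
    obtain r :: real where r: "0 < r" "ereal r < fps_conv_radius xi_fps"
      using fps_conv_radius_xi_fps_pos ereal_dense2[of 0] by (auto simp: zero_ereal_def)
    have "exp (min (- apery_L) (ln r)) \<le> exp (ln r)" by simp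
    also have "\<dots> = r" using r by simp
    finally have "ereal (exp (min (- apery_L) (ln r))) \<le> ereal r" by simp
    hence "ereal (exp (min (- apery_L) (ln r))) < fps_conv_radius xi_fps"
      using r(2) by (rule order.strict_trans1)
    thus ?thesis by (intro that[of "min (- apery_L) (ln r)"]) auto
  qed
  define G where "G = strip e \<inter> {t. Re t < \<kappa>}"
  have G: "open G" "G \<noteq> {}"
  proof -
    show "open G" unfolding G_def by (intro open_Int open_strip open_halfspace_Re_lt)
    have "Complex (\<kappa> - 1) (e / 2) \<in> G" using e by (simp add: G_def strip_def)
    thus "G \<noteq> {}" by blast
  qed
  have Gr: "norm (exp t) < fps_conv_radius xi_fps" if "t \<in> G" for t
    by (rule order.strict_trans[OF _ \<kappa>(2)]) (use that in \<open>simp add: G_def\<close>)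
  have "\<exists>D'. rel (eval_fps xi_fps) D' \<and> exp ` D' \<subseteq> exp ` G"
    by (rule rel_continuation[OF cont \<open>rel \<xi> D\<close>])
      (use G Gr open_exp_image[OF G(1)] in \<open>auto simp: D_def eball_def\<close>)
  then obtain D' where "rel (eval_fps xi_fps) D'" "D' \<subseteq> G"
    using rel_shift_into G(1) by blast
  then obtain g where D': "open D'" "D' \<noteq> {}" "D' \<subseteq> G" and
    g: "\<And>i. i < N \<Longrightarrow> lsol (p i) (a i) (g i) D'" "\<And>t. t \<in> D' \<Longrightarrow> eval_fps xi_fps (exp t) = eval_mpoly P (\<lambda>i. g i t)"
    unfolding rel_def by blast
  show False
  proof (rule apery_not_hypergeometric_local[OF e(1,2) e(3)[unfolded S_def] m D'(1,2) _ \<Phi>])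
    show "D' \<subseteq> strip e \<inter> left_half" using D'(3) \<kappa>(1) by (auto simp: G_def left_half_def)
    show "lsol (p i) (hyp_coeff (p i) (as i) (bs i) (\<gamma> i) (m i)) (g i) D'" if "i < N" for i
      using g(1)[OF that] by (simp add: a_def)
  qed (use g(2) Gr D' in auto)
qed

section \<open>\<open>\<xi>\<close> is a G-function\<close>

text \<open>The polynomials over the integers form a ring stable under differentiation. Closure
  properties then show that the coefficients of the equation of \<open>\<xi>\<close> are
  polynomials, without expanding them.\<close>

definition int_poly_fps :: "complex fps set"
  where "int_poly_fps = fps_of_poly ` {p. \<forall>i. coeff p i \<in> \<int>}"

lemma int_poly_fps_closed [simp, intro]:
  "F \<in> int_poly_fps \<Longrightarrow> G \<in> int_poly_fps \<Longrightarrow> F + G \<in> int_poly_fps"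
  "F \<in> int_poly_fps \<Longrightarrow> G \<in> int_poly_fps \<Longrightarrow> F - G \<in> int_poly_fps"
  "F \<in> int_poly_fps \<Longrightarrow> G \<in> int_poly_fps \<Longrightarrow> F * G \<in> int_poly_fps"
  "F \<in> int_poly_fps \<Longrightarrow> F ^ n \<in> int_poly_fps"
  "F \<in> int_poly_fps \<Longrightarrow> fps_deriv F \<in> int_poly_fps"
  "fps_X \<in> int_poly_fps" "numeral k \<in> int_poly_fps" "1 \<in> int_poly_fps"
proof -
  show mult: "F * G \<in> int_poly_fps" if FG: "F \<in> int_poly_fps" "G \<in> int_poly_fps" for F G
  proof -
    obtain p q where pq: "F = fps_of_poly p" "G = fps_of_poly q" "\<And>i. coeff p i \<in> \<int>" "\<And>i. coeff q i \<in> \<int>"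
      using FG by (auto simp: int_poly_fps_def)
    have "coeff (p * q) i \<in> \<int>" for i
      using pq by (auto simp: coeff_mult intro!: Ints_sum Ints_mult)
    thus ?thesis unfolding int_poly_fps_def pq fps_of_poly_mult[symmetric] by blast
  qed
  show one: "1 \<in> int_poly_fps"
    unfolding int_poly_fps_def by (rule image_eqI[of _ _ 1]) (auto simp: coeff_1)
  show "F ^ n \<in> int_poly_fps" if "F \<in> int_poly_fps" for F n
    using that by (induction n) (auto intro: one mult)
  show "F + G \<in> int_poly_fps" if FG: "F \<in> int_poly_fps" "G \<in> int_poly_fps" for F G
  proof -
    obtain p q where pq: "F = fps_of_poly p" "G = fps_of_poly q" "\<And>i. coeff p i \<in> \<int>" "\<And>i. coeff q i \<in> \<int>"
      using FG by (auto simp: int_poly_fps_def)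
    have "coeff (p + q) i \<in> \<int>" for i using pq by auto
    thus ?thesis unfolding int_poly_fps_def pq fps_of_poly_add[symmetric] by blast
  qed
  show "F - G \<in> int_poly_fps" if FG: "F \<in> int_poly_fps" "G \<in> int_poly_fps" for F G
  proof -
    obtain p q where pq: "F = fps_of_poly p" "G = fps_of_poly q" "\<And>i. coeff p i \<in> \<int>" "\<And>i. coeff q i \<in> \<int>"
      using FG by (auto simp: int_poly_fps_def)
    have "coeff (p - q) i \<in> \<int>" for i using pq by auto
    thus ?thesis unfolding int_poly_fps_def pq fps_of_poly_diff[symmetric] by blast
  qed
  show "fps_deriv F \<in> int_poly_fps" if F: "F \<in> int_poly_fps" for F
  proof -
    obtain p where p: "F = fps_of_poly p" "\<And>i. coeff p i \<in> \<int>"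
      using F by (auto simp: int_poly_fps_def)
    have "coeff (pderiv p) i \<in> \<int>" for i
      using p Ints_mult[OF Ints_of_nat p(2)] by (simp only: coeff_pderiv)
    thus ?thesis unfolding int_poly_fps_def p fps_of_poly_pderiv[symmetric] by blast
  qed
  show "fps_X \<in> int_poly_fps"
    unfolding int_poly_fps_def by (rule image_eqI[of _ _ "[:0, 1:]"]) (auto simp: coeff_pCons split: nat.splits)
  show "numeral k \<in> int_poly_fps"
    unfolding int_poly_fps_def
    by (rule image_eqI[of _ _ "numeral k"]) (auto simp: numeral_poly coeff_pCons split: nat.splits)
qed

lemma Ints_imp_Qbar: "x \<in> \<int> \<Longrightarrow> x \<in> Qbar"
  by (auto simp: Qbar_def elim!: Ints_cases)

lemma int_poly_fps_Qbar_ratfuns: "F \<in> int_poly_fps \<Longrightarrow> fps_to_fls F \<in> Qbar_ratfuns"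
proof -
  assume "F \<in> int_poly_fps"
  then obtain p where p: "F = fps_of_poly p" "\<And>i. coeff p i \<in> \<int>" by (auto simp: int_poly_fps_def)
  have one: "coeff (1 :: complex poly) i \<in> \<int>" for i by (auto simp: coeff_1)
  have "fps_to_fls F = fps_to_fls (fps_of_poly p) / fps_to_fls (fps_of_poly 1)"
    by (simp add: p)
  moreover have "(\<forall>i. coeff p i \<in> Qbar) \<and> (\<forall>i. coeff (1 :: complex poly) i \<in> Qbar) \<and> (1 :: complex poly) \<noteq> 0"
    by (intro conjI allI Ints_imp_Qbar p(2) one) simp
  ultimately show ?thesis unfolding Qbar_ratfuns_def mem_Collect_eq
    by - (rule exI[of _ p], rule exI[of _ 1], rule conjI)
qed

lemma fls_deriv_funpow_fps_to_fls:
  "(fls_deriv ^^ j) (fps_to_fls F) = fps_to_fls ((fps_deriv ^^ j) F)"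
  by (induction j) (auto simp: fls_deriv_fps_to_fls)

lemma apery_sqrt_fps_square: "apery_sqrt_fps * apery_sqrt_fps = fps_X ^ 2 - 34 * fps_X + 1"
  and apery_sqrt_fps_nth_0: "fps_nth apery_sqrt_fps 0 = 1"
  using apery_sqrt_fps_unique[of apery_sqrt_fps] by (auto simp: power2_eq_square)

text \<open>Writing the root as \<open>1 - 17 x + 2 r\<close> turns its defining equation into
  \<open>r + r^2 = 17 x r - 72 x^2\<close>. As \<open>r\<close> has no constant term, this
  determines its coefficients recursively within the integers.\<close>

lemma apery_sqrt_fps_Ints: "fps_nth apery_sqrt_fps n \<in> \<int>"
proof -
  define r where "r = (apery_sqrt_fps - (1 - 17 * fps_X)) * fps_const (1 / 2)"
  have two: "2 * fps_const (1 / 2) = (1 :: complex fps)"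
    by (simp add: numeral_fps_const)
  have s: "apery_sqrt_fps = 1 - 17 * fps_X + 2 * r"
  proof -
    have "2 * r = (apery_sqrt_fps - (1 - 17 * fps_X)) * (2 * fps_const (1 / 2))"
      by (simp only: r_def mult_ac)
    thus ?thesis by (simp add: two)
  qed
  have "4 * (r + r * r) = 4 * (17 * (fps_X * r) - 72 * fps_X ^ 2)"
    using apery_sqrt_fps_square unfolding s by (simp add: algebra_simps power2_eq_square)
  hence eq: "r + r * r = 17 * (fps_X * r) - 72 * fps_X ^ 2"
    by (rule mult_left_cancel[THEN iffD1, rotated]) simp
  have num: "fps_nth (numeral k * F) n = numeral k * fps_nth F n" for k and F :: "complex fps" and n
    by (simp add: numeral_fps_const)
  have r0: "fps_nth r 0 = 0"
    by (simp add: r_def apery_sqrt_fps_nth_0 num)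
  have r: "fps_nth r n \<in> \<int>" for n
  proof (induction n rule: less_induct)
    case (less n)
    have "fps_nth r n = 17 * fps_nth (fps_X * r) n - 72 * fps_nth (fps_X ^ 2) n - fps_nth (r * r) n"
      using arg_cong[OF eq, of "\<lambda>F. fps_nth F n"]
      by (simp only: num fps_add_nth fps_sub_nth eq_diff_eq diff_diff_eq2)
    moreover have "fps_nth (fps_X * r) n \<in> \<int>"
      using less[of "n - 1"] by (cases n) auto
    moreover have "fps_nth (fps_X ^ 2 :: complex fps) n \<in> \<int>"
      by (simp add: fps_X_power_iff)
    moreover have "fps_nth (r * r) n \<in> \<int>"
      unfolding fps_mult_nth
    proof (rule Ints_sum)
      fix i assume "i \<in> {0..n}"
      then consider "i = 0" | "i = n" | "i < n" "n - i < n" by fastforce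
      thus "fps_nth r i * fps_nth r (n - i) \<in> \<int>"
        using less by cases (auto simp: r0)
    qed
    ultimately show ?case by simp
  qed
  show ?thesis unfolding s
    using r[of n] by (auto simp: num fps_X_def)
qed

lemma xi_fps_Ints: "fps_nth xi_fps n \<in> \<int>"
proof -
  have "fps_nth (apery_sqrt_fps * apery_fps) m \<in> \<int>" for m
    unfolding fps_mult_nth
    by (intro Ints_sum Ints_mult apery_sqrt_fps_Ints) (simp only: apery_fps_def fps_nth_Abs_fps Ints_of_nat)
  thus ?thesis by (cases n) (auto simp: xi_fps_def mult.assoc)
qed

lemma fps_nth_geometric_bound:
  fixes F :: "complex fps"
  assumes "fps_conv_radius F > 0"
  shows "\<exists>C::real. C > 0 \<and> (\<forall>n. norm (fps_nth F n) \<le> C ^ (n + 1))"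
proof -
  obtain r where r: "ereal 0 < ereal r" "ereal r < fps_conv_radius F"
    using ereal_dense2[of 0 "fps_conv_radius F"] assms by (auto simp: zero_ereal_def)
  have "summable (\<lambda>n. fps_nth F n * of_real r ^ n)"
    using r by (intro summable_fps) auto
  hence "Bseq (\<lambda>n. fps_nth F n * of_real r ^ n)"
    by (rule summable_imp_Bseq)
  then obtain K where K: "K > 0" "\<And>n. norm (fps_nth F n * of_real r ^ n) \<le> K"
    by (auto simp: Bseq_def)
  define C where "C = max K (1 / r)"
  have "norm (fps_nth F n) \<le> C ^ (n + 1)" for n
  proof -
    have "norm (fps_nth F n) \<le> K * (1 / r) ^ n"
      using K(2)[of n] r by (simp add: norm_mult norm_power field_simps)
    also have "\<dots> \<le> C * C ^ n"
      using K r by (intro mult_mono power_mono) (auto simp: C_def)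
    finally show ?thesis by simp
  qed
  moreover have "C > 0" using K by (simp add: C_def)
  ultimately show ?thesis by blast
qed

text \<open>Writing \<open>\<xi> = w \<alpha>\<close> with \<open>W w' = V w\<close>, the operator \<open>T F = W F' - V F\<close> satisfies
  \<open>T (w F) = w (W F')\<close>, so an equation for \<open>\<alpha>\<close> in terms of \<open>W \<partial>\<close> becomes one for \<open>\<xi>\<close> in terms of \<open>T\<close>.\<close>

lemma xi_fps_ode:
  "\<exists>c. (\<forall>j. c j \<in> int_poly_fps) \<and> c 3 \<noteq> 0 \<and> (\<Sum>j\<le>3. c j * (fps_deriv ^^ j) xi_fps) = 0"
proof -
  define X where "X = (fps_X :: complex fps)"
  define P where "P = X ^ 2 - 34 * X + 1"
  define Q where "Q = 2 * X ^ 2 - 34 * X"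
  define Q2 where "Q2 = 4 * X ^ 2 - 34 * X"
  define W where "W = X * P"
  define V where "V = 2 * X ^ 2 - 51 * X + 1"
  define B2 where "B2 = 3 * X ^ 2 - 51 * X"
  define B1 where "B1 = 3 * X ^ 2 - 27 * X"
  define B0 where "B0 = X ^ 2 - 5 * X"
  \<comment> \<open>\<open>p2\<close>, \<open>p1\<close>, \<open>p0\<close> are chosen so that
    \<open>\<delta>^3 + p2 \<delta>^2 + p1 \<delta> + p0\<close> is \<open>P^2\<close> times the
    operator of \<open>\<alpha>\<close>, where \<open>\<delta>\<close> is \<open>P\<close> times the
    Euler operator; this keeps all coefficients polynomial.\<close>
  define p2 where "p2 = B2 - 3 * Q"
  define p1 where "p1 = P * B1 - Q ^ 2 - P * Q2 - Q * (B2 - 3 * Q)"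
  define p0 where "p0 = P ^ 2 * B0"
  define T where "T = (\<lambda>F. W * fps_deriv F - V * F)"
  define \<delta> where "\<delta> = (\<lambda>F. W * fps_deriv F)"
  define w where "w = X * apery_sqrt_fps"
  have dX: "fps_deriv X = 1" by (simp add: X_def)
  have dX2: "fps_deriv (X ^ 2) = 2 * X" by (simp add: power2_eq_square dX)
  have dP: "X * fps_deriv P = Q" and dQ: "X * fps_deriv Q = Q2"
    by (simp_all add: P_def Q_def Q2_def dX dX2 algebra_simps power2_eq_square)
  have ss: "apery_sqrt_fps * apery_sqrt_fps = P"
    using apery_sqrt_fps_square by (simp add: P_def X_def)
  have "2 * (apery_sqrt_fps * fps_deriv apery_sqrt_fps) = 2 * (X - 17)"
    using arg_cong[OF ss, of fps_deriv] by (simp add: P_def dX dX2 algebra_simps)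
  hence ds: "apery_sqrt_fps * fps_deriv apery_sqrt_fps = X - 17"
    by (rule mult_left_cancel[THEN iffD1, rotated]) simp
  have dw: "W * fps_deriv w = V * w"
  proof -
    have "P * fps_deriv apery_sqrt_fps = apery_sqrt_fps * (X - 17)"
      unfolding ds[symmetric] ss[symmetric] by (simp add: algebra_simps)
    moreover have "W * fps_deriv w = X * (X * (P * fps_deriv apery_sqrt_fps) + P * apery_sqrt_fps)"
      by (simp add: W_def w_def dX algebra_simps)
    ultimately have "W * fps_deriv w = X * (X * (apery_sqrt_fps * (X - 17)) + P * apery_sqrt_fps)"
      by simp
    thus ?thesis by (simp add: w_def V_def P_def algebra_simps power2_eq_square)
  qed
  have T: "T (w * F) = w * \<delta> F" for F
  proof -
    have "T (w * F) = (W * fps_deriv w - V * w) * F + w * (W * fps_deriv F)"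
      by (simp add: T_def algebra_simps)
    thus ?thesis by (simp add: dw \<delta>_def)
  qed
  define \<theta> where "\<theta> = (\<lambda>j. (fps_theta ^^ j) apery_fps)"
  have \<theta>: "X * fps_deriv (\<theta> j) = \<theta> (Suc j)" for j
    by (simp add: \<theta>_def fps_theta_def X_def)
  have ode: "P * \<theta> 3 + B2 * \<theta> 2 + B1 * \<theta> 1 + B0 * \<theta> 0 = 0"
  proof -
    have "\<theta> 3 - X * (34 * \<theta> 3 + 51 * \<theta> 2 + 27 * \<theta> 1 + 5 * \<theta> 0)
        + X ^ 2 * (\<theta> 3 + 3 * \<theta> 2 + 3 * \<theta> 1 + \<theta> 0) = 0"
      unfolding \<theta>_def X_def by (rule apery_fps_ode)
    thus ?thesis by (simp add: P_def B2_def B1_def B0_def algebra_simps)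
  qed
  have d1: "\<delta> (\<theta> 0) = P * \<theta> 1"
    using \<theta>[of 0] by (simp add: \<delta>_def W_def mult_ac)
  have d2: "\<delta> (\<delta> (\<theta> 0)) = P ^ 2 * \<theta> 2 + P * Q * \<theta> 1"
  proof -
    have "\<delta> (P * \<theta> 1) = P * (P * (X * fps_deriv (\<theta> 1)) + X * fps_deriv P * \<theta> 1)"
      by (simp add: \<delta>_def W_def algebra_simps)
    thus ?thesis using \<theta>[of 1] by (simp add: d1 dP algebra_simps power2_eq_square numeral_2_eq_2)
  qed
  have d3: "\<delta> (\<delta> (\<delta> (\<theta> 0))) = P ^ 3 * \<theta> 3 + 3 * P ^ 2 * Q * \<theta> 2 + (P * Q ^ 2 + P ^ 2 * Q2) * \<theta> 1"
  proof -
    have "\<delta> (P ^ 2 * \<theta> 2 + P * Q * \<theta> 1) = P * (P ^ 2 * (X * fps_deriv (\<theta> 2)) + 2 * P * (X * fps_deriv P) * \<theta> 2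
        + P * Q * (X * fps_deriv (\<theta> 1)) + (P * (X * fps_deriv Q) + (X * fps_deriv P) * Q) * \<theta> 1)"
      by (simp add: \<delta>_def W_def algebra_simps power2_eq_square)
    also have "\<dots> = P ^ 3 * \<theta> 3 + 3 * P ^ 2 * Q * \<theta> 2 + (P * Q ^ 2 + P ^ 2 * Q2) * \<theta> 1"
      unfolding \<theta> dP dQ
      by (simp add: numeral_3_eq_3[symmetric] numeral_2_eq_2[symmetric])
        (simp add: algebra_simps power2_eq_square power3_eq_cube)
    finally show ?thesis by (simp only: d2)
  qed
  have "\<delta> (\<delta> (\<delta> (\<theta> 0))) + p2 * \<delta> (\<delta> (\<theta> 0)) + p1 * \<delta> (\<theta> 0) + p0 * \<theta> 0
      = P ^ 2 * (P * \<theta> 3 + B2 * \<theta> 2 + B1 * \<theta> 1 + B0 * \<theta> 0)"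
    unfolding d3 unfolding d2 unfolding d1 p2_def p1_def p0_def
    by (simp add: algebra_simps power2_eq_square power3_eq_cube)
  hence "w * (\<delta> (\<delta> (\<delta> (\<theta> 0))) + p2 * \<delta> (\<delta> (\<theta> 0)) + p1 * \<delta> (\<theta> 0) + p0 * \<theta> 0) = 0"
    by (simp only: ode mult_zero_right)
  moreover have xi: "xi_fps = w * \<theta> 0" by (simp add: xi_fps_def w_def \<theta>_def X_def)
  ultimately have *: "T (T (T xi_fps)) + p2 * T (T xi_fps) + p1 * T xi_fps + p0 * xi_fps = 0"
    unfolding xi T by (simp add: algebra_simps)
  define a where "a = W ^ 2"
  define b where "b = W * fps_deriv W - 2 * V * W"
  define c where "c = V ^ 2 - W * fps_deriv V"
  define d where "d = (\<lambda>j. (fps_deriv ^^ j) xi_fps)"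
  have d: "fps_deriv (d j) = d (Suc j)" for j by (simp add: d_def)
  have T1: "T (d 0) = W * d 1 - V * d 0" by (simp add: T_def d)
  have T2: "T (T (d 0)) = a * d 2 + b * d 1 + c * d 0"
    unfolding T1 by (simp add: T_def d a_def b_def c_def algebra_simps power2_eq_square numeral_2_eq_2)
  have T3: "T (T (T (d 0))) = W * a * d 3 + (W * fps_deriv a + W * b - V * a) * d 2
      + (W * fps_deriv b + W * c - V * b) * d 1 + (W * fps_deriv c - V * c) * d 0"
    unfolding T2 by (simp add: T_def d algebra_simps numeral_2_eq_2 numeral_3_eq_3)
  define C where "C = (\<lambda>j::nat. if j = 3 then W * a else if j = 2 then W * fps_deriv a + W * b - V * a + p2 * a
    else if j = 1 then W * fps_deriv b + W * c - V * b + p2 * b + p1 * W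
    else W * fps_deriv c - V * c + p2 * c - p1 * V + p0)"
  have base: "X \<in> int_poly_fps" by (simp add: X_def)
  have poly: "P \<in> int_poly_fps" "Q \<in> int_poly_fps" "Q2 \<in> int_poly_fps" "W \<in> int_poly_fps" "V \<in> int_poly_fps"
    "B2 \<in> int_poly_fps" "B1 \<in> int_poly_fps" "B0 \<in> int_poly_fps"
    unfolding P_def Q_def Q2_def W_def V_def B2_def B1_def B0_def by (simp_all add: base)
  have poly': "p2 \<in> int_poly_fps" "p1 \<in> int_poly_fps" "p0 \<in> int_poly_fps"
    "a \<in> int_poly_fps" "b \<in> int_poly_fps" "c \<in> int_poly_fps"
    unfolding p2_def p1_def p0_def a_def b_def c_def by (simp_all add: poly)
  have C: "C j \<in> int_poly_fps" for j
    unfolding C_def using poly poly' by simp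
  have C3: "C 3 \<noteq> 0"
  proof -
    have "fps_nth P 0 = 1" by (simp add: P_def X_def numeral_fps_const)
    hence "P \<noteq> 0" by force
    moreover have "X \<noteq> 0" by (simp add: X_def)
    ultimately show ?thesis by (simp add: C_def a_def W_def)
  qed
  have "(\<Sum>j\<le>3. C j * (fps_deriv ^^ j) xi_fps) = 0"
  proof -
    have "(\<Sum>j\<le>3. C j * d j) = C 0 * d 0 + C 1 * d 1 + C 2 * d 2 + C 3 * d 3"
      by (simp add: eval_nat_numeral)
    also have "\<dots> = T (T (T (d 0))) + p2 * T (T (d 0)) + p1 * T (d 0) + p0 * d 0"
      unfolding T3 unfolding T2 unfolding T1 by (simp add: C_def algebra_simps)
    also have "\<dots> = 0" using * by (simp add: d_def)
    finally show ?thesis by (simp add: d_def)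
  qed
  with C C3 show ?thesis by (intro exI[of _ C] conjI allI)
qed

text \<open>The coefficients are integers: every automorphism fixes them, so the growth condition
  reduces to a positive radius of convergence, and 1 serves as common denominator.\<close>

lemma G_function_xi_fps: "G_function xi_fps"
  unfolding G_function_def
proof (intro conjI)
  show "\<forall>n. fps_nth xi_fps n \<in> Qbar"
    by (intro allI Ints_imp_Qbar xi_fps_Ints)
  obtain c where c: "\<forall>j. c j \<in> int_poly_fps" "c 3 \<noteq> 0"
    "(\<Sum>j\<le>3. c j * (fps_deriv ^^ j) xi_fps) = 0"
    using xi_fps_ode by (elim exE conjE)
  have sum: "fps_to_fls (\<Sum>j\<in>A. f j) = (\<Sum>j\<in>A. fps_to_fls (f j))" for f :: "nat \<Rightarrow> complex fps" and A
    by (induction A rule: infinite_finite_induct) auto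
  have "(\<Sum>j\<le>3. fps_to_fls (c j) * (fls_deriv ^^ j) (fps_to_fls xi_fps)) = fps_to_fls (\<Sum>j\<le>3. c j * (fps_deriv ^^ j) xi_fps)"
    by (simp only: fls_deriv_funpow_fps_to_fls sum fls_times_fps_to_fls)
  hence "(\<Sum>j\<le>3. fps_to_fls (c j) * (fls_deriv ^^ j) (fps_to_fls xi_fps)) = 0"
    by (simp only: c(3) fps_zero_to_fls)
  moreover have "\<forall>j\<le>3. fps_to_fls (c j) \<in> Qbar_ratfuns"
    using c(1) int_poly_fps_Qbar_ratfuns by blast
  moreover have "\<exists>j\<le>3::nat. fps_to_fls (c j) \<noteq> 0"
    using c(2) by (intro exI[of _ 3]) auto
  ultimately show "\<exists>(r::nat) c. (\<forall>j\<le>r. c j \<in> Qbar_ratfuns) \<and> (\<exists>j\<le>r. c j \<noteq> 0) \<and>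
        (\<Sum>j\<le>r. c j * (fls_deriv ^^ j) (fps_to_fls xi_fps)) = 0"
    by - (rule exI[of _ 3], rule exI[of _ "\<lambda>j. fps_to_fls (c j)"], intro conjI)
  obtain C :: real where C: "C > 0" "\<forall>n. norm (fps_nth xi_fps n) \<le> C ^ (n + 1)"
    using fps_nth_geometric_bound[OF fps_conv_radius_xi_fps_pos] by (elim exE conjE)
  have "norm (\<sigma> (fps_nth xi_fps n)) \<le> C ^ (n + 1)" if "\<sigma> \<in> Gal_Qbar" for \<sigma> n
  proof -
    have "\<sigma> (fps_nth xi_fps n) = fps_nth xi_fps n"
      using that xi_fps_Ints[of n] Ints_subset_Rats by (auto simp: Gal_Qbar_def)
    thus ?thesis using C(2) by metis
  qed
  thus "\<exists>C::real. C > 0 \<and> (\<forall>\<sigma>\<in>Gal_Qbar. \<forall>n. norm (\<sigma> (fps_nth xi_fps n)) \<le> C ^ (n + 1))"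
    using C(1) by (intro exI[of _ C] conjI ballI allI)
  show "\<exists>(D::real) (d :: nat \<Rightarrow> int). D > 0 \<and>
        (\<forall>n. 1 \<le> d n \<and> of_int (d n) \<le> D ^ (n + 1) \<and>
          (\<forall>m\<le>n. algebraic_int (of_int (d n) * fps_nth xi_fps m)))"
    using xi_fps_Ints by (intro exI[of _ 1] exI[of _ "\<lambda>_. 1"]) (auto intro: int_imp_algebraic_int)
qed

theorem corollary3:
  shows "G_function xi_fps \<and>
    \<not> (\<exists>(U :: complex set) (\<xi> :: complex \<Rightarrow> complex) (N :: nat)
          (f :: nat \<Rightarrow> complex \<Rightarrow> complex) (P :: cmpoly).
        fps_branch xi_fps \<xi> U \<and>
        (\<forall>i<N. admissible_branch (f i) U) \<and>
        P \<in> Qbar_mpoly N \<and>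
        (\<forall>x\<in>U. \<xi> x = eval_mpoly P (\<lambda>i. f i x)))"
proof (intro conjI notI)
  show "G_function xi_fps"
    by (rule G_function_xi_fps)
next
  assume "\<exists>(U :: complex set) (\<xi> :: complex \<Rightarrow> complex) (N :: nat)
          (f :: nat \<Rightarrow> complex \<Rightarrow> complex) (P :: cmpoly).
        fps_branch xi_fps \<xi> U \<and>
        (\<forall>i<N. admissible_branch (f i) U) \<and>
        P \<in> Qbar_mpoly N \<and>
        (\<forall>x\<in>U. \<xi> x = eval_mpoly P (\<lambda>i. f i x))"
  then obtain U :: "complex set" and \<xi> :: "complex \<Rightarrow> complex" and N :: nat
      and f :: "nat \<Rightarrow> complex \<Rightarrow> complex" and P :: cmpoly
    where *: "fps_branch xi_fps \<xi> U" "\<forall>i<N. admissible_branch (f i) U"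
      "P \<in> Qbar_mpoly N" "\<forall>x\<in>U. \<xi> x = eval_mpoly P (\<lambda>i. f i x)"
    by (elim exE conjE)
  show False
  proof (rule xi_not_hypergeometric[OF *(1) _ *(3)])
    show "admissible_branch (f i) U" if "i < N" for i
      using *(2) that by blast
    show "\<xi> x = eval_mpoly P (\<lambda>i. f i x)" if "x \<in> U" for x
      using *(4) that by blast
  qed
qed

end
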